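(* Let $L$ be a nilpotent subalgebra of rank $n\ge 3$ over $R$ of the Lie algebra $W(A)$, let $Z=Z(L)$ be the center of $L$, suppose $\operatorname{rk}_R Z\ge n-2$, and let $F$ be the field of constants of $L$ in $R$. Then one of the following statements holds: 1) $\dim_F FL=n$ and $FL$ is either abelian or is a direct sum of a nonabelian nilpotent Lie algebra of dimension $3$ and an abelian Lie algebra (over $F$); 2) $\dim_F FL\ge n+1$ and $FL$ lies in a locally nilpotent subalgebra of $W(A)$ of rank $n$ over $R$ which has a basis $D_1,\dots,D_n$ over $R$ satisfying $[D_i,D_j]=0$ for all $i,j=1,\dots,n$, and which is of one of the following two forms: $$L_1=F\Big\langle \Big\{\tfrac{b^i}{i!}D_1\Big\}_{i=0}^{\infty},\dots,\Big\{\tfrac{b^i}{i!}D_{n-1}\Big\}_{i=0}^{\infty},\,D_n\Big\rangle$$ for some $b\in R$ such that $D_i(b)=0$ for $i=1,\dots,n-1$ and $D_n(b)=1$; or $$L_2=F\Big\langle \Big\{\tfrac{a^ib^j}{i!j!}D_1\Big\}_{i,j=0}^{\infty},\dots,\Big\{\tfrac{a^ib^j}{i!j!}D_{n-2}\Big\}_{i,j=0}^{\infty},\,\Big\{\tfrac{b^i}{i!}D_{n-1}\Big\}_{i=0}^{\infty},\,D_n\Big\rangle$$ for some $a,b\in R$ such that $D_{n-1}(a)=1$, $D_n(a)=0$, $D_{n-1}(b)=0$, $D_n(b)=1$, and $D_i(a)=D_i(b)=0$ for $i=1,\dots,n-2$.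
   Context: $\mathbb K$ is a field of characteristic zero, $A$ is an integral domain over $\mathbb K$ (a commutative $\mathbb K$-algebra without zero divisors), and $R=\operatorname{Frac}(A)$ is its field of fractions. $\operatorname{Der}_{\mathbb K}A$ is the Lie algebra over $\mathbb K$ of all $\mathbb K$-derivations of $A$ with bracket $[D_1,D_2]=D_1D_2-D_2D_1$; each derivation of $A$ extends uniquely to $R$, so $\operatorname{Der}_{\mathbb K}A\subseteq\operatorname{Der}_{\mathbb K}R$. $W(A):=R\operatorname{Der}_{\mathbb K}A$ (the $R$-linear span) is a subalgebra of the $\mathbb K$-Lie algebra $\operatorname{Der}_{\mathbb K}R$ (it is a Lie algebra over $\mathbb K$, not over $R$, but it is a vector space over $R$). For a subalgebra $L\subseteq W(A)$ (or a subset such as its center), $\operatorname{rk}_R L:=\dim_R RL$, where $RL$ is the $R$-linear span; a basis of $L$ over $R$ is a maximal subset of $L$ that is linearly independent over $R$. The field of constants of $L$ in $R$ is $F=F(L)=\{r\in R \mid D(r)=0 \text{ for all } D\in L\}$. $FL$ is the $F$-linear span of $L$; it is a Lie algebra over $F$. The notation $F\langle\,\cdot\,\rangle$ denotes the set of all (finite) linear combinations with coefficients in $F$ of the listed elements. A Lie algebra is locally nilpotent if each of its finitely generated subalgebras is nilpotent. The abelian summand in 1) may be zero. *)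

theory Defs
  imports
    "HOL-Computational_Algebra.Computational_Algebra"
    "HOL-Library.Function_Algebras"
    "HOL-Library.Extended_Nat"
begin

locale domain_algebra = vector_space scale
  for scale :: "'k::field_char_0 \<Rightarrow> 'a::idom \<Rightarrow> 'a" +
  assumes scale_mult_left: "scale c x * y = scale c (x * y)"

definition fract_scale :: "('k::field \<Rightarrow> 'a::idom \<Rightarrow> 'a) \<Rightarrow> 'k \<Rightarrow> 'a fract \<Rightarrow> 'a fract"
  where "fract_scale scale c r = to_fract (scale c 1) * r"

text \<open>The image of the base field in the field of fractions.\<close>

definition base_field :: "('k::field \<Rightarrow> 'a::idom \<Rightarrow> 'a) \<Rightarrow> 'a fract set"
  where "base_field scale = range (\<lambda>c. to_fract (scale c 1))"

lemma (in domain_algebra) domain_algebra_fract_scale: "domain_algebra (fract_scale scale)"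
proof
  have mult: "scale (c * d) 1 = scale c 1 * scale d 1" for c d
    by (simp add: scale_mult_left)
  show "fract_scale scale c (x + y) = fract_scale scale c x + fract_scale scale c y" for c x y
    by (simp add: fract_scale_def algebra_simps)
  show "fract_scale scale (c + d) x = fract_scale scale c x + fract_scale scale d x" for c d x
    by (simp add: fract_scale_def scale_left_distrib algebra_simps)
  show "fract_scale scale c (fract_scale scale d x) = fract_scale scale (c * d) x" for c d x
    by (simp add: fract_scale_def mult mult.assoc del: scale_scale)
  show "fract_scale scale 1 x = x" for x
    by (simp add: fract_scale_def)
  show "fract_scale scale c x * y = fract_scale scale c (x * y)" for c x y
    by (simp add: fract_scale_def mult.assoc)
qed


definition Der :: "('k::field \<Rightarrow> 'b::comm_ring_1 \<Rightarrow> 'b) \<Rightarrow> ('b \<Rightarrow> 'b) set"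
  where "Der scale =
    {D. Vector_Spaces.linear scale scale D \<and> (\<forall>x y. D (x * y) = D x * y + x * D y)}"

definition lie_bracket :: "('r::ab_group_add \<Rightarrow> 'r) \<Rightarrow> ('r \<Rightarrow> 'r) \<Rightarrow> 'r \<Rightarrow> 'r"
  where "lie_bracket D E = (\<lambda>x. D (E x) - E (D x))"

definition smul :: "'r::field \<Rightarrow> ('r \<Rightarrow> 'r) \<Rightarrow> 'r \<Rightarrow> 'r"
  where "smul r D = (\<lambda>x. r * D x)"

global_interpretation op: vector_space smul
  by unfold_locales (simp_all add: smul_def fun_eq_iff algebra_simps)

text \<open>Every derivation of \<open>A\<close> has exactly one extension to a derivation of the field of fractions;
  the set below consists of these extensions.\<close>

definition W :: "('k::field \<Rightarrow> 'a::idom \<Rightarrow> 'a) \<Rightarrow> ('a fract \<Rightarrow> 'a fract) set"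
  where "W scale = op.span
    {E \<in> Der (fract_scale scale). \<exists>D \<in> Der scale. \<forall>x. E (to_fract x) = to_fract (D x)}"

text \<open>\<open>op.dim\<close> takes the value 0 on spaces of infinite dimension, so this is the rank only for
  sets of finite rank.\<close>

definition rk :: "('r::field \<Rightarrow> 'r) set \<Rightarrow> nat"
  where "rk L = op.dim (op.span L)"

definition basis_over_R :: "('r::field \<Rightarrow> 'r) set \<Rightarrow> ('r \<Rightarrow> 'r) set \<Rightarrow> bool"
  where "basis_over_R L B \<longleftrightarrow> B \<subseteq> L \<and> op.independent B \<and>
    (\<forall>B'. B \<subseteq> B' \<and> B' \<subseteq> L \<and> op.independent B' \<longrightarrow> B' = B)"


text \<open>Linear algebra over a subfield \<open>F\<close> of \<open>R\<close>, which is a set rather than a type; compare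
  \<open>module.span_explicit\<close>, \<open>module.dependent_explicit\<close> and \<open>vector_space.dim_def\<close>.\<close>

definition span_over :: "'r::field set \<Rightarrow> ('r \<Rightarrow> 'r) set \<Rightarrow> ('r \<Rightarrow> 'r) set"
  where "span_over F S = {\<Sum>v\<in>T. smul (c v) v | T c. finite T \<and> T \<subseteq> S \<and> c ` T \<subseteq> F}"

definition indep_over :: "'r::field set \<Rightarrow> ('r \<Rightarrow> 'r) set \<Rightarrow> bool"
  where "indep_over F B \<longleftrightarrow> (\<forall>T c. finite T \<and> T \<subseteq> B \<and> c ` T \<subseteq> F \<and>
    (\<Sum>v\<in>T. smul (c v) v) = 0 \<longrightarrow> (\<forall>v\<in>T. c v = 0))"

definition basis_over :: "'r::field set \<Rightarrow> ('r \<Rightarrow> 'r) set \<Rightarrow> ('r \<Rightarrow> 'r) set \<Rightarrow> bool"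
  where "basis_over F V B \<longleftrightarrow> indep_over F B \<and> span_over F B = V"

definition dim_over :: "'r::field set \<Rightarrow> ('r \<Rightarrow> 'r) set \<Rightarrow> enat"
  where "dim_over F V =
    (if \<exists>B. finite B \<and> basis_over F V B
     then enat (card (SOME B. finite B \<and> basis_over F V B)) else \<infinity>)"

definition subspace_over :: "'r::field set \<Rightarrow> ('r \<Rightarrow> 'r) set \<Rightarrow> bool"
  where "subspace_over F V \<longleftrightarrow> 0 \<in> V \<and> (\<forall>x\<in>V. \<forall>y\<in>V. x + y \<in> V) \<and> (\<forall>c\<in>F. \<forall>x\<in>V. smul c x \<in> V)"

lemma span_over_UNIV: "span_over UNIV S = op.span S"
  by (auto simp: span_over_def op.span_explicit)

lemma indep_over_UNIV: "indep_over UNIV B \<longleftrightarrow> op.independent B"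
  unfolding indep_over_def op.dependent_explicit by blast

lemma subspace_over_UNIV: "subspace_over UNIV V \<longleftrightarrow> op.subspace V"
  by (auto simp: subspace_over_def op.subspace_def)


text \<open>A Lie algebra is a set of maps \<open>R \<Rightarrow> R\<close> together with its field of scalars \<open>F\<close>: the image of the
  base field for subalgebras of \<open>W\<close>, the field of constants for \<open>FL\<close>. The bracket is
  \<open>F\<close>-bilinear on maps that are \<open>F\<close>-linear, but not on arbitrary ones.\<close>

definition lie_subalgebra :: "'r::field set \<Rightarrow> ('r \<Rightarrow> 'r) set \<Rightarrow> bool"
  where "lie_subalgebra F L \<longleftrightarrow> subspace_over F L \<and> (\<forall>x\<in>L. \<forall>y\<in>L. lie_bracket x y \<in> L)"

definition lie_abelian :: "('r::field \<Rightarrow> 'r) set \<Rightarrow> bool"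
  where "lie_abelian L \<longleftrightarrow> (\<forall>x\<in>L. \<forall>y\<in>L. lie_bracket x y = 0)"

definition lie_center :: "('r::field \<Rightarrow> 'r) set \<Rightarrow> ('r \<Rightarrow> 'r) set"
  where "lie_center L = {x \<in> L. \<forall>y\<in>L. lie_bracket x y = 0}"

primrec lower_central :: "'r::field set \<Rightarrow> ('r \<Rightarrow> 'r) set \<Rightarrow> nat \<Rightarrow> ('r \<Rightarrow> 'r) set"
  where
    "lower_central F L 0 = L"
  | "lower_central F L (Suc k) = span_over F {lie_bracket x y | x y. x \<in> L \<and> y \<in> lower_central F L k}"

definition lie_nilpotent :: "'r::field set \<Rightarrow> ('r \<Rightarrow> 'r) set \<Rightarrow> bool"
  where "lie_nilpotent F L \<longleftrightarrow> (\<exists>k. lower_central F L k = {0})"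

definition lie_locally_nilpotent :: "'r::field set \<Rightarrow> ('r \<Rightarrow> 'r) set \<Rightarrow> bool"
  where "lie_locally_nilpotent F L \<longleftrightarrow>
    (\<forall>S. finite S \<and> S \<subseteq> L \<longrightarrow> lie_nilpotent F (lie_subalgebra F hull S))"

definition lie_ideal :: "'r::field set \<Rightarrow> ('r \<Rightarrow> 'r) set \<Rightarrow> ('r \<Rightarrow> 'r) set \<Rightarrow> bool"
  where "lie_ideal F L I \<longleftrightarrow> subspace_over F I \<and> I \<subseteq> L \<and> (\<forall>x\<in>L. \<forall>y\<in>I. lie_bracket x y \<in> I)"

definition lie_direct_sum ::
    "'r::field set \<Rightarrow> ('r \<Rightarrow> 'r) set \<Rightarrow> ('r \<Rightarrow> 'r) set \<Rightarrow> ('r \<Rightarrow> 'r) set \<Rightarrow> bool"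
  where "lie_direct_sum F L M N \<longleftrightarrow> lie_ideal F L M \<and> lie_ideal F L N \<and>
    M \<inter> N = {0} \<and> L = {x + y | x y. x \<in> M \<and> y \<in> N}"

definition constants :: "('r::field \<Rightarrow> 'r) set \<Rightarrow> 'r set"
  where "constants L = {r. \<forall>D\<in>L. D r = 0}"


definition L1 :: "'r::field set \<Rightarrow> nat \<Rightarrow> (nat \<Rightarrow> 'r \<Rightarrow> 'r) \<Rightarrow> 'r \<Rightarrow> ('r \<Rightarrow> 'r) set"
  where "L1 F n D b = span_over F
    ({smul (b ^ i / of_nat (fact i)) (D k) | i k. k \<in> {1..n - 1}} \<union> {D n})"

definition L2 :: "'r::field set \<Rightarrow> nat \<Rightarrow> (nat \<Rightarrow> 'r \<Rightarrow> 'r) \<Rightarrow> 'r \<Rightarrow> 'r \<Rightarrow> ('r \<Rightarrow> 'r) set"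
  where "L2 F n D a b = span_over F
    ({smul (a ^ i * b ^ j / (of_nat (fact i) * of_nat (fact j))) (D k) | i j k. k \<in> {1..n - 2}}
     \<union> {smul (b ^ i / of_nat (fact i)) (D (n - 1)) | i. True} \<union> {D n})"

end

theory Submission
  imports Defs
begin

text \<open>
  The proof works in moving coordinates. Choose \<open>m = n - 2\<close> central elements
  \<open>D\<^sub>1, \<dots>, D\<^sub>m\<close> of \<open>L\<close> that are independent over
  \<open>R\<close>. Since \<open>L\<close> is nilpotent and has rank \<open>m + 2\<close>, some
  \<open>P \<in> L\<close> outside their span is central modulo that span; complete by \<open>Q
  \<in> L\<close>. Every element of \<open>L\<close> is a combination \<open>\<Sum> r\<^sub>i
  D\<^sub>i + p P + q Q\<close> (\<open>exists_nilpotent_frame\<close>), and the question is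
  which functions occur as coefficients.

  Central elements commute with \<open>L\<close>, so all coefficients lie in the field
  \<open>K\<close> killed by the \<open>D\<^sub>i\<close>, and on \<open>K\<close> the
  derivations \<open>P\<close> and \<open>Q\<close> commute. The coefficient \<open>q\<close>
  must be a constant: if it were not, some element of \<open>L\<close> would act on the
  \<open>Q\<close>-component by a nonzero scalar (\<open>Q_coef_in_F\<close>). Brackets with
  \<open>P\<close> and \<open>Q\<close> differentiate the other coefficients, up to terms that
  involve \<open>[P,Q]\<close>, and lead down the lower central series to 0. Hence every ring
  \<open>T\<close> with \<open>F \<subseteq> T \<subseteq> R\<close> that is closed under
  integration, in the sense that a function of \<open>K\<close> belongs to \<open>T\<close> as
  soon as its derivatives under \<open>P\<close> and \<open>Q\<close> do, contains all
  coefficients (\<open>coefs_in\<close>).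

  If all coefficients are constants, \<open>F L\<close> is spanned by the frame, and
  \<open>[P,Q]\<close> is the only bracket that may be nonzero: the algebra is abelian or a
  Heisenberg algebra plus an abelian summand (\<open>constant_coefs\<close>). Otherwise
  \<open>F\<close> itself is not closed under integration: there are nonconstant functions in
  \<open>K\<close> with constant derivatives under \<open>P\<close> and \<open>Q\<close>. Modulo
  constants they form a space of dimension 1 or 2 over \<open>F\<close>. In dimension 2 it
  contains \<open>a\<close>, \<open>b\<close> dual to \<open>P\<close>, \<open>Q\<close>, and
  \<open>F[a,b]\<close> is closed under integration; in dimension 1, after a constant change of
  \<open>P\<close> and \<open>Q\<close>, the ring \<open>F[b]\<close> is. The bracket
  \<open>[P,Q]\<close> also has polynomial coefficients, so subtracting antiderivatives of them
  times the \<open>D\<^sub>i\<close> from one of the two directions makes the frame commute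
  without leaving the polynomial coefficients (\<open>straighten1\<close>,
  \<open>straighten2\<close>). In the new frame \<open>F L\<close> lies in the algebra of the
  form \<open>L\<^sub>1\<close> or \<open>L\<^sub>2\<close>.

  These algebras are locally nilpotent because finitely many elements have bounded degrees, and
  for a suitable weight every bracket lowers the bound
  (\<open>coef_space_lie_subalgebra_locally_nilpotent\<close>).
\<close>

section \<open>Linear algebra over a subfield\<close>

definition subfield :: "'r::field set \<Rightarrow> bool"
  where "subfield F \<longleftrightarrow> 0 \<in> F \<and> 1 \<in> F \<and> (\<forall>x\<in>F. \<forall>y\<in>F. x + y \<in> F \<and> x * y \<in> F) \<and>
    (\<forall>x\<in>F. - x \<in> F \<and> inverse x \<in> F)"

lemma subfieldD:
  assumes "subfield F"
  shows "0 \<in> F" "1 \<in> F" "x \<in> F \<Longrightarrow> y \<in> F \<Longrightarrow> x + y \<in> F" "x \<in> F \<Longrightarrow> y \<in> F \<Longrightarrow> x * y \<in> F"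
    "x \<in> F \<Longrightarrow> - x \<in> F" "x \<in> F \<Longrightarrow> y \<in> F \<Longrightarrow> x - y \<in> F" "x \<in> F \<Longrightarrow> inverse x \<in> F"
    "x \<in> F \<Longrightarrow> y \<in> F \<Longrightarrow> x / y \<in> F" "of_nat k \<in> F"
proof -
  show *: "0 \<in> F" "1 \<in> F" "\<And>x y. x \<in> F \<Longrightarrow> y \<in> F \<Longrightarrow> x + y \<in> F"
    "\<And>x y. x \<in> F \<Longrightarrow> y \<in> F \<Longrightarrow> x * y \<in> F"
    "\<And>x. x \<in> F \<Longrightarrow> - x \<in> F" "\<And>x. x \<in> F \<Longrightarrow> inverse x \<in> F"
    using assms by (auto simp: subfield_def)
  show "x \<in> F \<Longrightarrow> y \<in> F \<Longrightarrow> x - y \<in> F" using *(3)[of x "- y"] *(5)[of y] by simp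
  show "x \<in> F \<Longrightarrow> y \<in> F \<Longrightarrow> x / y \<in> F" by (simp add: divide_inverse *)
  show "of_nat k \<in> F" by (induction k) (use * in auto)
qed

lemma subfield_sum:
  assumes "subfield F" "\<And>i. i \<in> A \<Longrightarrow> f i \<in> F"
  shows "sum f A \<in> F"
  using assms(2) by (induction A rule: infinite_finite_induct) (auto simp: subfieldD[OF assms(1)])

lemma sum_fun_apply: "(\<Sum>v\<in>T. f v) x = (\<Sum>v\<in>T. f v x)"
  by (induction T rule: infinite_finite_induct) auto

text \<open>Gaussian elimination: one unknown is removed together with one equation, and no step
  leaves the subfield.\<close>

lemma homogeneous_system:
  fixes A :: "'j \<Rightarrow> nat \<Rightarrow> 'r::field"
  assumes F: "subfield F" and "finite J" "card J > k" "\<And>j i. j \<in> J \<Longrightarrow> A j i \<in> F"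
  shows "\<exists>c. c ` J \<subseteq> F \<and> (\<exists>j\<in>J. c j \<noteq> 0) \<and> (\<forall>i<k. (\<Sum>j\<in>J. c j * A j i) = 0)"
  using assms(2-)
proof (induction k arbitrary: J A)
  case 0
  then obtain j where "j \<in> J" by fastforce
  then show ?case using subfieldD[OF F] by (intro exI[of _ "\<lambda>_. 1"]) auto
next
  case (Suc k)
  show ?case
  proof (cases "\<forall>j\<in>J. A j k = 0")
    case True
    obtain c where c: "c ` J \<subseteq> F" "\<exists>j\<in>J. c j \<noteq> 0" "\<forall>i<k. (\<Sum>j\<in>J. c j * A j i) = 0"
      using Suc.IH[of J A] Suc.prems by auto
    then have "\<forall>i<Suc k. (\<Sum>j\<in>J. c j * A j i) = 0"
      using True by (auto simp: less_Suc_eq)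
    then show ?thesis using c by blast
  next
    case False
    then obtain u where u: "u \<in> J" "A u k \<noteq> 0" by blast
    define K where "K = J - {u}"
    have K: "finite K" "card K > k" "K \<subseteq> J" "u \<notin> K" "J = insert u K"
      using Suc.prems u by (auto simp: K_def)
    define B where "B = (\<lambda>j i. A j i - A j k / A u k * A u i)"
    have "\<And>j i. j \<in> K \<Longrightarrow> B j i \<in> F"
      using Suc.prems(3) u K(3) unfolding B_def by (intro subfieldD[OF F]) auto
    then obtain c where c: "c ` K \<subseteq> F" "\<exists>j\<in>K. c j \<noteq> 0" "\<forall>i<k. (\<Sum>j\<in>K. c j * B j i) = 0"
      using Suc.IH[of K B] K by blast
    define cu where "cu = - (\<Sum>j\<in>K. c j * (A j k / A u k))"
    have cu: "cu \<in> F" unfolding cu_def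
      using c(1) Suc.prems(3) u K(3) by (intro subfieldD[OF F] subfield_sum[OF F]) auto
    have eq: "(\<Sum>j\<in>J. (c(u := cu)) j * A j i) = (\<Sum>j\<in>K. c j * B j i)" for i
    proof -
      have "(\<Sum>j\<in>J. (c(u := cu)) j * A j i) = cu * A u i + (\<Sum>j\<in>K. (c(u := cu)) j * A j i)"
        using K by simp
      also have "(\<Sum>j\<in>K. (c(u := cu)) j * A j i) = (\<Sum>j\<in>K. c j * A j i)"
        using K(4) by (intro sum.cong) auto
      also have "cu * A u i = - (\<Sum>j\<in>K. c j * (A j k / A u k * A u i))"
        by (simp add: cu_def sum_distrib_right mult.assoc)
      finally show ?thesis by (simp add: B_def right_diff_distrib sum_subtractf)
    qed
    have "B j k = 0" for j using u by (simp add: B_def)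
    then have "\<forall>i<Suc k. (\<Sum>j\<in>J. (c(u := cu)) j * A j i) = 0"
      using c(3) unfolding eq by (auto simp: less_Suc_eq)
    moreover have "\<exists>j\<in>J. (c(u := cu)) j \<noteq> 0" using c(2) K by force
    moreover have "(c(u := cu)) ` J \<subseteq> F" using c(1) cu K by auto
    ultimately show ?thesis by blast
  qed
qed

lemma span_over_base:
  assumes "subfield F" "x \<in> S"
  shows "x \<in> span_over F S"
  unfolding span_over_def
  using assms by (intro CollectI exI[of _ "{x}"] exI[of _ "\<lambda>_. 1"])
    (auto simp: subfieldD smul_def)

lemma span_over_minimal:
  assumes V: "subspace_over F V" and "S \<subseteq> V"
  shows "span_over F S \<subseteq> V"
proof
  fix x assume "x \<in> span_over F S"
  then obtain T c where x: "x = (\<Sum>v\<in>T. smul (c v) v)" and T: "finite T" "T \<subseteq> S" "c ` T \<subseteq> F"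
    by (auto simp: span_over_def)
  from T have "(\<Sum>v\<in>T. smul (c v) v) \<in> V"
    by (induction T rule: finite_induct) (use assms in \<open>auto simp: subspace_over_def\<close>)
  then show "x \<in> V" by (simp add: x)
qed

lemma span_over_subspace:
  assumes F: "subfield F"
  shows "subspace_over F (span_over F S)"
  unfolding subspace_over_def
proof (intro conjI ballI)
  show "0 \<in> span_over F S"
    unfolding span_over_def by (rule CollectI, rule exI[of _ "{}"]) auto
next
  fix x y assume "x \<in> span_over F S" "y \<in> span_over F S"
  then obtain T c U d where x: "x = (\<Sum>v\<in>T. smul (c v) v)" and T: "finite T" "T \<subseteq> S" "c ` T \<subseteq> F"
    and y: "y = (\<Sum>v\<in>U. smul (d v) v)" and U: "finite U" "U \<subseteq> S" "d ` U \<subseteq> F"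
    by (auto simp: span_over_def)
  define e where "e = (\<lambda>v. (if v \<in> T then c v else 0) + (if v \<in> U then d v else 0))"
  have "x = (\<Sum>v\<in>T \<union> U. smul (if v \<in> T then c v else 0) v)"
    unfolding x using T U by (intro sum.mono_neutral_cong_left) (auto simp: smul_def)
  moreover have "y = (\<Sum>v\<in>T \<union> U. smul (if v \<in> U then d v else 0) v)"
    unfolding y using T U by (intro sum.mono_neutral_cong_left) (auto simp: smul_def)
  ultimately have "x + y = (\<Sum>v\<in>T \<union> U. smul (e v) v)"
    by (simp add: e_def op.scale_left_distrib sum.distrib)
  moreover have "e v \<in> F" for v
    unfolding e_def using T(3) U(3) by (intro subfieldD(3)[OF F]) (auto simp: subfieldD(1)[OF F])
  then have "e ` (T \<union> U) \<subseteq> F" by blast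
  ultimately show "x + y \<in> span_over F S"
    unfolding span_over_def using T(1,2) U(1,2)
    by (intro CollectI exI[of _ "T \<union> U"] exI[of _ e]) auto
next
  fix a x assume a: "a \<in> F" and "x \<in> span_over F S"
  then obtain T c where x: "x = (\<Sum>v\<in>T. smul (c v) v)" and T: "finite T" "T \<subseteq> S" "c ` T \<subseteq> F"
    by (auto simp: span_over_def)
  have "smul a x = (\<Sum>v\<in>T. smul (a * c v) v)"
    unfolding x by (simp add: op.scale_sum_right)
  moreover have "(\<lambda>v. a * c v) ` T \<subseteq> F"
    using T(3) subfieldD(4)[OF F a] by blast
  ultimately show "smul a x \<in> span_over F S"
    unfolding span_over_def using T(1,2)
    by (intro CollectI exI[of _ T] exI[of _ "\<lambda>v. a * c v"]) auto
qed

lemma indep_over_subset_field: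
  assumes "op.independent B"
  shows "indep_over F B"
  using assms unfolding indep_over_UNIV[symmetric] indep_over_def by blast

text \<open>The exchange inequality. It cannot be read off from linear algebra over the whole
  field, since vectors that are independent over the subfield may become dependent over the
  field.\<close>

lemma card_indep_over_le:
  assumes F: "subfield F" and S: "finite S" and T: "T \<subseteq> span_over F S" "indep_over F T"
  shows "finite T \<and> card T \<le> card S"
proof (rule ccontr)
  assume neg: "\<not> (finite T \<and> card T \<le> card S)"
  obtain J where J: "J \<subseteq> T" "finite J" "card J > card S"
  proof (cases "finite T")
    case True then show ?thesis using neg that[of T] by auto
  next
    case False
    then obtain J where "finite J" "card J = Suc (card S)" "J \<subseteq> T"
      using infinite_arbitrarily_large by blast
    then show ?thesis using that by auto
  qed
  obtain s where s: "bij_betw s {..<card S} S"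
    using ex_bij_betw_nat_finite[OF S] by (auto simp: lessThan_atLeast0)
  have "\<exists>a. (\<forall>v. a v \<in> F) \<and> j = (\<Sum>v\<in>S. smul (a v) v)" if jJ: "j \<in> J" for j
  proof -
    obtain U c where j: "j = (\<Sum>v\<in>U. smul (c v) v)" and U: "finite U" "U \<subseteq> S" "c ` U \<subseteq> F"
      using subsetD[OF T(1) subsetD[OF J(1) jJ]] unfolding span_over_def by blast
    have "j = (\<Sum>v\<in>S. smul (if v \<in> U then c v else 0) v)"
      unfolding j using U S by (intro sum.mono_neutral_cong_left) (auto simp: smul_def)
    then show ?thesis using U(3) subfieldD(1)[OF F]
      by (intro exI[of _ "\<lambda>v. if v \<in> U then c v else 0"]) auto
  qed
  then obtain a where a: "\<And>j v. j \<in> J \<Longrightarrow> a j v \<in> F"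
      "\<And>j. j \<in> J \<Longrightarrow> j = (\<Sum>v\<in>S. smul (a j v) v)"
    by metis
  obtain c where c: "c ` J \<subseteq> F" "\<exists>j\<in>J. c j \<noteq> 0"
      "\<forall>i<card S. (\<Sum>j\<in>J. c j * a j (s i)) = 0"
    using homogeneous_system[OF F J(2,3), of "\<lambda>j i. a j (s i)"] a(1) by auto
  have 0: "(\<Sum>j\<in>J. c j * a j v) = 0" if "v \<in> S" for v
  proof -
    have "v \<in> s ` {..<card S}" using s that by (simp add: bij_betw_def)
    then show ?thesis using c(3) by auto
  qed
  have "(\<Sum>j\<in>J. smul (c j) j) = (\<Sum>j\<in>J. smul (c j) (\<Sum>v\<in>S. smul (a j v) v))"
    by (intro sum.cong refl arg_cong[where f = "smul _"] a(2))
  also have "\<dots> = (\<Sum>v\<in>S. \<Sum>j\<in>J. smul (c j * a j v) v)"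
    by (simp add: op.scale_sum_right sum.swap[of _ S])
  also have "\<dots> = 0"
    by (rule sum.neutral, rule ballI) (simp only: op.scale_sum_left[symmetric] 0 op.scale_zero_left)
  finally have "\<forall>j\<in>J. c j = 0"
    using T(2) J(1,2) c(1) unfolding indep_over_def by blast
  then show False using c(2) by blast
qed

lemma dim_over_eq_card:
  assumes F: "subfield F" and B: "finite B" "basis_over F V B"
  shows "dim_over F V = enat (card B)"
proof -
  define C where "C = (SOME B. finite B \<and> basis_over F V B)"
  have C: "finite C \<and> basis_over F V C"
    unfolding C_def by (rule someI[of _ B]) (use B in auto)
  have sub: "X \<subseteq> span_over F X" for X :: "('a \<Rightarrow> 'a) set" using span_over_base[OF F] by blast
  have "card C \<le> card B" "card B \<le> card C"
    using card_indep_over_le[OF F, of B C] card_indep_over_le[OF F, of C B] B C sub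
    by (auto simp: basis_over_def)
  then show ?thesis using B C_def by (auto simp: dim_over_def)
qed

lemma dim_over_ge_card:
  assumes F: "subfield F" and T: "T \<subseteq> V" "indep_over F T"
  shows "enat (card T) \<le> dim_over F V"
proof (cases "\<exists>B. finite B \<and> basis_over F V B")
  case True
  then obtain B where B: "finite B" "basis_over F V B" by blast
  then have "card T \<le> card B"
    using card_indep_over_le[OF F B(1), of T] T by (auto simp: basis_over_def)
  then show ?thesis using dim_over_eq_card[OF F B] by simp
next
  case False
  then have "dim_over F V = \<infinity>" unfolding dim_over_def by (rule if_not_P)
  then show ?thesis by simp
qed

section \<open>Spans of monomials\<close>

text \<open>The span of a set of field elements over a subfield, generated one summand at a time
  so that linear maps can be controlled on the generators alone.\<close>

inductive_set lin :: "'r::field set \<Rightarrow> 'r set \<Rightarrow> 'r set" for F S where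
  zero: "0 \<in> lin F S"
| add: "f \<in> lin F S \<Longrightarrow> c \<in> F \<Longrightarrow> s \<in> S \<Longrightarrow> f + c * s \<in> lin F S"

lemma lin_mono:
  assumes "S \<subseteq> S'"
  shows "lin F S \<subseteq> lin F S'"
proof
  fix f assume "f \<in> lin F S"
  then show "f \<in> lin F S'" by induction (use assms in \<open>auto intro: lin.intros\<close>)
qed

lemma lin_plus:
  assumes "f \<in> lin F S" "g \<in> lin F S"
  shows "f + g \<in> lin F S"
  using assms(2) by induction (use assms(1) in \<open>auto intro: lin.intros simp: add.assoc[symmetric]\<close>)

lemma lin_scale:
  assumes "subfield F" "c \<in> F" "f \<in> lin F S"
  shows "c * f \<in> lin F S"
  using assms(3)
  by induction (use assms(1,2) in
      \<open>auto intro: lin.intros subfieldD simp: distrib_left mult.assoc[symmetric]\<close>)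

lemma lin_base:
  assumes "subfield F" "s \<in> S"
  shows "s \<in> lin F S"
  using lin.add[OF lin.zero subfieldD(2)[OF assms(1)] assms(2)] by simp

lemma lin_map:
  assumes "\<And>f h. g (f + h) = g f + g h" "\<And>c s. c \<in> F \<Longrightarrow> s \<in> S \<Longrightarrow> g (c * s) = c * g s"
    and "\<And>s. s \<in> S \<Longrightarrow> g s \<in> lin F S'" and "subfield F" "f \<in> lin F S"
  shows "g f \<in> lin F S'"
  using assms(5)
proof induction
  case zero
  have "g 0 = g 0 + g 0" using assms(1)[of 0 0] by simp
  then have "g 0 = 0" by (metis add_cancel_right_right)
  then show ?case by (simp add: lin.zero)
next
  case (add f c s)
  then show ?case by (simp add: assms lin_plus lin_scale)
qed

lemma lin_times:
  assumes F: "subfield F" and "\<And>s t. s \<in> S \<Longrightarrow> t \<in> S' \<Longrightarrow> s * t \<in> lin F S''"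
    and "f \<in> lin F S" "g \<in> lin F S'"
  shows "f * g \<in> lin F S''"
proof -
  have "s * g \<in> lin F S''" if "s \<in> S" for s
    by (rule lin_map[of "(*) s", OF _ _ _ F assms(4)]) (simp_all only: distrib_left mult.left_commute assms(2)[OF that])
  then have "f * g \<in> lin F S''"
    by (intro lin_map[of "\<lambda>x. x * g", OF _ _ _ F assms(3)])
      (simp_all only: distrib_right mult.assoc)
  then show ?thesis .
qed

text \<open>Used with a derivation as the map: antiderivatives need to be found for monomials
  only.\<close>

lemma lin_preimage:
  assumes "\<And>f h. g (f + h) = g f + g h" "\<And>c f. c \<in> F \<Longrightarrow> g (c * f) = c * g f"
    and "\<And>s. s \<in> S \<Longrightarrow> \<exists>t\<in>lin F S'. g t = s" and "subfield F" "f \<in> lin F S"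
  shows "\<exists>t\<in>lin F S'. g t = f"
  using assms(5)
proof induction
  case zero
  have "g 0 = g 0 + g 0" using assms(1)[of 0 0] by simp
  then have "g 0 = 0" by (metis add_cancel_right_right)
  then show ?case using lin.zero by blast
next
  case (add f c s)
  then obtain t u where "t \<in> lin F S'" "g t = f" "u \<in> lin F S'" "g u = s" using assms(3) by blast
  then have "t + c * u \<in> lin F S'" "g (t + c * u) = f + c * s"
    using add by (simp_all add: assms lin_plus lin_scale)
  then show ?case by blast
qed

lemma lin_induct_linear:
  assumes "f \<in> lin F S" "\<phi> 0" "\<And>f h. \<phi> f \<Longrightarrow> \<phi> h \<Longrightarrow> \<phi> (f + h)" "\<And>c s. c \<in> F \<Longrightarrow> s \<in> S \<Longrightarrow> \<phi> (c * s)"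
  shows "\<phi> f"
  using assms(1) by induction (use assms in auto)

section \<open>Derivations in coordinates\<close>

definition derivation :: "('r::field \<Rightarrow> 'r) \<Rightarrow> bool"
  where "derivation d \<longleftrightarrow> (\<forall>x y. d (x + y) = d x + d y) \<and> (\<forall>x y. d (x * y) = d x * y + x * d y)"

lemma derivation_simps:
  assumes "derivation d"
  shows "d (x + y) = d x + d y" "d (x * y) = d x * y + x * d y"
    "d 0 = 0" "d 1 = 0" "d (- x) = - d x" "d (x - y) = d x - d y"
    "d (of_nat k) = 0"
    "d (\<Sum>i\<in>A. f i) = (\<Sum>i\<in>A. d (f i))"
    "d (x ^ Suc k) = of_nat (Suc k) * x ^ k * d x"
proof -
  show add: "d (x + y) = d x + d y" for x y using assms by (simp add: derivation_def)
  show mult: "d (x * y) = d x * y + x * d y" for x y using assms by (simp add: derivation_def)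
  have "d 0 = d 0 + d 0" using add[of 0 0] by simp
  then show 0: "d 0 = 0" by (metis add_cancel_right_right)
  have "d 1 = d 1 + d 1" using mult[of 1 1] by simp
  then show 1: "d 1 = 0" by (metis add_cancel_right_right)
  show minus: "d (- x) = - d x" for x
    using add[of x "- x"] 0 by (simp add: add_eq_0_iff)
  show "d (x - y) = d x - d y" using add[of x "- y"] minus by simp
  show "d (of_nat k) = 0" by (induction k) (simp_all add: 0 1 add)
  show "d (\<Sum>i\<in>A. f i) = (\<Sum>i\<in>A. d (f i))"
    by (induction A rule: infinite_finite_induct) (simp_all add: 0 add)
  show "d (x ^ Suc k) = of_nat (Suc k) * x ^ k * d x"
    by (induction k) (simp_all add: mult algebra_simps)
qed

lemma derivation_inverse:
  assumes "derivation d" "d x = 0"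
  shows "d (inverse x) = 0"
proof (cases "x = 0")
  case False
  have "d (x * inverse x) = x * d (inverse x)"
    using assms(2) by (simp only: derivation_simps(2)[OF assms(1)]) simp
  then show ?thesis using False derivation_simps(4)[OF assms(1)] by simp
qed (simp add: derivation_simps[OF assms(1)])

lemma subfield_constants:
  assumes "\<And>d. d \<in> L \<Longrightarrow> derivation d"
  shows "subfield (constants L)"
  unfolding subfield_def constants_def
  using assms by (auto simp: derivation_simps derivation_inverse)

lemma derivation_add: "derivation d \<Longrightarrow> derivation e \<Longrightarrow> derivation (\<lambda>x. d x + e x)"
  by (simp add: derivation_def algebra_simps)

lemma derivation_mult: "derivation d \<Longrightarrow> derivation (\<lambda>x. c * d x)"
  by (simp add: derivation_def algebra_simps)

lemma derivation_sum:
  assumes "\<And>i. i \<in> A \<Longrightarrow> derivation (d i)"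
  shows "derivation (\<lambda>x. \<Sum>i\<in>A. d i x)"
  using assms
  by (induction A rule: infinite_finite_induct)
    (auto intro: derivation_add, simp_all add: derivation_def)

lemma lie_bracket_skew:
  fixes D E :: "'r::field \<Rightarrow> 'r"
  shows "lie_bracket D E = - lie_bracket E D"
  by (simp add: lie_bracket_def fun_eq_iff)

text \<open>The two directions \<open>P\<close> and \<open>Q\<close> are kept apart from the
  \<open>m\<close> others because in the applications the \<open>D i\<close> commute with
  everything of interest, so that the whole Lie structure sits in \<open>P\<close> and
  \<open>Q\<close>.\<close>

definition comb :: "nat \<Rightarrow> (nat \<Rightarrow> 'r::field \<Rightarrow> 'r) \<Rightarrow> ('r \<Rightarrow> 'r) \<Rightarrow> ('r \<Rightarrow> 'r) \<Rightarrow>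
    (nat \<Rightarrow> 'r) \<Rightarrow> 'r \<Rightarrow> 'r \<Rightarrow> 'r \<Rightarrow> 'r"
  where "comb m D P Q r p q = (\<lambda>x. (\<Sum>i\<in>{1..m}. r i * D i x) + p * P x + q * Q x)"

lemma comb_plus: "comb m D P Q r p q + comb m D P Q r' p' q' =
    comb m D P Q (\<lambda>i. r i + r' i) (p + p') (q + q')"
  by (simp add: comb_def fun_eq_iff sum.distrib algebra_simps)

lemma comb_minus: "comb m D P Q r p q - comb m D P Q r' p' q' =
    comb m D P Q (\<lambda>i. r i - r' i) (p - p') (q - q')"
  by (simp add: comb_def fun_eq_iff sum_subtractf algebra_simps)

lemma comb_uminus: "- comb m D P Q r p q = comb m D P Q (\<lambda>i. - r i) (- p) (- q)"
  by (simp add: comb_def fun_eq_iff sum_negf)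

lemma comb_scale: "smul c (comb m D P Q r p q) = comb m D P Q (\<lambda>i. c * r i) (c * p) (c * q)"
  by (simp add: comb_def smul_def fun_eq_iff sum_distrib_left algebra_simps)

lemma comb_zero: "comb m D P Q (\<lambda>_. 0) 0 0 = 0"
  by (simp add: comb_def fun_eq_iff)

lemma comb_cong:
  assumes "\<And>i. i \<in> {1..m} \<Longrightarrow> r i = r' i"
  shows "comb m D P Q r p q = comb m D P Q r' p q"
  using assms by (simp add: comb_def)

lemma comb_P: "comb m D P Q (\<lambda>_. 0) 1 0 = P" and comb_Q: "comb m D P Q (\<lambda>_. 0) 0 1 = Q"
  by (simp_all add: comb_def fun_eq_iff)

lemma comb_D:
  assumes "j \<in> {1..m}"
  shows "comb m D P Q (\<lambda>i. if i = j then 1 else 0) 0 0 = D j"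
proof
  fix x
  have "(\<Sum>i\<in>{1..m}. (if i = j then 1 else 0) * D i x) = (\<Sum>i\<in>{1..m}. if i = j then D i x else 0)"
    by (intro sum.cong) auto
  then show "comb m D P Q (\<lambda>i. if i = j then 1 else 0) 0 0 x = D j x"
    using assms by (simp add: comb_def)
qed

lemma lie_bracket_comb:
  assumes y: "derivation y"
  shows "lie_bracket y (comb m D P Q r p q) = comb m D P Q (\<lambda>i. y (r i)) (y p) (y q) +
    comb m (\<lambda>i. lie_bracket y (D i)) (lie_bracket y P) (lie_bracket y Q) r p q"
  by (simp add: fun_eq_iff comb_def lie_bracket_def derivation_simps[OF y] sum.distrib
      right_diff_distrib sum_subtractf algebra_simps)

text \<open>Characteristic zero is a hypothesis on the values, so that the field may be a field of
  fractions, whose type does not determine the characteristic.\<close>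

locale frame =
  fixes m :: nat and D :: "nat \<Rightarrow> 'r::field \<Rightarrow> 'r" and P Q :: "'r \<Rightarrow> 'r"
  assumes char0: "\<And>k. k > 0 \<Longrightarrow> of_nat k \<noteq> (0::'r)"
    and derD: "\<And>i. i \<in> {1..m} \<Longrightarrow> derivation (D i)"
    and derP: "derivation P" and derQ: "derivation Q"
    and commD: "\<And>i j. i \<in> {1..m} \<Longrightarrow> j \<in> {1..m} \<Longrightarrow> lie_bracket (D i) (D j) = 0"
    and commP: "\<And>i. i \<in> {1..m} \<Longrightarrow> lie_bracket (D i) P = 0"
    and commQ: "\<And>i. i \<in> {1..m} \<Longrightarrow> lie_bracket (D i) Q = 0"
    and independent: "\<And>r p q. comb m D P Q r p q = 0 \<Longrightarrow> (\<forall>i\<in>{1..m}. r i = 0) \<and> p = 0 \<and> q = 0"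
begin

abbreviation cmb :: "(nat \<Rightarrow> 'r) \<Rightarrow> 'r \<Rightarrow> 'r \<Rightarrow> 'r \<Rightarrow> 'r"
  where "cmb \<equiv> comb m D P Q"

definition K :: "'r set"
  where "K = {c. \<forall>i\<in>{1..m}. D i c = 0}"

definition F :: "'r set"
  where "F = {c \<in> K. P c = 0 \<and> Q c = 0}"

lemma cmb_eq_iff:
  "cmb r p q = cmb r' p' q' \<longleftrightarrow> (\<forall>i\<in>{1..m}. r i = r' i) \<and> p = p' \<and> q = q'"
proof
  assume "cmb r p q = cmb r' p' q'"
  then have "cmb (\<lambda>i. r i - r' i) (p - p') (q - q') = 0"
    by (simp add: comb_minus[symmetric])
  from independent[OF this] show "(\<forall>i\<in>{1..m}. r i = r' i) \<and> p = p' \<and> q = q'" by simp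
qed (auto intro: comb_cong)

lemma derivation_cmb: "derivation (cmb r p q)"
  unfolding comb_def
  by (intro derivation_add derivation_sum derivation_mult derD derP derQ)

lemma F_K: "c \<in> F \<Longrightarrow> c \<in> K" by (simp add: F_def)

lemma cmb_K: "c \<in> K \<Longrightarrow> cmb r p q c = p * P c + q * Q c"
  by (simp add: comb_def K_def)

lemma cmb_F: "c \<in> F \<Longrightarrow> cmb r p q c = 0"
  by (simp add: cmb_K F_def)

lemma constants_eq_F:
  assumes "L \<subseteq> {cmb r p q | r p q. True}" "D ` {1..m} \<subseteq> L" "P \<in> L" "Q \<in> L"
  shows "constants L = F"
proof
  show "constants L \<subseteq> F"
  proof
    fix c assume "c \<in> constants L"
    then have c: "d c = 0" if "d \<in> L" for d using that by (simp add: constants_def)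
    have "D i c = 0" if "i \<in> {1..m}" for i using c assms(2) that by blast
    then show "c \<in> F" using c assms(3,4) by (simp add: F_def K_def)
  qed
  show "F \<subseteq> constants L"
  proof
    fix c assume "c \<in> F"
    then have "d c = 0" if "d \<in> L" for d using assms(1) that cmb_F by blast
    then show "c \<in> constants L" by (simp add: constants_def)
  qed
qed

lemma subfield_F: "subfield F"
proof -
  have "F = constants (D ` {1..m} \<union> {P, Q})" by (auto simp: F_def K_def constants_def)
  moreover have "subfield (constants (D ` {1..m} \<union> {P, Q}))"
    by (rule subfield_constants) (use derD derP derQ in blast)
  ultimately show ?thesis by (rule ssubst)
qed

lemmas F_simps = subfieldD[OF subfield_F]

lemma commute_apply:
  assumes "lie_bracket d e = 0"
  shows "d (e x) = e (d x)"
  using assms by (simp add: lie_bracket_def fun_eq_iff)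

lemma zero_K: "0 \<in> K" using derD by (simp add: K_def derivation_simps)

lemma plus_K: "f \<in> K \<Longrightarrow> g \<in> K \<Longrightarrow> f + g \<in> K"
  using derD by (simp add: K_def derivation_simps)

lemma uminus_K: "f \<in> K \<Longrightarrow> - f \<in> K"
  using derD by (simp add: K_def derivation_simps)

lemma minus_K: "f \<in> K \<Longrightarrow> g \<in> K \<Longrightarrow> f - g \<in> K"
  using derD by (simp add: K_def derivation_simps)

lemma times_K: "f \<in> K \<Longrightarrow> g \<in> K \<Longrightarrow> f * g \<in> K"
  using derD by (simp add: K_def derivation_simps)

lemma power_K: "f \<in> K \<Longrightarrow> f ^ k \<in> K"
  using derD by (induction k) (auto intro: times_K, simp add: K_def derivation_simps)

lemma P_K: "f \<in> K \<Longrightarrow> P f \<in> K"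
  using commute_apply[OF commP] derivation_simps(3)[OF derP] by (simp add: K_def)

lemma Q_K: "f \<in> K \<Longrightarrow> Q f \<in> K"
  using commute_apply[OF commQ] derivation_simps(3)[OF derQ] by (simp add: K_def)

lemma lin_K:
  assumes "S \<subseteq> K"
  shows "lin F S \<subseteq> K"
proof
  fix f assume "f \<in> lin F S"
  then show "f \<in> K"
    by (rule lin_induct_linear) (use assms in \<open>auto intro: zero_K plus_K times_K F_K\<close>)
qed

lemma P_F_linear: "c \<in> F \<Longrightarrow> P (c * f) = c * P f" and Q_F_linear: "c \<in> F \<Longrightarrow> Q (c * f) = c * Q f"
  by (simp_all add: derivation_simps(2)[OF derP] derivation_simps(2)[OF derQ] F_def)

lemmas P_simps = derivation_simps[OF derP] and Q_simps = derivation_simps[OF derQ]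

text \<open>Coefficients in \<open>K\<close> make the first combination commute with every
  \<open>D i\<close>, so that, besides the derivatives of the coefficients, only the bracket of
  \<open>P\<close> with \<open>Q\<close> contributes.\<close>

lemma bracket_cmb:
  assumes x: "x = cmb r p q" and y: "y = cmb r' p' q'"
    and K: "\<And>i. i \<in> {1..m} \<Longrightarrow> r i \<in> K" "p \<in> K" "q \<in> K"
  shows "lie_bracket x y = cmb (\<lambda>i. x (r' i) - y (r i)) (x p' - y p) (x q' - y q)
    + smul (p * q' - q * p') (lie_bracket P Q)"
proof -
  have D0: "lie_bracket (D i) x = 0" if "i \<in> {1..m}" for i
  proof -
    have "lie_bracket (D i) (D j) = 0" if "j \<in> {1..m}" for j using commD that \<open>i \<in> _\<close> by blast
    moreover have "D i (r j) = 0" if "j \<in> {1..m}" for j using K(1)[OF that] \<open>i \<in> _\<close> by (simp add: K_def)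
    moreover have "D i p = 0" "D i q = 0" using K \<open>i \<in> _\<close> by (auto simp: K_def)
    ultimately show ?thesis using commP[OF that] commQ[OF that]
      unfolding x lie_bracket_comb[OF derD[OF that]]
      by (simp add: comb_def fun_eq_iff)
  qed
  have xD: "lie_bracket x (D i) = 0" if "i \<in> {1..m}" for i
    using D0[OF that] lie_bracket_skew[of x "D i"] by simp
  have PD: "lie_bracket P (D i) = 0" and QD: "lie_bracket Q (D i) = 0" if "i \<in> {1..m}" for i
    using commP[OF that] commQ[OF that] lie_bracket_skew[of P "D i"] lie_bracket_skew[of Q "D i"]
    by simp_all
  have dx: "derivation x" unfolding x by (rule derivation_cmb)
  have Px: "lie_bracket P x = cmb (\<lambda>i. P (r i)) (P p) (P q) + smul q (lie_bracket P Q)"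
    unfolding x lie_bracket_comb[OF derP]
    by (simp add: comb_def fun_eq_iff PD smul_def) (simp add: lie_bracket_def)
  have Qx: "lie_bracket Q x = cmb (\<lambda>i. Q (r i)) (Q p) (Q q) - smul p (lie_bracket P Q)"
    unfolding x lie_bracket_comb[OF derQ]
    by (simp add: comb_def fun_eq_iff QD smul_def) (simp add: lie_bracket_def algebra_simps)
  have y0: "y (r i) = p' * P (r i) + q' * Q (r i)" if "i \<in> {1..m}" for i
    using K(1)[OF that] unfolding y by (rule cmb_K)
  have y1: "y p = p' * P p + q' * Q p" "y q = p' * P q + q' * Q q"
    using K unfolding y by (simp_all add: cmb_K)
  have "lie_bracket x y = cmb (\<lambda>i. x (r' i)) (x p') (x q') -
      smul p' (lie_bracket P x) - smul q' (lie_bracket Q x)"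
  proof -
    have "lie_bracket x y = cmb (\<lambda>i. x (r' i)) (x p') (x q') +
        comb m (\<lambda>i. lie_bracket x (D i)) (lie_bracket x P) (lie_bracket x Q) r' p' q'"
      unfolding y by (rule lie_bracket_comb[OF dx])
    then show ?thesis
      by (simp add: comb_def xD fun_eq_iff smul_def lie_bracket_skew[of x P] lie_bracket_skew[of x Q])
  qed
  also have "\<dots> = cmb (\<lambda>i. x (r' i)) (x p') (x q') -
      cmb (\<lambda>i. p' * P (r i) + q' * Q (r i)) (y p) (y q) + smul (p * q' - q * p') (lie_bracket P Q)"
    unfolding Px Qx y1
    by (simp add: comb_def fun_eq_iff smul_def algebra_simps sum.distrib sum_distrib_left)
  also have "cmb (\<lambda>i. p' * P (r i) + q' * Q (r i)) (y p) (y q) = cmb (\<lambda>i. y (r i)) (y p) (y q)"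
    by (intro comb_cong) (simp add: y0)
  finally show ?thesis unfolding comb_minus .
qed

end

section \<open>Locally nilpotent algebras with polynomial coefficients\<close>

definition lin_closed :: "'r::field set \<Rightarrow> 'r set \<Rightarrow> bool"
  where "lin_closed F A \<longleftrightarrow> 0 \<in> A \<and> (\<forall>f\<in>A. \<forall>g\<in>A. f + g \<in> A) \<and> (\<forall>c\<in>F. \<forall>f\<in>A. c * f \<in> A)"

lemma lin_closedD:
  assumes "lin_closed F A"
  shows "0 \<in> A" "f \<in> A \<Longrightarrow> g \<in> A \<Longrightarrow> f + g \<in> A" "c \<in> F \<Longrightarrow> f \<in> A \<Longrightarrow> c * f \<in> A"
  using assms by (auto simp: lin_closed_def)

lemma lin_closed_minus:
  assumes "lin_closed F A" "subfield F" "f \<in> A" "g \<in> A"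
  shows "f - g \<in> A"
proof -
  have "-1 \<in> F" using subfieldD(2,5)[OF assms(2)] by blast
  then have "f + (-1) * g \<in> A" using assms(3,4) lin_closedD[OF assms(1)] by blast
  then show ?thesis by simp
qed

lemma lin_closed_lin:
  assumes "subfield F"
  shows "lin_closed F (lin F S)"
  unfolding lin_closed_def using lin.zero lin_plus lin_scale[OF assms] by blast

lemma lin_closed_zero: "lin_closed F {0}"
  by (simp add: lin_closed_def)

lemma lin_closed_field:
  assumes "subfield F"
  shows "lin_closed F F"
  unfolding lin_closed_def using subfieldD[OF assms] by blast

lemma subspace_over_sum:
  assumes "subspace_over F V" "\<And>i. i \<in> A \<Longrightarrow> f i \<in> V"
  shows "sum f A \<in> V"
  using assms(2)
  by (induction A rule: infinite_finite_induct) (use assms(1) in \<open>auto simp: subspace_over_def\<close>)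

lemma smul_lin_in_span_over:
  assumes F: "subfield F" and "f \<in> lin F S" "\<And>s. s \<in> S \<Longrightarrow> smul s v \<in> span_over F G"
  shows "smul f v \<in> span_over F G"
  using assms(2)
proof (rule lin_induct_linear)
  note sp = span_over_subspace[OF F, of G, unfolded subspace_over_def]
  show "smul 0 v \<in> span_over F G" using sp by simp
  show "smul (f + h) v \<in> span_over F G" if "smul f v \<in> span_over F G" "smul h v \<in> span_over F G" for f h
    using sp that by (simp add: op.scale_left_distrib)
  show "smul (c * s) v \<in> span_over F G" if "c \<in> F" "s \<in> S" for c s
  proof -
    have "smul c (smul s v) \<in> span_over F G" using sp that assms(3) by blast
    then show ?thesis by (simp only: op.scale_scale)
  qed
qed

lemma finite_common_bound:
  fixes X :: "nat \<Rightarrow> 'x set"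
  assumes "finite S" "S \<subseteq> (\<Union>k. X k)" "\<And>j k. j \<le> k \<Longrightarrow> X j \<subseteq> X k"
  shows "\<exists>k. S \<subseteq> X k"
  using assms(1,2)
proof (induction S rule: finite_induct)
  case (insert x S)
  then obtain j k where "x \<in> X j" "S \<subseteq> X k" by auto
  then have "insert x S \<subseteq> X (max j k)" using assms(3)[of j "max j k"] assms(3)[of k "max j k"] by auto
  then show ?case by blast
qed simp

lemma comb_eq_sum: "comb m D P Q r p q = (\<Sum>i\<in>{1..m}. smul (r i) (D i)) + smul p P + smul q Q"
  by (simp add: comb_def fun_eq_iff smul_def sum_fun_apply)

context frame
begin

text \<open>The three sets restrict the coefficients of the \<open>D i\<close>, of
  \<open>P\<close> and of \<open>Q\<close>. With polynomials for the first two and constants for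
  the third, these are the algebras of the second alternative of the theorem.\<close>

definition coef_space :: "'r set \<Rightarrow> 'r set \<Rightarrow> 'r set \<Rightarrow> ('r \<Rightarrow> 'r) set"
  where "coef_space T T' U = {cmb f p q | f p q. (\<forall>i\<in>{1..m}. f i \<in> T) \<and> p \<in> T' \<and> q \<in> U}"

lemma coef_spaceI: "\<lbrakk>\<And>i. i \<in> {1..m} \<Longrightarrow> f i \<in> T; p \<in> T'; q \<in> U\<rbrakk> \<Longrightarrow> cmb f p q \<in> coef_space T T' U"
  unfolding coef_space_def by blast

lemma coef_spaceE:
  assumes "x \<in> coef_space T T' U"
  obtains f p q where "x = cmb f p q" "\<And>i. i \<in> {1..m} \<Longrightarrow> f i \<in> T" "p \<in> T'" "q \<in> U"
  using assms unfolding coef_space_def by blast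

lemma coef_space_mono: "T1 \<subseteq> T2 \<Longrightarrow> T1' \<subseteq> T2' \<Longrightarrow> U1 \<subseteq> U2 \<Longrightarrow> coef_space T1 T1' U1 \<subseteq> coef_space T2 T2' U2"
  unfolding coef_space_def by blast

lemma subspace_over_coef_space:
  assumes "lin_closed F T" "lin_closed F T'" "lin_closed F U"
  shows "subspace_over F (coef_space T T' U)"
  unfolding subspace_over_def
proof (intro conjI ballI)
  show "0 \<in> coef_space T T' U"
    unfolding comb_zero[of m D P Q, symmetric] by (intro coef_spaceI lin_closedD(1)[OF assms(1)] lin_closedD(1)[OF assms(2)] lin_closedD(1)[OF assms(3)])
  show "x + y \<in> coef_space T T' U" if "x \<in> coef_space T T' U" "y \<in> coef_space T T' U" for x y
    using that(1)
  proof (rule coef_spaceE)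
    fix f p q assume x: "x = cmb f p q" "\<And>i. i \<in> {1..m} \<Longrightarrow> f i \<in> T" "p \<in> T'" "q \<in> U"
    from that(2) obtain f' p' q'
      where y: "y = cmb f' p' q'" "\<And>i. i \<in> {1..m} \<Longrightarrow> f' i \<in> T" "p' \<in> T'" "q' \<in> U"
      by (rule coef_spaceE) blast
    show ?thesis unfolding x(1) y(1) comb_plus
      using x y by (intro coef_spaceI lin_closedD(2)[OF assms(1)] lin_closedD(2)[OF assms(2)]
          lin_closedD(2)[OF assms(3)])
  qed
  show "smul c x \<in> coef_space T T' U" if "c \<in> F" "x \<in> coef_space T T' U" for c x
    using that(2)
  proof (rule coef_spaceE)
    fix f p q assume x: "x = cmb f p q" "\<And>i. i \<in> {1..m} \<Longrightarrow> f i \<in> T" "p \<in> T'" "q \<in> U"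
    show ?thesis unfolding x(1) comb_scale
      using x that(1) by (intro coef_spaceI lin_closedD(3)[OF assms(1)] lin_closedD(3)[OF assms(2)]
          lin_closedD(3)[OF assms(3)])
  qed
qed

lemma span_over_eq_coef_space:
  assumes sub: "subspace_over F (coef_space (lin F S) (lin F S') F)" and "G \<subseteq> coef_space (lin F S) (lin F S') F"
    and "\<And>i s. i \<in> {1..m} \<Longrightarrow> s \<in> S \<Longrightarrow> smul s (D i) \<in> span_over F G"
    and "\<And>s. s \<in> S' \<Longrightarrow> smul s P \<in> span_over F G" and "Q \<in> span_over F G"
  shows "span_over F G = coef_space (lin F S) (lin F S') F"
proof
  show "span_over F G \<subseteq> coef_space (lin F S) (lin F S') F" by (rule span_over_minimal[OF assms(1,2)])
  show "coef_space (lin F S) (lin F S') F \<subseteq> span_over F G"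
  proof
    fix x assume "x \<in> coef_space (lin F S) (lin F S') F"
    then obtain f p q where x: "x = cmb f p q" "\<And>i. i \<in> {1..m} \<Longrightarrow> f i \<in> lin F S" "p \<in> lin F S'" "q \<in> F"
      by (rule coef_spaceE) blast
    note sp = span_over_subspace[OF subfield_F, of G]
    have "(\<Sum>i\<in>{1..m}. smul (f i) (D i)) \<in> span_over F G"
      by (intro subspace_over_sum[OF sp] smul_lin_in_span_over[OF subfield_F x(2)] assms(3))
    moreover have "smul p P \<in> span_over F G"
      by (intro smul_lin_in_span_over[OF subfield_F x(3)] assms(4))
    moreover have "smul q Q \<in> span_over F G" using sp x(4) assms(5) by (simp add: subspace_over_def)
    ultimately show "x \<in> span_over F G"
      using sp unfolding x(1) comb_eq_sum subspace_over_def by blast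
  qed
qed

end

locale commuting_frame = frame +
  assumes commPQ: "lie_bracket P Q = 0"
begin

text \<open>The coefficients of a bracket arise by applying one factor to the coefficients of the
  other, so it suffices to control products of coefficients with derivatives of coefficients. The
  coefficient of \<open>Q\<close> is constant and therefore disappears.\<close>

lemma bracket_coef_space:
  assumes x: "x \<in> coef_space T1 T1' F" and y: "y \<in> coef_space T2 T2' U" and U: "U \<subseteq> F"
    and K: "T1 \<subseteq> K" "T2 \<subseteq> K" "T1' \<subseteq> K" "T2' \<subseteq> K"
    and cl: "lin_closed F T3" "lin_closed F T3'"
    and P0: "\<And>p. p \<in> T1' \<union> T2' \<Longrightarrow> P p = 0"
    and 1: "\<And>p f. p \<in> T1' \<Longrightarrow> f \<in> T2 \<Longrightarrow> p * P f \<in> T3" "\<And>f. f \<in> T2 \<Longrightarrow> Q f \<in> T3"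
    and 2: "\<And>p f. p \<in> T2' \<Longrightarrow> f \<in> T1 \<Longrightarrow> p * P f \<in> T3" "\<And>q f. q \<in> U \<Longrightarrow> f \<in> T1 \<Longrightarrow> q * Q f \<in> T3"
    and 3: "\<And>p. p \<in> T2' \<Longrightarrow> Q p \<in> T3'" "\<And>q p. q \<in> U \<Longrightarrow> p \<in> T1' \<Longrightarrow> q * Q p \<in> T3'"
  shows "lie_bracket x y \<in> coef_space T3 T3' {0}"
proof -
  obtain f p q where x: "x = cmb f p q" "\<And>i. i \<in> {1..m} \<Longrightarrow> f i \<in> T1" "p \<in> T1'" "q \<in> F"
    using x by (rule coef_spaceE) blast
  obtain f' p' q' where y: "y = cmb f' p' q'" "\<And>i. i \<in> {1..m} \<Longrightarrow> f' i \<in> T2" "p' \<in> T2'" "q' \<in> U"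
    using y by (rule coef_spaceE) blast
  have "lie_bracket x y = cmb (\<lambda>i. x (f' i) - y (f i)) (x p' - y p) (x q' - y q)"
    using bracket_cmb[OF x(1) y(1)] x y K commPQ F_K by (auto simp: subset_iff)
  moreover have "x (f' i) - y (f i) \<in> T3" if i: "i \<in> {1..m}" for i
  proof -
    have "x (f' i) = p * P (f' i) + q * Q (f' i)" "y (f i) = p' * P (f i) + q' * Q (f i)"
      using x(2)[OF i] y(2)[OF i] K unfolding x(1) y(1) by (auto intro: cmb_K)
    moreover have "p * P (f' i) \<in> T3" "q * Q (f' i) \<in> T3"
      using 1 x(3,4) y(2)[OF i] lin_closedD(3)[OF cl(1)] by blast+
    moreover have "p' * P (f i) \<in> T3" "q' * Q (f i) \<in> T3"
      using 2 y(3,4) x(2)[OF i] by blast+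
    ultimately show ?thesis
      by (simp only: lin_closed_minus[OF cl(1) subfield_F] lin_closedD(2)[OF cl(1)])
  qed
  moreover have "x p' - y p \<in> T3'"
  proof -
    have "x p' = q * Q p'" "y p = q' * Q p"
      using x(3) y(3) K P0 unfolding x(1) y(1) by (auto simp: cmb_K subset_iff)
    moreover have "q * Q p' \<in> T3'" "q' * Q p \<in> T3'"
      using 3 x(3,4) y(3,4) lin_closedD(3)[OF cl(2)] by blast+
    ultimately show ?thesis by (simp only: lin_closed_minus[OF cl(2) subfield_F])
  qed
  moreover have "x q' - y q = 0" using x y U cmb_F by auto
  ultimately show ?thesis using coef_spaceI[of "\<lambda>i. x (f' i) - y (f i)" T3 "x p' - y p" T3' 0 "{0}"] by simp
qed

text \<open>Local nilpotency from a filtration by weight. \<open>U' d\<close> bounds the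
  coefficient of \<open>P\<close> and then \<open>U d e\<close> bounds the other coefficients, in
  a weight that depends on \<open>d\<close>: one application of \<open>P\<close> has to lower that
  weight by more than multiplication by an element of \<open>U' d\<close> raises it. On the
  \<open>k\<close>-th term of the lower central series both bounds are then smaller by
  \<open>k\<close>.\<close>

lemma coef_space_lie_subalgebra_locally_nilpotent:
  fixes U :: "nat \<Rightarrow> nat \<Rightarrow> 'a set" and U' :: "nat \<Rightarrow> 'a set"
  assumes k0: "k0 \<subseteq> F"
    and cl: "\<And>d j. lin_closed F (U d j)" "\<And>j. lin_closed F (U' j)"
    and mono: "\<And>d j k. j \<le> k \<Longrightarrow> U d j \<subseteq> U d k" "\<And>j k. j \<le> k \<Longrightarrow> U' j \<subseteq> U' k"
    and U0: "\<And>d. U d 0 = {0}" "U' 0 = {0}"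
    and K: "\<And>d j. U d j \<subseteq> K" "\<And>j. U' j \<subseteq> K"
    and PU: "\<And>d k j p f. p \<in> U' (d - k) \<Longrightarrow> f \<in> U d j \<Longrightarrow> p * P f \<in> U d (j - Suc k)"
    and QU: "\<And>d j f. f \<in> U d j \<Longrightarrow> Q f \<in> U d (j - 1)"
    and PU': "\<And>j p. p \<in> U' j \<Longrightarrow> P p = 0" and QU': "\<And>j p. p \<in> U' j \<Longrightarrow> Q p \<in> U' (j - 1)"
    and T: "\<And>d. T = (\<Union>j. U d j)" and T': "T' = (\<Union>j. U' j)"
    and clT: "lin_closed F T" "lin_closed F T'"
  shows "lie_subalgebra k0 (coef_space T T' F)" "lie_locally_nilpotent k0 (coef_space T T' F)"
proof -
  note clF = lin_closed_field[OF subfield_F]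
  have sub: "subspace_over k0 V" if "subspace_over F V" for V :: "('a \<Rightarrow> 'a) set"
    using that k0 by (auto simp: subspace_over_def)
  have lie: "lie_bracket x y \<in> coef_space T T' F" if "x \<in> coef_space T T' F" "y \<in> coef_space T T' F" for x y
  proof -
    have "lie_bracket x y \<in> coef_space T T' {0}"
    proof (rule bracket_coef_space[OF that _ _ _ _ _ clT])
      show "T \<subseteq> K" "T \<subseteq> K" "T' \<subseteq> K" "T' \<subseteq> K" using K unfolding T[of 0] T' by blast+
      have P1: "p * P f \<in> T" if p: "p \<in> T'" and f: "f \<in> T" for p f
      proof -
        obtain d where d: "p \<in> U' d" using p unfolding T' by blast
        obtain j where "f \<in> U d j" using f unfolding T[of d] by blast
        then show ?thesis using PU[of p d 0 f j] d unfolding T[of d] by auto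
      qed
      then show "\<And>p f. p \<in> T' \<Longrightarrow> f \<in> T \<Longrightarrow> p * P f \<in> T" "\<And>p f. p \<in> T' \<Longrightarrow> f \<in> T \<Longrightarrow> p * P f \<in> T"
        by auto
      show Q1: "Q f \<in> T" if "f \<in> T" for f using that QU unfolding T[of 0] by blast
      show Q2: "Q p \<in> T'" if "p \<in> T'" for p using that QU' unfolding T' by blast
      show "q * Q f \<in> T" if "q \<in> F" "f \<in> T" for q f using Q1 that lin_closedD(3)[OF clT(1)] by blast
      show "q * Q p \<in> T'" if "q \<in> F" "p \<in> T'" for q p using Q2 that lin_closedD(3)[OF clT(2)] by blast
      show "P p = 0" if "p \<in> T' \<union> T'" for p using that PU' unfolding T' by blast
    qed simp
    then show ?thesis using coef_space_mono[of T T T' T' "{0}" F] F_simps(1) by blast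
  qed
  show "lie_subalgebra k0 (coef_space T T' F)"
    unfolding lie_subalgebra_def using lie sub[OF subspace_over_coef_space[OF clT clF]] by blast
  show "lie_locally_nilpotent k0 (coef_space T T' F)"
    unfolding lie_locally_nilpotent_def
  proof (intro allI impI)
    fix S assume S: "finite S \<and> S \<subseteq> coef_space T T' F"
    have "\<exists>d. S \<subseteq> coef_space T (U' d) F"
    proof (rule finite_common_bound)
      show "S \<subseteq> (\<Union>k. coef_space T (U' k) F)"
      proof
        fix x assume "x \<in> S"
        then obtain f p q where x: "x = cmb f p q" "\<And>i. i \<in> {1..m} \<Longrightarrow> f i \<in> T" "p \<in> T'" "q \<in> F"
          using S by (blast elim: coef_spaceE)
        then obtain d where "p \<in> U' d" unfolding T' by blast
        then have "x \<in> coef_space T (U' d) F" unfolding x(1) using x by (intro coef_spaceI)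
        then show "x \<in> (\<Union>k. coef_space T (U' k) F)" by blast
      qed
    qed (use S mono coef_space_mono in auto)
    then obtain d where d: "S \<subseteq> coef_space T (U' d) F" by blast
    have "\<exists>e. S \<subseteq> coef_space (U d e) (U' d) F"
    proof (rule finite_common_bound)
      show "S \<subseteq> (\<Union>k. coef_space (U d k) (U' d) F)"
      proof
        fix x assume "x \<in> S"
        then obtain f p q where x: "x = cmb f p q" "\<And>i. i \<in> {1..m} \<Longrightarrow> f i \<in> T" "p \<in> U' d" "q \<in> F"
          using d by (blast elim: coef_spaceE)
        have "\<exists>e. f ` {1..m} \<subseteq> U d e"
          by (rule finite_common_bound) (use x(2) mono in \<open>auto simp: T[of d]\<close>)
        then obtain e where "f ` {1..m} \<subseteq> U d e" by blast
        then have "x \<in> coef_space (U d e) (U' d) F" unfolding x(1) using x by (intro coef_spaceI) auto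
        then show "x \<in> (\<Union>k. coef_space (U d k) (U' d) F)" by blast
      qed
    qed (use S mono coef_space_mono in auto)
    then obtain e where e: "S \<subseteq> coef_space (U d e) (U' d) F" by blast
    \<comment> \<open>All brackets lack a component along \<open>Q\<close>, hence the case distinction.\<close>
    define G where "G = (\<lambda>k. coef_space (U d (e - k)) (U' (d - k)) (if k = 0 then F else {0}))"
    have Gsub: "subspace_over k0 (G k)" for k
      unfolding G_def using cl clF lin_closed_zero by (intro sub subspace_over_coef_space) auto
    have G_bracket: "lie_bracket x y \<in> G (Suc k)" if "x \<in> G 0" "y \<in> G k" for x y k
    proof -
      have "lie_bracket x y \<in> coef_space (U d (e - Suc k)) (U' (d - Suc k)) {0}"
      proof (rule bracket_coef_space)
        show "x \<in> coef_space (U d e) (U' d) F" "y \<in> coef_space (U d (e - k)) (U' (d - k)) (if k = 0 then F else {0})"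
          using that by (simp_all add: G_def)
        show "p * P f \<in> U d (e - Suc k)" if "p \<in> U' d" "f \<in> U d (e - k)" for p f
          using PU[of p d 0 f "e - k"] that by simp
        show "p * P f \<in> U d (e - Suc k)" if "p \<in> U' (d - k)" "f \<in> U d e" for p f
          using PU that by blast
        show "Q f \<in> U d (e - Suc k)" if "f \<in> U d (e - k)" for f
          using QU[OF that] by simp
        show "Q f \<in> U' (d - Suc k)" if "f \<in> U' (d - k)" for f
          using QU'[OF that] by simp
        show "q * Q f \<in> U d (e - Suc k)" if "q \<in> (if k = 0 then F else {0})" "f \<in> U d e" for q f
          using QU[OF that(2)] that lin_closedD[OF cl(1)] by (auto split: if_splits)
        show "q * Q f \<in> U' (d - Suc k)" if "q \<in> (if k = 0 then F else {0})" "f \<in> U' d" for q f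
          using QU'[OF that(2)] that lin_closedD[OF cl(2)] by (auto split: if_splits)
      qed (use K cl PU' F_simps(1) in auto)
      then show ?thesis by (simp add: G_def)
    qed
    have "G (Suc k) \<subseteq> G 0" for k
      unfolding G_def using mono F_simps(1) by (intro coef_space_mono) auto
    then have "lie_subalgebra k0 (G 0)"
      unfolding lie_subalgebra_def using Gsub G_bracket[where k = 0] by blast
    define H where "H = lie_subalgebra k0 hull S"
    have "S \<subseteq> G 0" using e by (simp add: G_def)
    then have HG: "H \<subseteq> G 0" unfolding H_def by (rule hull_minimal) fact
    have "0 \<in> H" by (auto simp: H_def hull_def lie_subalgebra_def subspace_over_def)
    have lower0: "0 \<in> lower_central k0 H k" for k
    proof (cases k)
      case (Suc j)
      show ?thesis unfolding Suc lower_central.simps span_over_def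
        by (rule CollectI, rule exI[of _ "{}"]) auto
    qed (use \<open>0 \<in> H\<close> in simp)
    have lower: "lower_central k0 H k \<subseteq> G k" for k
    proof (induction k)
      case (Suc k)
      show ?case unfolding lower_central.simps
        by (rule span_over_minimal[OF Gsub]) (use Suc G_bracket HG in blast)
    qed (use HG in simp)
    have "G (Suc (d + e)) = {cmb f p q | f p q. (\<forall>i\<in>{1..m}. f i = 0) \<and> p = 0 \<and> q = 0}"
      by (simp add: G_def coef_space_def U0)
    moreover have "cmb f 0 0 = 0" if "\<forall>i\<in>{1..m}. f i = 0" for f
      using that comb_cong[of m f "\<lambda>_. 0" D P Q 0 0] comb_zero by simp
    ultimately have "G (Suc (d + e)) \<subseteq> {0}" by auto
    then have "lower_central k0 H (Suc (d + e)) = {0}" using lower lower0 by blast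
    then show "lie_nilpotent k0 (lie_subalgebra k0 hull S)"
      unfolding lie_nilpotent_def H_def by blast
  qed
qed

end

section \<open>Polynomial coefficients in one or two functions\<close>

lemma lin_UN:
  assumes "\<And>j k. j \<le> k \<Longrightarrow> S j \<subseteq> S k"
  shows "lin F (\<Union>j::nat. S j) = (\<Union>j. lin F (S j))"
proof
  show "(\<Union>j. lin F (S j)) \<subseteq> lin F (\<Union>j. S j)" using lin_mono by blast
  show "lin F (\<Union>j. S j) \<subseteq> (\<Union>j. lin F (S j))"
  proof
    fix f assume "f \<in> lin F (\<Union>j. S j)"
    then show "f \<in> (\<Union>j. lin F (S j))"
    proof induction
      case zero then show ?case using lin.zero by blast
    next
      case (add f c s)
      then obtain j k where "f \<in> lin F (S j)" "s \<in> S k" by blast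
      then have "f \<in> lin F (S (max j k))" "s \<in> S (max j k)"
        using assms[of j "max j k"] assms[of k "max j k"] lin_mono[of "S j" "S (max j k)"] by auto
      then show ?case using add.hyps(2) lin.add by blast
    qed
  qed
qed

lemma lin_empty: "lin F {} = {0}"
proof -
  have "f = 0" if "f \<in> lin F {}" for f using that by induction auto
  then show ?thesis using lin.zero[of F "{}"] by blast
qed

lemma derivation_power:
  assumes "derivation d"
  shows "d (x ^ k) = of_nat k * x ^ (k - 1) * d x"
  using derivation_simps[OF assms] by (cases k) auto

definition monom1 :: "'r::field \<Rightarrow> 'r set"
  where "monom1 b = range (\<lambda>j. b ^ j)"

definition monom2 :: "'r::field \<Rightarrow> 'r \<Rightarrow> 'r set"
  where "monom2 a b = {a ^ i * b ^ j | i j. True}"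

context frame
begin

lemmas lin_F = lin_base[OF subfield_F] lin_scale[OF subfield_F] lin_plus lin.zero

lemma monom1_K: "b \<in> K \<Longrightarrow> monom1 b \<subseteq> K"
  using power_K by (auto simp: monom1_def)

lemma monom2_K: "a \<in> K \<Longrightarrow> b \<in> K \<Longrightarrow> monom2 a b \<subseteq> K"
  using power_K times_K by (auto simp: monom2_def)

lemma F_lin_monom1: "F \<subseteq> lin F (monom1 b)"
proof
  fix c assume "c \<in> F"
  moreover have "1 \<in> monom1 b" by (auto simp: monom1_def intro: range_eqI[of _ _ 0])
  ultimately show "c \<in> lin F (monom1 b)" using lin.add[OF lin.zero] by fastforce
qed

lemma lin_monom1_monom2: "lin F (monom1 b) \<subseteq> lin F (monom2 a b)"
proof (rule lin_mono)
  have "b ^ j = a ^ 0 * b ^ j" for j by simp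
  then show "monom1 b \<subseteq> monom2 a b" unfolding monom1_def monom2_def by blast
qed

lemma lin_monom1_times: "f \<in> lin F (monom1 b) \<Longrightarrow> g \<in> lin F (monom1 b) \<Longrightarrow> f * g \<in> lin F (monom1 b)"
proof (rule lin_times[OF subfield_F])
  show "s * t \<in> lin F (monom1 b)" if "s \<in> monom1 b" "t \<in> monom1 b" for s t
    using that by (intro lin_F) (auto simp: monom1_def power_add[symmetric])
qed

lemma lin_monom2_times: "f \<in> lin F (monom2 a b) \<Longrightarrow> g \<in> lin F (monom2 a b) \<Longrightarrow> f * g \<in> lin F (monom2 a b)"
proof (rule lin_times[OF subfield_F])
  show "s * t \<in> lin F (monom2 a b)" if "s \<in> monom2 a b" "t \<in> monom2 a b" for s t
  proof -
    from that obtain i j k l where "s = a ^ i * b ^ j" "t = a ^ k * b ^ l" by (auto simp: monom2_def)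
    then have "s * t = a ^ (i + k) * b ^ (j + l)" by (simp add: power_add)
    then show ?thesis by (intro lin_F) (auto simp: monom2_def)
  qed
qed

lemma P_lin_zero:
  assumes "P b = 0" "f \<in> lin F (monom1 b)"
  shows "P f = 0"
  using assms(2) by (rule lin_induct_linear)
    (auto simp: P_simps P_F_linear monom1_def derivation_power[OF derP] assms(1) F_def)

text \<open>Removes the factorials from the generators of the two families.\<close>

lemma div_smul_span:
  assumes "k > 0" "smul (f / of_nat k) v \<in> span_over F G"
  shows "smul f v \<in> span_over F G"
proof -
  have "smul (of_nat k) (smul (f / of_nat k) v) \<in> span_over F G"
    using span_over_subspace[OF subfield_F, of G] assms(2) F_simps(9)[of k]
    unfolding subspace_over_def by blast
  then show ?thesis using char0[OF assms(1)] by simp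
qed

lemma smul_D_coef_space:
  assumes "i \<in> {1..m}" "f \<in> T" "lin_closed F T" "lin_closed F T'"
  shows "smul f (D i) \<in> coef_space T T' F"
proof -
  have "cmb (\<lambda>j. f * (if j = i then 1 else 0)) (f * 0) (f * 0) \<in> coef_space T T' F"
    using assms(2) lin_closedD(1)[OF assms(3)] lin_closedD(1)[OF assms(4)] F_simps(1)
    by (intro coef_spaceI) auto
  then show ?thesis unfolding comb_scale[symmetric] comb_D[OF assms(1)] .
qed

lemma smul_P_coef_space:
  assumes "f \<in> T'" "lin_closed F T"
  shows "smul f P \<in> coef_space T T' F"
proof -
  have "cmb (\<lambda>j. f * 0) (f * 1) (f * 0) \<in> coef_space T T' F"
    using assms(1) lin_closedD(1)[OF assms(2)] F_simps(1) by (intro coef_spaceI) auto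
  then show ?thesis unfolding comb_scale[symmetric] comb_P .
qed

lemma Q_coef_space:
  assumes "lin_closed F T" "lin_closed F T'"
  shows "Q \<in> coef_space T T' F"
proof -
  have "cmb (\<lambda>j. 0) 0 1 \<in> coef_space T T' F"
    using lin_closedD(1)[OF assms(1)] lin_closedD(1)[OF assms(2)] F_simps(2) by (intro coef_spaceI) auto
  then show ?thesis unfolding comb_Q .
qed

end

context commuting_frame
begin

lemmas closed_lin = lin_closed_lin[OF subfield_F]

lemma Q_power: "Q b = 1 \<Longrightarrow> Q (b ^ j) = of_nat j * b ^ (j - 1)"
  by (simp add: derivation_power[OF derQ])

lemma lin_power_bounded:
  assumes "Q b = 1" "f \<in> lin F {b ^ i | i. i < j}"
  shows "Q f \<in> lin F {b ^ i | i. i < j - 1}"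
proof (rule lin_map[of Q F _ _, OF _ _ _ subfield_F assms(2)])
  fix s assume "s \<in> {b ^ i | i. i < j}"
  then obtain i where i: "s = b ^ i" "i < j" by blast
  show "Q s \<in> lin F {b ^ i | i. i < j - 1}"
  proof (cases i)
    case (Suc k)
    then show ?thesis unfolding i(1) Q_power[OF assms(1)]
      using i(2) by (intro lin_scale[OF subfield_F F_simps(9) lin_base[OF subfield_F]]) auto
  qed (simp add: i(1) Q_simps lin.zero)
qed (simp_all add: Q_simps(1) Q_F_linear)

text \<open>Here \<open>P\<close> kills all coefficients, so the degree in \<open>b\<close>
  already serves as the weight.\<close>

lemma L1_eq_coef_space:
  assumes b: "b \<in> K" "P b = 0" "Q b = 1"
    and E: "\<And>i. i \<in> {1..m} \<Longrightarrow> E i = D i" "E (m + 1) = P" "E (m + 2) = Q"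
    and k0: "k0 \<subseteq> F"
  shows "L1 F (m + 2) E b = coef_space (lin F (monom1 b)) (lin F (monom1 b)) F"
    "lie_subalgebra k0 (coef_space (lin F (monom1 b)) (lin F (monom1 b)) F)"
    "lie_locally_nilpotent k0 (coef_space (lin F (monom1 b)) (lin F (monom1 b)) F)"
proof -
  define G where "G = {smul (b ^ i / of_nat (fact i)) (E k) | i k. k \<in> {1..m + 2 - 1}} \<union> {E (m + 2)}"
  let ?T = "lin F (monom1 b)"
  have T: "b ^ i / of_nat (fact i) \<in> ?T" for i
  proof -
    have "inverse (of_nat (fact i)) * b ^ i \<in> ?T"
      by (intro lin_F F_simps) (auto simp: monom1_def)
    then show ?thesis by (simp add: field_simps)
  qed
  have "L1 F (m + 2) E b = span_over F G" by (simp add: L1_def G_def)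
  also have "\<dots> = coef_space ?T ?T F"
  proof (rule span_over_eq_coef_space)
    show "subspace_over F (coef_space ?T ?T F)"
      by (intro subspace_over_coef_space closed_lin lin_closed_field subfield_F)
    show "G \<subseteq> coef_space ?T ?T F"
    proof
      fix x assume "x \<in> G"
      then consider i k where "x = smul (b ^ i / of_nat (fact i)) (E k)" "k \<in> {1..m}"
        | i where "x = smul (b ^ i / of_nat (fact i)) P" | "x = Q"
        using E by (auto simp: G_def le_Suc_eq)
      then show "x \<in> coef_space ?T ?T F"
        using T by cases (auto simp: E intro: smul_D_coef_space smul_P_coef_space Q_coef_space closed_lin)
    qed
    have gen: "smul s (E k) \<in> span_over F G" if "s \<in> monom1 b" "k \<in> {1..m + 1}" for s k
    proof -
      obtain i where "s = b ^ i" using \<open>s \<in> monom1 b\<close> by (auto simp: monom1_def)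
      moreover have "smul (b ^ i / of_nat (fact i)) (E k) \<in> span_over F G"
        using that(2) by (intro span_over_base[OF subfield_F]) (auto simp: G_def)
      ultimately show ?thesis using div_smul_span[of "fact i"] by simp
    qed
    show "smul s (D i) \<in> span_over F G" if "i \<in> {1..m}" "s \<in> monom1 b" for i s
      using gen[of s i] that E by auto
    show "smul s P \<in> span_over F G" if "s \<in> monom1 b" for s
      using gen[of s "m + 1"] that E by auto
    have "E (m + 2) \<in> span_over F G" by (intro span_over_base[OF subfield_F]) (simp add: G_def)
    then show "Q \<in> span_over F G" by (simp only: E(3))
  qed
  finally show "L1 F (m + 2) E b = coef_space ?T ?T F" .
  define U where "U = (\<lambda>j. lin F {b ^ i | i. i < j})"
  have mono: "U j \<subseteq> U k" if "j \<le> k" for j k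
    unfolding U_def using that by (intro lin_mono) auto
  have "monom1 b = (\<Union>j. {b ^ i | i. i < j})" by (auto simp: monom1_def)
  then have TU: "?T = (\<Union>j. U j)" unfolding U_def by (simp only:) (rule lin_UN, auto)
  have PU: "P f = 0" if "f \<in> U j" for f j
    using P_lin_zero[OF b(2)] that TU by blast
  have zero: "0 \<in> U j" for j by (simp add: U_def lin.zero)
  have UK: "U j \<subseteq> K" for j using TU lin_K[OF monom1_K[OF b(1)]] by blast
  have U0: "U 0 = {0}" by (simp add: U_def lin_empty)
  have cl: "lin_closed F (U j)" "lin_closed F ?T" for j by (simp_all add: U_def closed_lin)
  have QU: "Q f \<in> U (j - 1)" if "f \<in> U j" for f j
    using lin_power_bounded[OF b(3)] that by (simp add: U_def)
  have pPU: "p * P f \<in> U (j - Suc k)" if "p \<in> U (d - k)" "f \<in> U j" for d k j p f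
    using zero PU[OF that(2)] by simp
  note fin = coef_space_lie_subalgebra_locally_nilpotent[where U = "\<lambda>_. U", OF k0 cl(1) cl(1) mono mono
      U0 U0 UK UK pPU QU PU QU TU TU cl(2,2)]
  show "lie_subalgebra k0 (coef_space ?T ?T F)" "lie_locally_nilpotent k0 (coef_space ?T ?T F)"
    by (rule fin; assumption)+
qed

text \<open>A bracket with \<open>p P\<close>, where \<open>p\<close> has degree below
  \<open>d\<close> in \<open>b\<close>, trades one factor \<open>a\<close> for fewer than
  \<open>d\<close> factors \<open>b\<close>. Giving \<open>b\<close> the weight 1 and
  \<open>a\<close> the weight \<open>d + 1\<close> makes this a descent.\<close>

lemma L2_eq_coef_space:
  assumes a: "a \<in> K" "P a = 1" "Q a = 0" and b: "b \<in> K" "P b = 0" "Q b = 1"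
    and E: "\<And>i. i \<in> {1..m} \<Longrightarrow> E i = D i" "E (m + 1) = P" "E (m + 2) = Q"
    and k0: "k0 \<subseteq> F"
  shows "L2 F (m + 2) E a b = coef_space (lin F (monom2 a b)) (lin F (monom1 b)) F"
    "lie_subalgebra k0 (coef_space (lin F (monom2 a b)) (lin F (monom1 b)) F)"
    "lie_locally_nilpotent k0 (coef_space (lin F (monom2 a b)) (lin F (monom1 b)) F)"
proof -
  define G where "G =
    {smul (a ^ i * b ^ j / (of_nat (fact i) * of_nat (fact j))) (E k) | i j k. k \<in> {1..m + 2 - 2}}
     \<union> {smul (b ^ i / of_nat (fact i)) (E (m + 2 - 1)) | i. True} \<union> {E (m + 2)}"
  let ?T = "lin F (monom2 a b)" and ?T' = "lin F (monom1 b)"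
  have T: "a ^ i * b ^ j / (of_nat (fact i) * of_nat (fact j)) \<in> ?T" for i j
  proof -
    have "inverse (of_nat (fact i) * of_nat (fact j)) * (a ^ i * b ^ j) \<in> ?T"
      by (intro lin_F F_simps) (auto simp: monom2_def)
    then show ?thesis by (simp add: field_simps)
  qed
  have T': "b ^ i / of_nat (fact i) \<in> ?T'" for i
  proof -
    have "inverse (of_nat (fact i)) * b ^ i \<in> ?T'"
      by (intro lin_F F_simps) (auto simp: monom1_def)
    then show ?thesis by (simp add: field_simps)
  qed
  have "L2 F (m + 2) E a b = span_over F G" by (simp add: L2_def G_def)
  also have "\<dots> = coef_space ?T ?T' F"
  proof (rule span_over_eq_coef_space)
    show "subspace_over F (coef_space ?T ?T' F)"
      by (intro subspace_over_coef_space closed_lin lin_closed_field subfield_F)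
    show "G \<subseteq> coef_space ?T ?T' F"
    proof
      fix x assume "x \<in> G"
      then consider i j k where "x = smul (a ^ i * b ^ j / (of_nat (fact i) * of_nat (fact j))) (E k)"
          "k \<in> {1..m}"
        | i where "x = smul (b ^ i / of_nat (fact i)) P" | "x = Q"
        using E by (auto simp: G_def)
      then show "x \<in> coef_space ?T ?T' F"
        using T T' by cases (auto simp: E intro: smul_D_coef_space smul_P_coef_space Q_coef_space closed_lin)
    qed
    show "smul s (D k) \<in> span_over F G" if "k \<in> {1..m}" "s \<in> monom2 a b" for k s
    proof -
      obtain i j where "s = a ^ i * b ^ j" using \<open>s \<in> monom2 a b\<close> by (auto simp: monom2_def)
      moreover have "smul (a ^ i * b ^ j / (of_nat (fact i) * of_nat (fact j))) (E k) \<in> span_over F G"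
        using that(1) by (intro span_over_base[OF subfield_F]) (auto simp: G_def)
      ultimately show ?thesis using div_smul_span[of "fact i * fact j" s "E k"] E(1)[OF that(1)]
        by (simp del: of_nat_fact)
    qed
    show "smul s P \<in> span_over F G" if "s \<in> monom1 b" for s
    proof -
      obtain i where "s = b ^ i" using \<open>s \<in> monom1 b\<close> by (auto simp: monom1_def)
      moreover have "smul (b ^ i / of_nat (fact i)) P \<in> span_over F G"
        using E(2) by (intro span_over_base[OF subfield_F]) (auto simp: G_def)
      ultimately show ?thesis using div_smul_span[of "fact i"] by simp
    qed
    have "E (m + 2) \<in> span_over F G" by (intro span_over_base[OF subfield_F]) (simp add: G_def)
    then show "Q \<in> span_over F G" by (simp only: E(3))
  qed
  finally show "L2 F (m + 2) E a b = coef_space ?T ?T' F" .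
  define M where "M = (\<lambda>d j. {a ^ i * b ^ l | i l. i * (d + 1) + l < j})"
  define U where "U = (\<lambda>d j. lin F (M d j))"
  define U' where "U' = (\<lambda>j. lin F {b ^ i | i. i < j})"
  have mono: "U d j \<subseteq> U d k" if "j \<le> k" for d j k
    unfolding U_def M_def using that by (intro lin_mono) fastforce
  have mono': "U' j \<subseteq> U' k" if "j \<le> k" for j k
    unfolding U'_def using that by (intro lin_mono) auto
  have mm: "monom2 a b = (\<Union>j. M d j)" for d
    unfolding monom2_def M_def by (auto intro: exI[of _ "Suc _"])
  have TU: "?T = (\<Union>j. U d j)" for d
    unfolding U_def mm[of d] by (rule lin_UN) (fastforce simp: M_def)
  have "monom1 b = (\<Union>j. {b ^ i | i. i < j})" by (auto simp: monom1_def)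
  then have TU': "?T' = (\<Union>j. U' j)" unfolding U'_def by (simp only:) (rule lin_UN, auto)
  have PU': "P f = 0" if "f \<in> U' j" for f j
    using P_lin_zero[OF b(2)] that TU' by blast
  have UK': "U' j \<subseteq> K" for j using TU' lin_K[OF monom1_K[OF b(1)]] by blast
  have UK: "U d j \<subseteq> K" for d j using TU[of d] lin_K[OF monom2_K[OF a(1) b(1)]] by blast
  have QU: "Q f \<in> U d (j - 1)" if "f \<in> U d j" for d j f
    unfolding U_def
  proof (rule lin_map[of Q F _ _, OF _ _ _ subfield_F that[unfolded U_def]])
    fix s assume "s \<in> M d j"
    then obtain i l where i: "s = a ^ i * b ^ l" "i * (d + 1) + l < j" by (auto simp: M_def)
    have Qs: "Q s = of_nat l * (a ^ i * b ^ (l - 1))"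
      unfolding i(1) by (simp add: Q_simps(2) derivation_power[OF derQ] a b)
    show "Q s \<in> lin F (M d (j - 1))"
    proof (cases l)
      case (Suc k)
      then have "a ^ i * b ^ (l - 1) \<in> M d (j - 1)"
        unfolding M_def using i(2) by (intro CollectI exI[of _ i] exI[of _ "l - 1"] conjI refl) simp
      then show ?thesis unfolding Qs
        by (rule lin_scale[OF subfield_F F_simps(9) lin_base[OF subfield_F]])
    qed (simp add: Qs lin.zero)
  qed (simp_all add: Q_simps(1) Q_F_linear)
  have PU: "p * P f \<in> U d (j - Suc k)" if p: "p \<in> U' (d - k)" and f: "f \<in> U d j" for d k j p f
    unfolding U_def
  proof (rule lin_times[OF subfield_F _ p[unfolded U'_def]])
    show "P f \<in> lin F {a ^ i * b ^ l | i l. Suc i * (d + 1) + l < j}"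
    proof (rule lin_map[of P F _ _, OF _ _ _ subfield_F f[unfolded U_def]])
      fix s assume "s \<in> M d j"
      then obtain i l where i: "s = a ^ i * b ^ l" "i * (d + 1) + l < j" by (auto simp: M_def)
      have Ps: "P s = of_nat i * (a ^ (i - 1) * b ^ l)"
        unfolding i(1) by (simp add: P_simps(2) derivation_power[OF derP] a b)
      show "P s \<in> lin F {a ^ i * b ^ l | i l. Suc i * (d + 1) + l < j}"
      proof (cases i)
        case (Suc k)
        then have "a ^ (i - 1) * b ^ l \<in> {a ^ i * b ^ l | i l. Suc i * (d + 1) + l < j}"
          using i(2) by (intro CollectI exI[of _ "i - 1"] exI[of _ l] conjI refl) simp
        then show ?thesis unfolding Ps
          by (rule lin_scale[OF subfield_F F_simps(9) lin_base[OF subfield_F]])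
      qed (simp add: Ps lin.zero)
    qed (simp_all add: P_simps(1) P_F_linear)
    fix s t assume "s \<in> {b ^ i | i. i < d - k}" "t \<in> {a ^ i * b ^ l | i l. Suc i * (d + 1) + l < j}"
    then obtain e i l where *: "s = b ^ e" "e < d - k" "t = a ^ i * b ^ l" "Suc i * (d + 1) + l < j"
      by blast
    then have "s * t = a ^ i * b ^ (e + l)" by (simp add: power_add)
    moreover have "i * (d + 1) + (e + l) < j - Suc k" using *(2,4) by simp
    ultimately show "s * t \<in> lin F (M d (j - Suc k))"
      by (intro lin_F) (auto simp: M_def)
  qed
  have U0: "U d 0 = {0}" "U' 0 = {0}" for d by (simp_all add: U_def U'_def M_def lin_empty)
  have cl: "lin_closed F (U d j)" "lin_closed F (U' j)" "lin_closed F ?T" "lin_closed F ?T'" for d j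
    by (simp_all add: U_def U'_def closed_lin)
  have QU': "Q f \<in> U' (j - 1)" if "f \<in> U' j" for f j
    using lin_power_bounded[OF b(3)] that by (simp add: U'_def)
  note fin = coef_space_lie_subalgebra_locally_nilpotent[OF k0 cl(1,2) mono mono' U0 UK UK' PU QU PU' QU'
      TU TU' cl(3,4)]
  show "lie_subalgebra k0 (coef_space ?T ?T' F)" "lie_locally_nilpotent k0 (coef_space ?T ?T' F)"
    by (rule fin; assumption)+
qed

end

section \<open>Antiderivatives of polynomials\<close>

lemma (in frame) exists_antiderivative1:
  assumes "Q b = 1" "f \<in> lin F (monom1 b)"
  shows "\<exists>s\<in>lin F (monom1 b). Q s = f"
proof (rule lin_preimage[OF _ _ _ subfield_F assms(2)])
  fix s assume "s \<in> monom1 b"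
  then obtain j where s: "s = b ^ j" by (auto simp: monom1_def)
  have "inverse (of_nat (Suc j)) * b ^ Suc j \<in> lin F (monom1 b)"
    by (intro lin_scale[OF subfield_F F_simps(7)[OF F_simps(9)] lin_base[OF subfield_F]])
      (simp add: monom1_def del: power_Suc)
  moreover have "Q (inverse (of_nat (Suc j)) * b ^ Suc j) = inverse (of_nat (Suc j)) * Q (b ^ Suc j)"
    by (rule Q_F_linear[OF F_simps(7)[OF F_simps(9)]])
  then have "Q (inverse (of_nat (Suc j)) * b ^ Suc j) = s"
    using char0[of "Suc j"] by (simp add: s Q_simps(9) assms(1) del: power_Suc of_nat_Suc)
  ultimately show "\<exists>t\<in>lin F (monom1 b). Q t = s" by blast
qed (simp_all add: Q_simps(1) Q_F_linear)

lemma (in frame) exists_antiderivative2: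
  assumes "P a = 1" "P b = 0" "f \<in> lin F (monom2 a b)"
  shows "\<exists>s\<in>lin F (monom2 a b). P s = f"
proof (rule lin_preimage[OF _ _ _ subfield_F assms(3)])
  fix s assume "s \<in> monom2 a b"
  then obtain i j where s: "s = a ^ i * b ^ j" by (auto simp: monom2_def)
  have "inverse (of_nat (Suc i)) * (a ^ Suc i * b ^ j) \<in> lin F (monom2 a b)"
    by (intro lin_scale[OF subfield_F F_simps(7)[OF F_simps(9)] lin_base[OF subfield_F]])
      (auto simp: monom2_def simp del: power_Suc)
  moreover have "P (inverse (of_nat (Suc i)) * (a ^ Suc i * b ^ j)) =
      inverse (of_nat (Suc i)) * P (a ^ Suc i * b ^ j)"
    by (rule P_F_linear[OF F_simps(7)[OF F_simps(9)]])
  moreover have "P (a ^ Suc i * b ^ j) = of_nat (Suc i) * s"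
    by (simp add: s P_simps(2) P_simps(9) derivation_power[OF derP, of b] assms del: power_Suc of_nat_Suc)
  ultimately show "\<exists>t\<in>lin F (monom2 a b). P t = s"
    using char0[of "Suc i"] by (force simp del: power_Suc of_nat_Suc)
qed (simp_all add: P_simps(1) P_F_linear)

lemma (in frame) Q_lin2:
  assumes "Q a = 0" "Q b = 1" "f \<in> lin F (monom2 a b)"
  shows "Q f \<in> lin F (monom2 a b)"
proof (rule lin_map[of Q, OF _ _ _ subfield_F assms(3)])
  fix s assume "s \<in> monom2 a b"
  then obtain i j where s: "s = a ^ i * b ^ j" by (auto simp: monom2_def)
  have "Q s = of_nat j * (a ^ i * b ^ (j - 1))"
    by (simp add: s Q_simps(2) derivation_power[OF derQ] assms)
  then show "Q s \<in> lin F (monom2 a b)"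
    by (simp only:) (intro lin_scale[OF subfield_F F_simps(9) lin_base[OF subfield_F]], auto simp: monom2_def)
qed (simp_all add: Q_simps(1) Q_F_linear)

text \<open>A polynomial in \<open>a\<close> and \<open>b\<close> that \<open>P\<close>, the
  derivative in \<open>a\<close>, kills does not involve \<open>a\<close>: the Euler operator
  \<open>a P - k\<close> removes the terms of degree \<open>k\<close> in \<open>a\<close>, and on
  the kernel of \<open>P\<close> it is multiplication by \<open>- k\<close>.\<close>

lemma (in frame) ker_P_lin2:
  assumes ab: "P a = 1" "P b = 0" and f: "f \<in> lin F (monom2 a b)" "P f = 0"
  shows "f \<in> lin F (monom1 b)"
proof -
  define S where "S = (\<lambda>k. {a ^ i * b ^ j | i j. i < k})"
  have S: "f \<in> lin F (S k) \<Longrightarrow> f \<in> lin F (monom1 b)" for k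
  proof (induction k)
    case 0
    then show ?case by (simp add: S_def lin_empty lin.zero)
  next
    case (Suc k)
    show ?case
    proof (cases "k = 0")
      case True
      have "S (Suc 0) = monom1 b" by (auto simp: S_def monom1_def)
      then show ?thesis using Suc.prems True by simp
    next
      case False
      define g where "g = (\<lambda>f. a * P f - of_nat k * f)"
      have "g f \<in> lin F (S k)"
      proof (rule lin_map[of g, OF _ _ _ subfield_F Suc.prems])
        fix s assume "s \<in> S (Suc k)"
        then obtain i j where s: "s = a ^ i * b ^ j" "i \<le> k" by (auto simp: S_def)
        have "P s = of_nat i * (a ^ (i - 1) * b ^ j)"
          by (simp add: s P_simps(2) derivation_power[OF derP] ab)
        then have gs: "g s = (of_nat i - of_nat k) * s"
          by (cases i) (simp_all add: g_def s algebra_simps)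
        show "g s \<in> lin F (S k)"
        proof (cases "i = k")
          case False
          then have "s \<in> S k" using s by (auto simp: S_def)
          then show ?thesis unfolding gs
            by (rule lin_scale[OF subfield_F F_simps(6)[OF F_simps(9,9)] lin_base[OF subfield_F]])
        qed (simp add: gs lin.zero)
      qed (simp_all add: g_def P_simps(1) P_F_linear algebra_simps)
      then have "inverse (- of_nat k) * g f \<in> lin F (S k)"
        by (rule lin_scale[OF subfield_F F_simps(7)[OF F_simps(5)[OF F_simps(9)]]])
      moreover have "inverse (- of_nat k) * g f = f"
        using char0[of k] False by (simp add: g_def f(2))
      ultimately show ?thesis using Suc.IH by simp
    qed
  qed
  have "monom2 a b = (\<Union>k. S k)" by (auto simp: monom2_def S_def)
  then have "lin F (monom2 a b) = (\<Union>k. lin F (S k))"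
    by (simp only:) (rule lin_UN, fastforce simp: S_def)
  then show ?thesis using f(1) S by blast
qed

section \<open>Independence, rank and change of frame\<close>

lemma indep_over_indexed:
  assumes F: "subfield F" and I: "finite I"
    and ind: "\<And>c. c ` I \<subseteq> F \<Longrightarrow> (\<Sum>i\<in>I. smul (c i) (E i)) = 0 \<Longrightarrow> \<forall>i\<in>I. c i = 0"
  shows "inj_on E I \<and> indep_over F (E ` I)"
proof
  show inj: "inj_on E I"
  proof (rule inj_onI, rule ccontr)
    fix i j assume ij: "i \<in> I" "j \<in> I" "E i = E j" "i \<noteq> j"
    define c where "c = (\<lambda>k. if k = i then 1 else if k = j then -1 else (0::'a))"
    have "(\<Sum>k\<in>I. smul (c k) (E k)) = (\<Sum>k\<in>{i, j}. smul (c k) (E k))"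
      using I ij by (intro sum.mono_neutral_right) (auto simp: c_def)
    also have "\<dots> = 0" using ij by (simp add: c_def)
    finally have "\<forall>i\<in>I. c i = 0"
      using subfieldD(1,2)[OF F] subfieldD(5)[OF F subfieldD(2)[OF F]]
      by (intro ind) (auto simp: c_def)
    then show False using ij(1) by (auto simp: c_def)
  qed
  show "indep_over F (E ` I)"
    unfolding indep_over_def
  proof (intro allI impI)
    fix T c assume T: "finite T \<and> T \<subseteq> E ` I \<and> c ` T \<subseteq> F \<and> (\<Sum>v\<in>T. smul (c v) v) = 0"
    define c' where "c' = (\<lambda>v. if v \<in> T then c v else 0)"
    have "0 = (\<Sum>v\<in>T. smul (c v) v)" using T by simp
    also have "\<dots> = (\<Sum>v\<in>E ` I. smul (c' v) v)"
      using T I by (intro sum.mono_neutral_cong_left) (auto simp: c'_def)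
    also have "\<dots> = (\<Sum>i\<in>I. smul (c' (E i)) (E i))"
      using inj by (simp add: sum.reindex)
    finally have "\<forall>i\<in>I. c' (E i) = 0"
      using T subfieldD(1)[OF F] by (intro ind) (auto simp: c'_def)
    then show "\<forall>v\<in>T. c v = 0" using T by (auto simp: c'_def split: if_splits)
  qed
qed

context frame
begin

definition directions :: "nat \<Rightarrow> 'r \<Rightarrow> 'r"
  where "directions i = (if i = m + 1 then P else if i = m + 2 then Q else D i)"

lemma directions_simps: "i \<in> {1..m} \<Longrightarrow> directions i = D i" "directions (m + 1) = P" "directions (m + 2) = Q"
  by (simp_all add: directions_def)

lemma sum_directions: "(\<Sum>i\<in>{1..m + 2}. smul (c i) (directions i)) = cmb c (c (m + 1)) (c (m + 2))"
proof -
  have "(\<Sum>i\<in>{1..m + 2}. smul (c i) (directions i)) = (\<Sum>i\<in>{1..m}. smul (c i) (directions i)) +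
      smul (c (m + 1)) P + smul (c (m + 2)) Q"
    by (simp add: directions_def)
  also have "(\<Sum>i\<in>{1..m}. smul (c i) (directions i)) = (\<Sum>i\<in>{1..m}. smul (c i) (D i))"
    by (intro sum.cong) (simp_all add: directions_def)
  finally show ?thesis by (simp only: comb_eq_sum)
qed

lemma directions_independent:
  "inj_on directions {1..m + 2}" "op.independent (directions ` {1..m + 2})"
proof -
  have "inj_on directions {1..m + 2} \<and> indep_over UNIV (directions ` {1..m + 2})"
  proof (rule indep_over_indexed)
    show "\<forall>i\<in>{1..m + 2}. c i = 0" if "(\<Sum>i\<in>{1..m + 2}. smul (c i) (directions i)) = 0" for c
    proof -
      have "(\<forall>i\<in>{1..m}. c i = 0) \<and> c (m + 1) = 0 \<and> c (m + 2) = 0"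
        using independent that unfolding sum_directions .
      then show ?thesis by (auto simp: le_Suc_eq)
    qed
  qed (auto simp: subfield_def)
  then show "inj_on directions {1..m + 2}" "op.independent (directions ` {1..m + 2})"
    by (simp_all add: indep_over_UNIV)
qed

lemma cmb_in_span: "cmb r p q \<in> op.span (directions ` {1..m + 2})"
proof -
  define c where "c = (\<lambda>i. if i = m + 1 then p else if i = m + 2 then q else r i)"
  have "cmb r p q = cmb c (c (m + 1)) (c (m + 2))"
    by (subst comb_cong[of m r c]) (auto simp: c_def)
  also have "\<dots> \<in> op.span (directions ` {1..m + 2})"
    unfolding sum_directions[symmetric] by (intro op.span_sum op.span_scale op.span_base) auto
  finally show ?thesis .
qed

lemma rank_and_basis:
  assumes M: "M \<subseteq> {cmb r p q | r p q. True}" and directions: "directions ` {1..m + 2} \<subseteq> M"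
  shows "rk M = m + 2" "basis_over_R M (directions ` {1..m + 2})"
proof -
  have sub: "M \<subseteq> op.span (directions ` {1..m + 2})" using M cmb_in_span by blast
  have "op.dim (op.span M) = card (directions ` {1..m + 2})"
    using op.span_minimal[OF sub op.subspace_span] directions_independent(2) directions op.span_superset
    by (intro op.dim_unique[of "directions ` {1..m + 2}"]) blast+
  then show "rk M = m + 2" using directions_independent(1) by (simp add: rk_def card_image)
  show "basis_over_R M (directions ` {1..m + 2})"
    unfolding basis_over_R_def
  proof (intro conjI allI impI directions directions_independent(2))
    fix B' assume B': "directions ` {1..m + 2} \<subseteq> B' \<and> B' \<subseteq> M \<and> op.independent B'"
    show "B' = directions ` {1..m + 2}"
    proof (rule ccontr)
      assume "B' \<noteq> directions ` {1..m + 2}"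
      then obtain v where v: "v \<in> B'" "v \<notin> directions ` {1..m + 2}" using B' by blast
      then have "directions ` {1..m + 2} \<subseteq> B' - {v}" using B' by blast
      then have "v \<in> op.span (B' - {v})"
        using v(1) B' sub op.span_mono[of "directions ` {1..m + 2}" "B' - {v}"] by blast
      then show False using B' v(1) unfolding op.dependent_def by blast
    qed
  qed
qed

text \<open>The matrix of constants by which \<open>P\<close> and \<open>Q\<close> are transformed
  is invertible, so Cramer's rule gives independence of the new frame and recovers the derivatives
  along \<open>P\<close> and \<open>Q\<close> from the new ones. The corrections
  \<open>s1\<close>, \<open>s2\<close> along the \<open>D i\<close> act trivially on
  \<open>K\<close>.\<close>

lemma change_frame:
  assumes P': "P' = cmb s1 u1 v1" and Q': "Q' = cmb s2 u2 v2"
    and s: "\<And>i. i \<in> {1..m} \<Longrightarrow> s1 i \<in> K" "\<And>i. i \<in> {1..m} \<Longrightarrow> s2 i \<in> K"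
    and F: "u1 \<in> F" "v1 \<in> F" "u2 \<in> F" "v2 \<in> F" and det: "u1 * v2 - u2 * v1 \<noteq> 0"
  shows "frame m D P' Q'" "frame.F m D P' Q' = F"
    "comb m D P' Q' r p q =
      cmb (\<lambda>i. r i + p * s1 i + q * s2 i) (p * u1 + q * u2) (p * v1 + q * v2)"
proof -
  have exp: "comb m D P' Q' r p q =
      cmb (\<lambda>i. r i + p * s1 i + q * s2 i) (p * u1 + q * u2) (p * v1 + q * v2)" for r p q
    unfolding P' Q'
    by (simp add: comb_def fun_eq_iff sum.distrib sum_distrib_left algebra_simps)
  then show "comb m D P' Q' r p q =
      cmb (\<lambda>i. r i + p * s1 i + q * s2 i) (p * u1 + q * u2) (p * v1 + q * v2)" .
  have comm: "lie_bracket (D i) (cmb s u v) = 0"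
    if "i \<in> {1..m}" "\<And>i. i \<in> {1..m} \<Longrightarrow> s i \<in> K" "u \<in> F" "v \<in> F" for i s u v
  proof -
    have "lie_bracket (D i) (cmb s u v) = cmb (\<lambda>j. D i (s j)) (D i u) (D i v)"
      unfolding lie_bracket_comb[OF derD[OF that(1)]]
      using commP[OF that(1)] commQ[OF that(1)] commD[OF that(1)] by (simp add: comb_def fun_eq_iff)
    also have "\<dots> = cmb (\<lambda>_. 0) 0 0"
      using that by (subst cmb_eq_iff) (auto simp: K_def F_def)
    finally show ?thesis unfolding comb_zero .
  qed
  have solve: "p = 0 \<and> q = 0" if "p * u1 + q * u2 = 0" "p * v1 + q * v2 = 0" for p q
  proof -
    have "p * (u1 * v2 - u2 * v1) = (p * u1 + q * u2) * v2 - (p * v1 + q * v2) * u2"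
      "q * (u1 * v2 - u2 * v1) = (p * v1 + q * v2) * u1 - (p * u1 + q * u2) * v1"
      by (simp_all add: algebra_simps)
    then show ?thesis using that det by simp
  qed
  show fr: "frame m D P' Q'"
  proof (unfold_locales)
    show "derivation P'" "derivation Q'" unfolding P' Q' by (rule derivation_cmb)+
    show "lie_bracket (D i) P' = 0" "lie_bracket (D i) Q' = 0" if "i \<in> {1..m}" for i
      unfolding P' Q' using that s F by (auto intro: comm)
    show "(\<forall>i\<in>{1..m}. r i = 0) \<and> p = 0 \<and> q = 0" if "comb m D P' Q' r p q = 0" for r p q
    proof -
      from independent[OF that[unfolded exp]]
      have 1: "\<forall>i\<in>{1..m}. r i + p * s1 i + q * s2 i = 0" "p * u1 + q * u2 = 0" "p * v1 + q * v2 = 0"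
        by auto
      with solve[OF 1(2,3)] show ?thesis by simp
    qed
  qed (use char0 derD commD in auto)
  interpret N: frame m D P' Q' by (rule fr)
  show "N.F = F"
  proof (intro set_eqI iffI)
    fix c assume "c \<in> N.F"
    then have c0: "c \<in> K" "P' c = 0" "Q' c = 0" unfolding N.F_def by auto
    then have c: "c \<in> K" "u1 * P c + v1 * Q c = 0" "u2 * P c + v2 * Q c = 0"
      unfolding P' Q' by (simp_all add: cmb_K)
    have "(u1 * v2 - u2 * v1) * P c = (u1 * P c + v1 * Q c) * v2 - (u2 * P c + v2 * Q c) * v1"
      "(u1 * v2 - u2 * v1) * Q c = (u2 * P c + v2 * Q c) * u1 - (u1 * P c + v1 * Q c) * u2"
      by (simp_all add: algebra_simps)
    then show "c \<in> F" using c det by (simp add: F_def)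
  next
    fix c assume "c \<in> F"
    then have "c \<in> K" "P' c = 0" "Q' c = 0" unfolding P' Q' using F_K cmb_F by auto
    then show "c \<in> N.F" unfolding N.F_def by blast
  qed
qed

end

section \<open>Nilpotent algebras with large center\<close>

text \<open>Nilpotency is used only in this form: the induction descends the lower central
  series.\<close>

lemma nilpotent_induct:
  assumes k0: "subfield k0" and L: "lie_subalgebra k0 L" "lie_nilpotent k0 L"
    and phi0: "\<phi> 0" and step: "\<And>x. x \<in> L \<Longrightarrow> (\<And>y. y \<in> L \<Longrightarrow> \<phi> (lie_bracket y x)) \<Longrightarrow> \<phi> x"
    and x: "x \<in> L"
  shows "\<phi> x"
proof -
  have br: "lie_bracket y x \<in> lower_central k0 L (Suc k)" if "y \<in> L" "x \<in> lower_central k0 L k" for x y k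
    unfolding lower_central.simps using that by (intro span_over_base[OF k0]) blast
  have sub: "lower_central k0 L k \<subseteq> L" for k
  proof (induction k)
    case (Suc k)
    show ?case unfolding lower_central.simps
      by (rule span_over_minimal) (use L(1) Suc in \<open>auto simp: lie_subalgebra_def\<close>)
  qed simp
  obtain N where N: "lower_central k0 L N = {0}" using L(2) by (auto simp: lie_nilpotent_def)
  have "\<forall>x\<in>lower_central k0 L (N - j). \<phi> x" for j
  proof (induction j)
    case 0
    show ?case unfolding diff_zero N using phi0 by blast
  next
    case (Suc j)
    show ?case
    proof (cases "j < N")
      case True
      then have "N - j = Suc (N - Suc j)" by simp
      then show ?thesis using Suc br sub step by (metis subsetD)
    next
      case False
      then show ?thesis using Suc by simp
    qed
  qed
  from this[of N] x show ?thesis by simp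
qed

text \<open>The frame adapted to \<open>L\<close>: the \<open>D i\<close> are central, and
  \<open>P\<close> is central modulo their \<open>R\<close>-span. The parameter \<open>e\<close>
  records the coefficients of the bracket of \<open>P\<close> with \<open>Q\<close>.\<close>

locale nilpotent_frame = frame +
  fixes k0 :: "'a set" and L :: "('a \<Rightarrow> 'a) set" and e :: "nat \<Rightarrow> 'a"
  assumes k0: "subfield k0" and lie: "lie_subalgebra k0 L" and nil: "lie_nilpotent k0 L"
    and k0_F: "k0 \<subseteq> F"
    and DL: "\<And>i. i \<in> {1..m} \<Longrightarrow> D i \<in> L" and PL: "P \<in> L" and QL: "Q \<in> L"
    and L_cmb: "L \<subseteq> {cmb r p q | r p q. True}"
    and central: "\<And>i x. i \<in> {1..m} \<Longrightarrow> x \<in> L \<Longrightarrow> lie_bracket (D i) x = 0"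
    and almost_central: "\<And>y. y \<in> L \<Longrightarrow> \<exists>f. lie_bracket y P = cmb f 0 0"
    and PQ: "lie_bracket P Q = cmb e 0 0"
begin

lemma zero_eq_cmb:
  assumes "0 = cmb r p q"
  shows "\<And>i. i \<in> {1..m} \<Longrightarrow> r i = 0" "p = 0" "q = 0"
  using independent[OF assms[symmetric]] by auto

lemmas induct_L = nilpotent_induct[OF k0 lie nil]

lemma bracket_L: "x \<in> L \<Longrightarrow> y \<in> L \<Longrightarrow> lie_bracket x y \<in> L"
  using lie by (simp add: lie_subalgebra_def)

lemma coefs_K:
  assumes "cmb r p q \<in> L"
  shows "\<And>i. i \<in> {1..m} \<Longrightarrow> r i \<in> K" "p \<in> K" "q \<in> K"
proof -
  have "(\<forall>i\<in>{1..m}. D j (r i) = 0) \<and> D j p = 0 \<and> D j q = 0" if j: "j \<in> {1..m}" for j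
  proof (rule independent)
    have "cmb (\<lambda>i. D j (r i)) (D j p) (D j q) = lie_bracket (D j) (cmb r p q)"
      unfolding lie_bracket_comb[OF derD[OF j]]
      using commP[OF j] commQ[OF j] commD[OF j] by (simp add: comb_def fun_eq_iff)
    then show "cmb (\<lambda>i. D j (r i)) (D j p) (D j q) = 0" using central[OF j assms] by simp
  qed
  then show "\<And>i. i \<in> {1..m} \<Longrightarrow> r i \<in> K" "p \<in> K" "q \<in> K" by (auto simp: K_def)
qed

lemma bracket_P: "lie_bracket P (cmb r p q) = cmb (\<lambda>i. P (r i) + q * e i) (P p) (P q)"
  and bracket_Q: "lie_bracket Q (cmb r p q) = cmb (\<lambda>i. Q (r i) - p * e i) (Q p) (Q q)"
proof -
  have D0: "lie_bracket P (D i) = 0" "lie_bracket Q (D i) = 0" if "i \<in> {1..m}" for i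
    using commP[OF that] commQ[OF that] lie_bracket_skew[of P "D i"] lie_bracket_skew[of Q "D i"]
    by simp_all
  have 0: "lie_bracket P P = 0" "lie_bracket Q Q = 0" by (simp_all add: lie_bracket_def fun_eq_iff)
  have QP: "lie_bracket Q P = - cmb e 0 0" using lie_bracket_skew[of Q P] PQ by simp
  show "lie_bracket P (cmb r p q) = cmb (\<lambda>i. P (r i) + q * e i) (P p) (P q)"
    unfolding lie_bracket_comb[OF derP] using D0 0 PQ
    by (simp add: comb_def fun_eq_iff sum.distrib sum_distrib_left algebra_simps)
  show "lie_bracket Q (cmb r p q) = cmb (\<lambda>i. Q (r i) - p * e i) (Q p) (Q q)"
    unfolding lie_bracket_comb[OF derQ] using D0 0 QP
    by (simp add: comb_def fun_eq_iff sum_subtractf sum_distrib_left algebra_simps)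
qed

text \<open>Because \<open>P\<close> is central modulo the span of the \<open>D i\<close>, a
  bracket with \<open>P\<close> has no components along \<open>P\<close> and
  \<open>Q\<close>.\<close>

lemma P_kills:
  assumes "cmb r p q \<in> L"
  shows "P p = 0" "P q = 0"
proof -
  obtain f where "lie_bracket (cmb r p q) P = cmb f 0 0" using almost_central[OF assms] by blast
  then have "cmb (\<lambda>i. P (r i) + q * e i) (P p) (P q) = - cmb f 0 0"
    using lie_bracket_skew[of P "cmb r p q"] bracket_P[of r p q] by simp
  then show "P p = 0" "P q = 0" unfolding comb_uminus cmb_eq_iff by simp_all
qed

lemma PQ_commute: "f \<in> K \<Longrightarrow> P (Q f) = Q (P f)"
proof -
  assume "f \<in> K"
  then have "lie_bracket P Q f = 0" unfolding PQ by (simp add: cmb_K)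
  then show ?thesis by (simp add: lie_bracket_def)
qed

text \<open>An element whose coefficient of \<open>Q\<close> has a nonzero constant derivative
  \<open>c\<close> under \<open>Q\<close> acts on constant coefficients of \<open>Q\<close> as
  multiplication by \<open>- c\<close>, hence not nilpotently.\<close>

lemma Q_coef_derivative_zero:
  assumes x: "cmb r p q \<in> L" and c: "Q q \<in> F"
  shows "Q q = 0"
proof (rule ccontr)
  assume c0: "Q q \<noteq> 0"
  have "\<forall>r' p' q'. Q = cmb r' p' q' \<longrightarrow> q' \<in> F \<longrightarrow> q' = 0"
  proof (rule induct_L[of "\<lambda>y. \<forall>r' p' q'. y = cmb r' p' q' \<longrightarrow> q' \<in> F \<longrightarrow> q' = 0", OF _ _ QL])
    show "\<forall>r' p' q'. 0 = cmb r' p' q' \<longrightarrow> q' \<in> F \<longrightarrow> q' = 0"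
      by (blast dest: zero_eq_cmb(3))
  next
    fix y assume y: "y \<in> L"
      and IH: "\<And>z. z \<in> L \<Longrightarrow> \<forall>r' p' q'. lie_bracket z y = cmb r' p' q' \<longrightarrow> q' \<in> F \<longrightarrow> q' = 0"
    show "\<forall>r' p' q'. y = cmb r' p' q' \<longrightarrow> q' \<in> F \<longrightarrow> q' = 0"
    proof (intro allI impI)
      fix r' p' q' assume y': "y = cmb r' p' q'" and q': "q' \<in> F"
      have "lie_bracket (cmb r p q) y = cmb (\<lambda>i. cmb r p q (r' i) - y (r i) + (p * q' - q * p') * e i)
          (cmb r p q p' - y p) (cmb r p q q' - y q)"
        using bracket_cmb[OF refl y' coefs_K[OF x]] unfolding PQ comb_scale comb_plus by simp
      also have "cmb r p q q' - y q = - (q' * Q q)"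
        using cmb_F[OF q'] coefs_K(3)[OF x] P_kills(2)[OF x] by (simp add: y' cmb_K)
      finally have "- (q' * Q q) = 0"
        by (rule IH[OF x, rule_format]) (rule F_simps(5)[OF F_simps(4)[OF q' c]])
      then show "q' = 0" using c0 by simp
    qed
  qed
  moreover have "Q = cmb (\<lambda>_. 0) 0 1" by (simp add: comb_Q)
  ultimately show False using F_simps(2) by (metis zero_neq_one)
qed

text \<open>Otherwise repeated brackets with \<open>Q\<close> would lead to an element excluded by
  the previous lemma.\<close>

lemma Q_coef_in_F:
  assumes x: "cmb r p q \<in> L"
  shows "q \<in> F"
proof -
  have "\<forall>r' p' q'. cmb r p q = cmb r' p' q' \<longrightarrow> Q q' = 0"
  proof (rule induct_L[of "\<lambda>y. \<forall>r' p' q'. y = cmb r' p' q' \<longrightarrow> Q q' = 0", OF _ _ x])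
    show "\<forall>r' p' q'. 0 = cmb r' p' q' \<longrightarrow> Q q' = 0"
      using zero_eq_cmb(3) Q_simps(3) by blast
  next
    fix y assume y: "y \<in> L"
      and IH: "\<And>z. z \<in> L \<Longrightarrow> \<forall>r' p' q'. lie_bracket z y = cmb r' p' q' \<longrightarrow> Q q' = 0"
    show "\<forall>r' p' q'. y = cmb r' p' q' \<longrightarrow> Q q' = 0"
    proof (intro allI impI)
      fix r' p' q' assume y': "y = cmb r' p' q'"
      have yL: "cmb r' p' q' \<in> L" using y y' by simp
      have "Q (Q q') = 0" using IH[OF QL] unfolding y' bracket_Q by blast
      moreover have "P (Q q') = 0"
        using PQ_commute[OF coefs_K(3)[OF yL]] P_kills(2)[OF yL] Q_simps(3) by simp
      ultimately have "Q q' \<in> F" using Q_K coefs_K(3)[OF yL] by (simp add: F_def)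
      then show "Q q' = 0" by (rule Q_coef_derivative_zero[OF yL])
    qed
  qed
  then have "Q q = 0" by blast
  then show ?thesis using coefs_K(3)[OF x] P_kills(2)[OF x] by (simp add: F_def)
qed

text \<open>Since \<open>P\<close> kills the coefficient of \<open>P\<close>, integration along
  \<open>Q\<close> alone captures it.\<close>

lemma P_coef_in:
  assumes "0 \<in> T'" and T': "\<And>f. f \<in> K \<Longrightarrow> P f = 0 \<Longrightarrow> Q f \<in> T' \<Longrightarrow> f \<in> T'"
    and x: "cmb r p q \<in> L"
  shows "p \<in> T'"
proof -
  have "\<forall>r' p' q'. cmb r p q = cmb r' p' q' \<longrightarrow> p' \<in> T'"
  proof (rule induct_L[of "\<lambda>y. \<forall>r' p' q'. y = cmb r' p' q' \<longrightarrow> p' \<in> T'", OF _ _ x])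
    show "\<forall>r' p' q'. 0 = cmb r' p' q' \<longrightarrow> p' \<in> T'"
      using zero_eq_cmb(2) assms(1) by blast
  next
    fix y assume y: "y \<in> L"
      and IH: "\<And>z. z \<in> L \<Longrightarrow> \<forall>r' p' q'. lie_bracket z y = cmb r' p' q' \<longrightarrow> p' \<in> T'"
    show "\<forall>r' p' q'. y = cmb r' p' q' \<longrightarrow> p' \<in> T'"
    proof (intro allI impI)
      fix r' p' q' assume y': "y = cmb r' p' q'"
      have yL: "cmb r' p' q' \<in> L" using y y' by simp
      have "Q p' \<in> T'" using IH[OF QL] unfolding y' bracket_Q by blast
      then show "p' \<in> T'" using T' coefs_K(2)[OF yL] P_kills(1)[OF yL] by blast
    qed
  qed
  then show ?thesis by blast
qed

text \<open>Taking brackets with \<open>P\<close> and \<open>Q\<close> differentiates the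
  coefficients. So a ring of functions that contains every function whose two derivatives it
  contains, contains all coefficients. The inhomogeneous terms in these derivatives involve
  \<open>[P,Q]\<close>, which is why the elements without components along \<open>P\<close> and
  \<open>Q\<close> have to be treated first.\<close>

lemma coefs_in:
  assumes T: "F \<subseteq> T" "\<And>f g. f \<in> T \<Longrightarrow> g \<in> T \<Longrightarrow> f + g \<in> T" "\<And>f g. f \<in> T \<Longrightarrow> g \<in> T \<Longrightarrow> f * g \<in> T"
    and int: "\<And>f. f \<in> K \<Longrightarrow> P f \<in> T \<Longrightarrow> Q f \<in> T \<Longrightarrow> f \<in> T"
  shows "\<And>i. i \<in> {1..m} \<Longrightarrow> e i \<in> T" "\<And>r p q. cmb r p q \<in> L \<Longrightarrow> p \<in> T"
    "\<And>r p q i. cmb r p q \<in> L \<Longrightarrow> i \<in> {1..m} \<Longrightarrow> r i \<in> T"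
proof -
  have 0: "0 \<in> T" using T(1) F_simps(1) by blast
  have "-1 \<in> T" using T(1) F_simps(5)[OF F_simps(2)] by blast
  then have "-1 * f \<in> T" if "f \<in> T" for f using T(3) that by blast
  then have minus: "f - g \<in> T" if "f \<in> T" "g \<in> T" for f g
    using T(2)[of f "-1 * g"] that by simp
  show p: "p \<in> T" if "cmb r p q \<in> L" for r p q
    by (rule P_coef_in[OF 0 _ that]) (use int 0 in auto)
  have "\<forall>r. x = cmb r 0 0 \<longrightarrow> (\<forall>i\<in>{1..m}. r i \<in> T)" if x: "x \<in> L" for x
  proof (rule induct_L[of "\<lambda>x. \<forall>r. x = cmb r 0 0 \<longrightarrow> (\<forall>i\<in>{1..m}. r i \<in> T)", OF _ _ x])
    show "\<forall>r. 0 = cmb r 0 0 \<longrightarrow> (\<forall>i\<in>{1..m}. r i \<in> T)"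
      using zero_eq_cmb(1) 0 by metis
  next
    fix y assume y: "y \<in> L"
      and IH: "\<And>z. z \<in> L \<Longrightarrow> \<forall>r. lie_bracket z y = cmb r 0 0 \<longrightarrow> (\<forall>i\<in>{1..m}. r i \<in> T)"
    show "\<forall>r. y = cmb r 0 0 \<longrightarrow> (\<forall>i\<in>{1..m}. r i \<in> T)"
    proof (intro allI impI ballI)
      fix r i assume y': "y = cmb r 0 0" and i: "i \<in> {1..m}"
      have "P (r i) \<in> T" "Q (r i) \<in> T"
        using IH[OF PL] IH[OF QL] i unfolding y' bracket_P bracket_Q P_simps(3) Q_simps(3) by fastforce+
      then show "r i \<in> T" using int coefs_K(1) y y' i by blast
    qed
  qed
  then show e: "e i \<in> T" if "i \<in> {1..m}" for i
    using bracket_L[OF PL QL] PQ that by auto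
  have "\<forall>r p q. x = cmb r p q \<longrightarrow> (\<forall>i\<in>{1..m}. r i \<in> T)" if x: "x \<in> L" for x
  proof (rule induct_L[of "\<lambda>x. \<forall>r p q. x = cmb r p q \<longrightarrow> (\<forall>i\<in>{1..m}. r i \<in> T)", OF _ _ x])
    show "\<forall>r p q. 0 = cmb r p q \<longrightarrow> (\<forall>i\<in>{1..m}. r i \<in> T)"
      using zero_eq_cmb(1) 0 by metis
  next
    fix y assume y: "y \<in> L"
      and IH: "\<And>z. z \<in> L \<Longrightarrow> \<forall>r p q. lie_bracket z y = cmb r p q \<longrightarrow> (\<forall>i\<in>{1..m}. r i \<in> T)"
    show "\<forall>r p q. y = cmb r p q \<longrightarrow> (\<forall>i\<in>{1..m}. r i \<in> T)"
    proof (intro allI impI ballI)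
      fix r p q i assume y': "y = cmb r p q" and i: "i \<in> {1..m}"
      have yL: "cmb r p q \<in> L" using y y' by simp
      have "P (r i) + q * e i \<in> T" "Q (r i) - p * e i \<in> T"
        using IH[OF PL] IH[OF QL] i unfolding y' bracket_P bracket_Q by blast+
      moreover have "q * e i \<in> T" "p * e i \<in> T"
        using T(3) e[OF i] p[OF yL] Q_coef_in_F[OF yL] T(1) by blast+
      ultimately have "P (r i) \<in> T" "Q (r i) \<in> T"
        using minus[of "P (r i) + q * e i" "q * e i"] T(2)[of "Q (r i) - p * e i" "p * e i"] by simp_all
      then show "r i \<in> T" using int coefs_K(1)[OF yL i] by blast
    qed
  qed
  then show "\<And>r p q i. cmb r p q \<in> L \<Longrightarrow> i \<in> {1..m} \<Longrightarrow> r i \<in> T" by blast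
qed

lemma directions_L: "directions ` {1..m + 2} \<subseteq> L"
  using DL PL QL by (auto simp: directions_def le_Suc_eq)

lemma coef_space_F_subset_span: "coef_space F F F \<subseteq> span_over F L"
proof
  fix x assume "x \<in> coef_space F F F"
  then obtain r p q where x: "x = cmb r p q" and rpq: "\<And>i. i \<in> {1..m} \<Longrightarrow> r i \<in> F" "p \<in> F" "q \<in> F"
    by (rule coef_spaceE) blast
  note sp = span_over_subspace[OF subfield_F, of L]
  have mult: "smul c v \<in> span_over F L" if "c \<in> F" "v \<in> L" for c v
    using sp span_over_base[OF subfield_F that(2)] that(1) by (simp add: subspace_over_def)
  have "(\<Sum>i\<in>{1..m}. smul (r i) (D i)) \<in> span_over F L"
    using rpq DL by (intro subspace_over_sum[OF sp] mult)
  moreover have "smul p P \<in> span_over F L" "smul q Q \<in> span_over F L"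
    using rpq PL QL by (auto intro: mult)
  ultimately show "x \<in> span_over F L"
    using sp unfolding x comb_eq_sum subspace_over_def by blast
qed

lemma closed_F: "lin_closed F F" by (rule lin_closed_field[OF subfield_F])

lemma span_over_L_eq:
  assumes "L \<subseteq> coef_space F F F"
  shows "span_over F L = coef_space F F F"
  using coef_space_F_subset_span
    span_over_minimal[OF subspace_over_coef_space[OF closed_F closed_F closed_F] assms] by blast

lemma dim_over_coef_space_F: "dim_over F (coef_space F F F) = enat (m + 2)"
proof -
  have "span_over F (directions ` {1..m + 2}) = coef_space F F F"
  proof
    show "span_over F (directions ` {1..m + 2}) \<subseteq> coef_space F F F"
    proof (rule span_over_minimal[OF subspace_over_coef_space[OF closed_F closed_F closed_F]])
      show "directions ` {1..m + 2} \<subseteq> coef_space F F F"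
      proof
        fix x assume "x \<in> directions ` {1..m + 2}"
        then obtain i where i: "i \<in> {1..m + 2}" "x = directions i" by blast
        define c where "c = (\<lambda>j. if j = i then 1 else (0::'a))"
        have "x = (\<Sum>j\<in>{1..m + 2}. smul (c j) (directions j))"
        proof -
          have "(\<Sum>j\<in>{1..m + 2}. smul (c j) (directions j)) = (\<Sum>j\<in>{i}. smul (c j) (directions j))"
            using i by (intro sum.mono_neutral_right) (auto simp: c_def)
          then show ?thesis by (simp add: c_def i)
        qed
        then show "x \<in> coef_space F F F" unfolding sum_directions
          using F_simps(1,2) by (auto simp: c_def intro!: coef_spaceI)
      qed
    qed
    show "coef_space F F F \<subseteq> span_over F (directions ` {1..m + 2})"
    proof
      fix x assume "x \<in> coef_space F F F"
      then obtain r p q where x: "x = cmb r p q" and rpq: "\<And>i. i \<in> {1..m} \<Longrightarrow> r i \<in> F" "p \<in> F" "q \<in> F"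
        by (rule coef_spaceE) blast
      define c where "c = (\<lambda>i. if i = m + 1 then p else if i = m + 2 then q else r i)"
      have c: "x = (\<Sum>i\<in>{1..m + 2}. smul (c i) (directions i))"
        unfolding x sum_directions by (subst comb_cong[of m r c]) (auto simp: c_def)
      note sp = span_over_subspace[OF subfield_F, of "directions ` {1..m + 2}"]
      have "c i \<in> F" if "i \<in> {1..m + 2}" for i using rpq that by (auto simp: c_def le_Suc_eq)
      then show "x \<in> span_over F (directions ` {1..m + 2})"
        using sp span_over_base[OF subfield_F] unfolding c
        by (intro subspace_over_sum[OF sp]) (auto simp: subspace_over_def)
    qed
  qed
  then have basis: "basis_over F (coef_space F F F) (directions ` {1..m + 2})"
    unfolding basis_over_def using indep_over_subset_field[OF directions_independent(2)] by blast
  then show ?thesis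
    using dim_over_eq_card[OF subfield_F _ basis] directions_independent(1) by (simp add: card_image)
qed

text \<open>The frame and one element with a nonconstant coefficient are independent over
  \<open>F\<close>.\<close>

lemma dim_over_large:
  assumes "\<not> L \<subseteq> coef_space F F F"
  shows "enat (m + 3) \<le> dim_over F (span_over F L)"
proof -
  obtain x where x: "x \<in> L" "x \<notin> coef_space F F F" using assms by blast
  define E where "E = (\<lambda>i. if i = 0 then x else directions i)"
  have I: "{0..m + 2} = insert 0 {1..m + 2}" by auto
  have ind: "inj_on E {0..m + 2} \<and> indep_over F (E ` {0..m + 2})"
  proof (rule indep_over_indexed[OF subfield_F])
    fix c assume c: "c ` {0..m + 2} \<subseteq> F" and 0: "(\<Sum>i\<in>{0..m + 2}. smul (c i) (E i)) = 0"
    have "(\<Sum>i\<in>{1..m + 2}. smul (c i) (E i)) = (\<Sum>i\<in>{1..m + 2}. smul (c i) (directions i))"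
      by (intro sum.cong) (auto simp: E_def)
    then have eq: "smul (c 0) x + cmb c (c (m + 1)) (c (m + 2)) = 0"
      using 0 unfolding I sum_directions[symmetric] by (simp add: E_def)
    have cF: "c i \<in> F" if "i \<le> m + 2" for i using c that by auto
    have "c 0 = 0"
    proof (rule ccontr)
      assume c0: "c 0 \<noteq> 0"
      have "smul (c 0) x = smul (-1) (cmb c (c (m + 1)) (c (m + 2)))"
        using eq by (simp add: eq_neg_iff_add_eq_0)
      then have "smul (inverse (c 0)) (smul (c 0) x) =
          smul (inverse (c 0)) (smul (-1) (cmb c (c (m + 1)) (c (m + 2))))" by simp
      moreover have "smul (inverse (c 0)) (smul (c 0) x) = x"
        unfolding op.scale_scale using c0 by simp
      ultimately have "x = smul (inverse (c 0) * -1) (cmb c (c (m + 1)) (c (m + 2)))"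
        unfolding op.scale_scale by simp
      then have "x \<in> coef_space F F F"
        unfolding comb_scale using cF
        by (auto intro!: coef_spaceI F_simps(4) F_simps(5) F_simps(7) F_simps(2))
      then show False using x(2) by blast
    qed
    then have "cmb c (c (m + 1)) (c (m + 2)) = 0" using eq by simp
    from independent[OF this] show "\<forall>i\<in>{0..m + 2}. c i = 0"
      using \<open>c 0 = 0\<close> by (auto simp: le_Suc_eq Suc_le_eq)
  qed simp
  have "E ` {0..m + 2} \<subseteq> span_over F L"
    using span_over_base[OF subfield_F, of _ L] x(1) directions_L unfolding I by (auto simp: E_def)
  then have "enat (card (E ` {0..m + 2})) \<le> dim_over F (span_over F L)"
    by (rule dim_over_ge_card[OF subfield_F _ conjunct2[OF ind]])
  moreover have "card (E ` {0..m + 2}) = m + 3" using ind by (simp add: card_image)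
  ultimately show ?thesis by simp
qed

lemma bracket_coef_space_F:
  assumes "\<And>i. i \<in> {1..m} \<Longrightarrow> r i \<in> F" "p \<in> F" "q \<in> F"
    and "\<And>i. i \<in> {1..m} \<Longrightarrow> r' i \<in> F" "p' \<in> F" "q' \<in> F"
  shows "lie_bracket (cmb r p q) (cmb r' p' q') = cmb (\<lambda>i. (p * q' - q * p') * e i) 0 0"
proof -
  have "lie_bracket (cmb r p q) (cmb r' p' q') =
      cmb (\<lambda>i. cmb r p q (r' i) - cmb r' p' q' (r i)) (cmb r p q p' - cmb r' p' q' p)
        (cmb r p q q' - cmb r' p' q' q) + smul (p * q' - q * p') (lie_bracket P Q)"
    using assms F_K by (intro bracket_cmb) auto
  also have "\<dots> = cmb (\<lambda>i. (p * q' - q * p') * e i) 0 0"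
    unfolding PQ comb_scale comb_plus using assms
    by (subst cmb_eq_iff) (simp add: cmb_F)
  finally show ?thesis .
qed

text \<open>With constant coefficients everything is governed by the single bracket
  \<open>[P,Q]\<close>. If it does not vanish, then \<open>P\<close>, \<open>Q\<close> and
  \<open>[P,Q]\<close> span a Heisenberg algebra, and a complement of \<open>[P,Q]\<close> in the
  span of the central directions splits off.\<close>

lemma constant_coefs:
  assumes L: "L \<subseteq> coef_space F F F"
  shows "lie_abelian (coef_space F F F) \<or>
    (\<exists>M N. lie_direct_sum F (coef_space F F F) M N \<and> \<not> lie_abelian M \<and> lie_nilpotent F M \<and>
      dim_over F M = 3 \<and> lie_abelian N)"
proof (cases "\<forall>i\<in>{1..m}. e i = 0")
  case True
  have "lie_bracket x y = 0" if x: "x \<in> coef_space F F F" and y: "y \<in> coef_space F F F" for x y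
  proof -
    obtain r p q where x: "x = cmb r p q" "\<And>i. i \<in> {1..m} \<Longrightarrow> r i \<in> F" "p \<in> F" "q \<in> F"
      using x by (rule coef_spaceE) blast
    obtain r' p' q' where y: "y = cmb r' p' q'" "\<And>i. i \<in> {1..m} \<Longrightarrow> r' i \<in> F" "p' \<in> F" "q' \<in> F"
      using y by (rule coef_spaceE) blast
    have "lie_bracket x y = cmb (\<lambda>i. (p * q' - q * p') * e i) 0 0"
      unfolding x(1) y(1) by (rule bracket_coef_space_F[OF x(2-4) y(2-4)])
    also have "\<dots> = cmb (\<lambda>_. 0) 0 0" unfolding cmb_eq_iff using True by simp
    finally have "lie_bracket x y = cmb (\<lambda>_. 0) 0 0" .
    then show ?thesis by (simp only: comb_zero)
  qed
  then show ?thesis by (simp add: lie_abelian_def)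
next
  case False
  then obtain i0 where i0: "i0 \<in> {1..m}" "e i0 \<noteq> 0" by blast
  have eF: "e i \<in> F" if "i \<in> {1..m}" for i
  proof -
    have "cmb e 0 0 \<in> coef_space F F F" using bracket_L[OF PL QL] L unfolding PQ by blast
    then obtain r p q where "cmb e 0 0 = cmb r p q" "\<And>i. i \<in> {1..m} \<Longrightarrow> r i \<in> F" by (rule coef_spaceE) blast
    then show ?thesis using that unfolding cmb_eq_iff by simp
  qed
  define H where "H = {cmb (\<lambda>i. t * e i) p q | t p q. t \<in> F \<and> p \<in> F \<and> q \<in> F}"
  define N where "N = {cmb r 0 0 | r. (\<forall>i\<in>{1..m}. r i \<in> F) \<and> r i0 = 0}"
  have H_coef_space: "H \<subseteq> coef_space F F F"
    unfolding H_def using eF by (auto intro!: coef_spaceI F_simps(4))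
  have N_coef_space: "N \<subseteq> coef_space F F F"
    unfolding N_def using F_simps(1) by (auto intro!: coef_spaceI)
  have bracket_H: "\<exists>t\<in>F. lie_bracket x y = cmb (\<lambda>i. t * e i) 0 0" if x: "x \<in> coef_space F F F" and y: "y \<in> coef_space F F F"
    for x y
  proof -
    obtain r p q where x: "x = cmb r p q" "\<And>i. i \<in> {1..m} \<Longrightarrow> r i \<in> F" "p \<in> F" "q \<in> F"
      using x by (rule coef_spaceE) blast
    obtain r' p' q' where y: "y = cmb r' p' q'" "\<And>i. i \<in> {1..m} \<Longrightarrow> r' i \<in> F" "p' \<in> F" "q' \<in> F"
      using y by (rule coef_spaceE) blast
    have "p * q' - q * p' \<in> F" by (intro F_simps x y)
    moreover have "lie_bracket x y = cmb (\<lambda>i. (p * q' - q * p') * e i) 0 0"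
      unfolding x(1) y(1) by (rule bracket_coef_space_F[OF x(2-4) y(2-4)])
    ultimately show ?thesis by blast
  qed
  have bracket_0: "lie_bracket x (cmb r 0 0) = 0"
    if x: "x \<in> coef_space F F F" and r: "\<And>i. i \<in> {1..m} \<Longrightarrow> r i \<in> F" for x r
  proof -
    obtain r' p' q' where x: "x = cmb r' p' q'" "\<And>i. i \<in> {1..m} \<Longrightarrow> r' i \<in> F" "p' \<in> F" "q' \<in> F"
      using x by (rule coef_spaceE) blast
    have "lie_bracket x (cmb r 0 0) = cmb (\<lambda>i. (p' * 0 - q' * 0) * e i) 0 0"
      unfolding x(1) by (rule bracket_coef_space_F[OF x(2-4) r F_simps(1,1)])
    then show ?thesis using comb_zero by simp
  qed
  have H_sub: "subspace_over F H"
    unfolding subspace_over_def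
  proof (intro conjI ballI)
    show "0 \<in> H" unfolding H_def comb_zero[of m D P Q, symmetric]
      using F_simps(1) by (intro CollectI exI[of _ 0]) auto
    show "x + y \<in> H" if xy: "x \<in> H" "y \<in> H" for x y
    proof -
      obtain t p q t' p' q' where "x = cmb (\<lambda>i. t * e i) p q" "y = cmb (\<lambda>i. t' * e i) p' q'"
        "t \<in> F" "p \<in> F" "q \<in> F" "t' \<in> F" "p' \<in> F" "q' \<in> F" using xy unfolding H_def by blast
      moreover from this have "x + y = cmb (\<lambda>i. (t + t') * e i) (p + p') (q + q')"
        by (simp add: comb_plus distrib_right)
      ultimately show ?thesis unfolding H_def using F_simps(3) by blast
    qed
    show "smul c x \<in> H" if cx: "c \<in> F" "x \<in> H" for c x
    proof -
      obtain t p q where "x = cmb (\<lambda>i. t * e i) p q" "t \<in> F" "p \<in> F" "q \<in> F"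
        using cx(2) unfolding H_def by blast
      moreover from this have "smul c x = cmb (\<lambda>i. (c * t) * e i) (c * p) (c * q)"
        by (simp add: comb_scale mult.assoc)
      ultimately show ?thesis unfolding H_def using F_simps(4) cx(1) by blast
    qed
  qed
  have N_sub: "subspace_over F N"
    unfolding subspace_over_def
  proof (intro conjI ballI)
    show "0 \<in> N" unfolding N_def comb_zero[of m D P Q, symmetric]
      using F_simps(1) by (intro CollectI exI[of _ "\<lambda>_. 0"]) auto
    show "x + y \<in> N" if xy: "x \<in> N" "y \<in> N" for x y
    proof -
      obtain r r' where "x = cmb r 0 0" "y = cmb r' 0 0" and r: "\<forall>i\<in>{1..m}. r i \<in> F" "r i0 = 0"
        "\<forall>i\<in>{1..m}. r' i \<in> F" "r' i0 = 0" using xy unfolding N_def by blast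
      then have "x + y = cmb (\<lambda>i. r i + r' i) 0 0" by (simp add: comb_plus)
      then show ?thesis unfolding N_def using F_simps(3) r
        by (intro CollectI exI[of _ "\<lambda>i. r i + r' i"]) simp
    qed
    show "smul c x \<in> N" if cx: "c \<in> F" "x \<in> N" for c x
    proof -
      obtain r where "x = cmb r 0 0" and r: "\<forall>i\<in>{1..m}. r i \<in> F" "r i0 = 0"
        using cx(2) unfolding N_def by blast
      then have "smul c x = cmb (\<lambda>i. c * r i) 0 0" by (simp add: comb_scale)
      then show ?thesis unfolding N_def using F_simps(4)[OF cx(1)] r
        by (intro CollectI exI[of _ "\<lambda>i. c * r i"]) simp
    qed
  qed
  have tH: "cmb (\<lambda>i. t * e i) 0 0 \<in> H" if "t \<in> F" for t
    unfolding H_def using that F_simps(1) by blast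
  have "lie_ideal F (coef_space F F F) H"
    unfolding lie_ideal_def
  proof (intro conjI ballI H_sub H_coef_space)
    fix x y assume "x \<in> coef_space F F F" "y \<in> H"
    then obtain t where "t \<in> F" "lie_bracket x y = cmb (\<lambda>i. t * e i) 0 0"
      using bracket_H H_coef_space by blast
    then show "lie_bracket x y \<in> H" using tH by simp
  qed
  moreover have "lie_ideal F (coef_space F F F) N"
    unfolding lie_ideal_def
  proof (intro conjI ballI N_sub N_coef_space)
    fix x y assume "x \<in> coef_space F F F" "y \<in> N"
    then have "lie_bracket x y = 0" unfolding N_def using bracket_0 by blast
    then show "lie_bracket x y \<in> N" using N_sub by (simp add: subspace_over_def)
  qed
  moreover have "H \<inter> N = {0}"
  proof
    show "{0} \<subseteq> H \<inter> N" using H_sub N_sub by (simp add: subspace_over_def)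
    show "H \<inter> N \<subseteq> {0}"
    proof
      fix x assume "x \<in> H \<inter> N"
      then obtain t p q r where *: "x = cmb (\<lambda>i. t * e i) p q" "x = cmb r 0 0" "r i0 = 0"
        unfolding H_def N_def by blast
      from *(1)[unfolded *(2) cmb_eq_iff] have "\<forall>i\<in>{1..m}. t * e i = r i" "p = 0" "q = 0" by auto
      then have "t = 0" using *(3) i0 by fastforce
      then show "x \<in> {0}" using *(1) \<open>p = 0\<close> \<open>q = 0\<close> comb_zero by simp
    qed
  qed
  moreover have "coef_space F F F = {x + y | x y. x \<in> H \<and> y \<in> N}"
  proof
    show "{x + y | x y. x \<in> H \<and> y \<in> N} \<subseteq> coef_space F F F"
      using H_coef_space N_coef_space subspace_over_coef_space[OF closed_F closed_F closed_F]
      unfolding subspace_over_def by blast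
    show "coef_space F F F \<subseteq> {x + y | x y. x \<in> H \<and> y \<in> N}"
    proof
      fix x assume "x \<in> coef_space F F F"
      then obtain r p q where x: "x = cmb r p q" "\<And>i. i \<in> {1..m} \<Longrightarrow> r i \<in> F" "p \<in> F" "q \<in> F"
        by (rule coef_spaceE) blast
      \<comment> \<open>The multiple of \<open>[P,Q]\<close> that clears the coefficient at \<open>i0\<close>.\<close>
      define t where "t = r i0 / e i0"
      have t: "t \<in> F" unfolding t_def using i0 by (intro F_simps x(2) eF)
      have "cmb (\<lambda>i. t * e i) p q \<in> H" using t x(3,4) unfolding H_def by blast
      moreover have "cmb (\<lambda>i. r i - t * e i) 0 0 \<in> N"
        unfolding N_def using x(2) t eF i0 by (auto intro!: exI[of _ "\<lambda>i. r i - t * e i"] F_simps(6) F_simps(4) simp: t_def)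
      moreover have "x = cmb (\<lambda>i. t * e i) p q + cmb (\<lambda>i. r i - t * e i) 0 0"
        by (simp add: x(1) comb_plus)
      ultimately show "x \<in> {x + y | x y. x \<in> H \<and> y \<in> N}" by blast
    qed
  qed
  ultimately have "lie_direct_sum F (coef_space F F F) H N" by (simp add: lie_direct_sum_def)
  moreover have PH: "P \<in> H" and QH: "Q \<in> H"
  proof -
    have "P = cmb (\<lambda>i. 0 * e i) 1 0" "Q = cmb (\<lambda>i. 0 * e i) 0 1" by (simp_all add: comb_P comb_Q)
    then show "P \<in> H" "Q \<in> H" unfolding H_def using F_simps(1,2) by blast+
  qed
  moreover have C0: "cmb e 0 0 \<noteq> 0" using independent[of e 0 0] i0 by blast
  moreover have "\<not> lie_abelian H"
    unfolding lie_abelian_def using PH QH C0 unfolding PQ[symmetric] by blast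
  moreover have "lie_abelian N"
    unfolding lie_abelian_def
  proof (intro ballI)
    fix x y assume "x \<in> N" "y \<in> N"
    then show "lie_bracket x y = 0" using N_coef_space bracket_0[of x] unfolding N_def by blast
  qed
  moreover have "lie_nilpotent F H"
  proof -
    let ?C = "{cmb (\<lambda>i. t * e i) 0 0 | t. t \<in> F}"
    have C_sub: "subspace_over F ?C"
      unfolding subspace_over_def
    proof (intro conjI ballI)
      show "0 \<in> ?C" unfolding comb_zero[of m D P Q, symmetric]
        using F_simps(1) by (intro CollectI exI[of _ 0]) auto
      show "x + y \<in> ?C" if xy: "x \<in> ?C" "y \<in> ?C" for x y
      proof -
        obtain t t' where "x = cmb (\<lambda>i. t * e i) 0 0" "y = cmb (\<lambda>i. t' * e i) 0 0" "t \<in> F" "t' \<in> F"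
          using xy by blast
        moreover from this have "x + y = cmb (\<lambda>i. (t + t') * e i) 0 0"
          by (simp add: comb_plus distrib_right)
        ultimately show ?thesis using F_simps(3) by blast
      qed
      show "smul c x \<in> ?C" if cx: "c \<in> F" "x \<in> ?C" for c x
      proof -
        obtain t where "x = cmb (\<lambda>i. t * e i) 0 0" "t \<in> F" using cx(2) by blast
        moreover from this have "smul c x = cmb (\<lambda>i. (c * t) * e i) 0 0"
          by (simp add: comb_scale mult.assoc)
        ultimately show ?thesis using F_simps(4) cx(1) by blast
      qed
    qed
    have "lower_central F H 1 \<subseteq> ?C"
      unfolding One_nat_def lower_central.simps
      by (rule span_over_minimal[OF C_sub]) (use bracket_H H_coef_space in blast)
    moreover have "lie_bracket x y = 0" if xy: "x \<in> H" "y \<in> ?C" for x y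
    proof -
      obtain t where t: "y = cmb (\<lambda>i. t * e i) 0 0" "t \<in> F" using xy(2) by blast
      have "t * e i \<in> F" if "i \<in> {1..m}" for i using F_simps(4)[OF t(2) eF[OF that]] .
      then show ?thesis unfolding t(1) using xy(1) H_coef_space by (intro bracket_0) auto
    qed
    ultimately have "lower_central F H (Suc 1) \<subseteq> {0}"
      unfolding lower_central.simps(2)[of F H 1]
      by (intro span_over_minimal) (auto simp: subspace_over_def)
    moreover have "0 \<in> lower_central F H (Suc 1)"
      unfolding lower_central.simps(2)[of F H 1]
      using span_over_subspace[OF subfield_F] by (simp add: subspace_over_def)
    ultimately have "lower_central F H (Suc 1) = {0}" by blast
    then show ?thesis unfolding lie_nilpotent_def by blast
  qed
  moreover have "dim_over F H = 3"
  proof -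
    define E where "E = (\<lambda>i::nat. if i = 0 then cmb e 0 0 else if i = 1 then P else Q)"
    have sumE: "(\<Sum>i\<in>{0, 1, 2}. smul (c i) (E i)) = cmb (\<lambda>i. c 0 * e i) (c 1) (c 2)" for c
    proof -
      have "(\<Sum>i\<in>{0, 1, 2}. smul (c i) (E i)) = smul (c 0) (cmb e 0 0) + smul (c 1) P + smul (c 2) Q"
        by (simp add: E_def add.assoc)
      then show ?thesis
        by (simp add: comb_def fun_eq_iff smul_def sum_distrib_left algebra_simps)
    qed
    have ind: "inj_on E {0, 1, 2} \<and> indep_over F (E ` {0, 1, 2})"
    proof (rule indep_over_indexed[OF subfield_F])
      show "\<forall>i\<in>{0, 1, 2}. c i = 0" if "(\<Sum>i\<in>{0, 1, 2}. smul (c i) (E i)) = 0" for c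
        using independent[OF that[unfolded sumE]] i0 by auto
    qed simp
    have "span_over F (E ` {0, 1, 2}) = H"
    proof
      have "cmb e 0 0 \<in> H" using tH[OF F_simps(2)] by simp
      then show "span_over F (E ` {0, 1, 2}) \<subseteq> H"
        using PH QH by (intro span_over_minimal[OF H_sub]) (auto simp: E_def)
      show "H \<subseteq> span_over F (E ` {0, 1, 2})"
      proof
        fix x assume "x \<in> H"
        then obtain t p q where x: "x = cmb (\<lambda>i. t * e i) p q" "t \<in> F" "p \<in> F" "q \<in> F"
          unfolding H_def by blast
        define c where "c = (\<lambda>i::nat. if i = 0 then t else if i = 1 then p else q)"
        note sp = span_over_subspace[OF subfield_F, of "E ` {0, 1, 2}"]
        have "x = (\<Sum>i\<in>{0, 1, 2}. smul (c i) (E i))" unfolding sumE by (simp add: x(1) c_def)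
        also have "\<dots> \<in> span_over F (E ` {0, 1, 2})"
        proof (rule subspace_over_sum[OF sp])
          fix i :: nat assume "i \<in> {0, 1, 2}"
          then have "E i \<in> span_over F (E ` {0, 1, 2})" by (intro span_over_base[OF subfield_F]) blast
          moreover have "c i \<in> F" using x by (simp add: c_def)
          ultimately show "smul (c i) (E i) \<in> span_over F (E ` {0, 1, 2})"
            using sp unfolding subspace_over_def by blast
        qed
        finally show "x \<in> span_over F (E ` {0, 1, 2})" .
      qed
    qed
    then have "basis_over F H (E ` {0, 1, 2})" using ind by (simp add: basis_over_def)
    then have "dim_over F H = enat (card (E ` {0, 1, 2}))"
      by (intro dim_over_eq_card[OF subfield_F]) auto
    also have "card (E ` {0, 1, 2}) = card {0, 1, 2 :: nat}" by (rule card_image[OF conjunct1[OF ind]])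
    finally show ?thesis by (simp add: numeral_eq_enat)
  qed
  ultimately show ?thesis by (intro disjI2 exI[of _ H] exI[of _ N] conjI)
qed

end

section \<open>Straightening the frame\<close>

context nilpotent_frame
begin

text \<open>The functions in \<open>K\<close> whose derivatives under \<open>P\<close> and
  \<open>Q\<close> are constants form \<open>F + F b\<close>; after a constant change of basis of
  the plane of \<open>P\<close> and \<open>Q\<close> the first new direction kills
  \<open>b\<close> and the second differentiates it. Subtracting antiderivatives of the
  coefficients of the bracket from the first direction makes the two commute.\<close>

lemma straighten1:
  assumes b: "b \<in> K" "u1 * P b + v1 * Q b = 0" "u2 * P b + v2 * Q b = 1"
    and uv: "u1 \<in> F" "v1 \<in> F" "u2 \<in> F" "v2 \<in> F" and det: "u1 * v2 - u2 * v1 = 1"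
    and only_b: "\<And>s. s \<in> K \<Longrightarrow> P s \<in> F \<Longrightarrow> Q s \<in> F \<Longrightarrow> u1 * P s + v1 * Q s = 0"
  obtains s where "commuting_frame m D (cmb s u1 v1) (cmb (\<lambda>_. 0) u2 v2)"
    "frame.F m D (cmb s u1 v1) (cmb (\<lambda>_. 0) u2 v2) = F"
    "L \<subseteq> frame.coef_space m D (cmb s u1 v1) (cmb (\<lambda>_. 0) u2 v2) (lin F (monom1 b)) (lin F (monom1 b)) F"
proof -
  define P1 where "P1 = cmb (\<lambda>_. 0) u1 v1"
  define Q1 where "Q1 = cmb (\<lambda>_. 0) u2 v2"
  have P1K: "P1 f = u1 * P f + v1 * Q f" and Q1K: "Q1 f = u2 * P f + v2 * Q f" if "f \<in> K" for f
    using that by (simp_all add: P1_def Q1_def cmb_K)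
  have det0: "u1 * v2 - u2 * v1 \<noteq> 0" using det by simp
  have fr1: "frame m D P1 Q1" "frame.F m D P1 Q1 = F"
    using change_frame(1,2)[OF P1_def Q1_def zero_K zero_K uv det0] by auto
  interpret A: frame m D P1 Q1 by (rule fr1(1))
  let ?T = "lin F (monom1 b)"
  have TK: "?T \<subseteq> K" by (rule lin_K[OF monom1_K[OF b(1)]])
  have FT: "F \<subseteq> ?T" by (rule F_lin_monom1)
  have P1T: "P1 f = 0" if "f \<in> ?T" for f
    using A.P_lin_zero[of b f] that P1K[OF b(1)] b(2) by (simp add: fr1(2))
  have Q1T: "\<exists>s\<in>?T. Q1 s = f" if "f \<in> ?T" for f
    using A.exists_antiderivative1[of b f] that Q1K[OF b(1)] b(3) by (simp add: fr1(2))
  have plusT: "f + g \<in> ?T" if "f \<in> ?T" "g \<in> ?T" for f g using lin_plus that .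
  have timesT: "f * g \<in> ?T" if "f \<in> ?T" "g \<in> ?T" for f g using lin_monom1_times that .
  have clT: "lin_closed F ?T" by (rule lin_closed_lin[OF subfield_F])
  have commK: "Q1 (P1 f) = P1 (Q1 f)" if f: "f \<in> K" for f
  proof -
    have "P f \<in> K" "Q f \<in> K" using P_K Q_K f by auto
    then show ?thesis using f uv
      by (simp add: P1K Q1K P_K Q_K plus_K times_K F_K P_simps(1) Q_simps(1) P_F_linear Q_F_linear
          PQ_commute algebra_simps)
  qed
  have int: "f \<in> ?T" if f: "f \<in> K" "P f \<in> ?T" "Q f \<in> ?T" for f
  proof -
    have P1f: "P1 f \<in> ?T" and "Q1 f \<in> ?T"
      unfolding P1K[OF f(1)] Q1K[OF f(1)] using f uv clT by (auto intro!: lin_closedD(2) lin_closedD(3))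
    then obtain s where s: "s \<in> ?T" "Q1 s = Q1 f" using Q1T by blast
    \<comment> \<open>After subtracting \<open>s\<close> only the derivative along the first direction is left, and it is a constant.\<close>
    have gK: "f - s \<in> K" using f(1) s(1) TK by (auto intro: minus_K)
    have Q1g: "Q1 (f - s) = 0" using s(2) by (simp add: A.Q_simps(6))
    have P1g: "P1 (f - s) = P1 f" using P1T[OF s(1)] by (simp add: A.P_simps(6))
    have "Q1 (P1 (f - s)) = 0" using commK[OF gK] Q1g A.P_simps(3) by simp
    moreover have "P1 (P1 (f - s)) = 0" unfolding P1g by (rule P1T[OF P1f])
    moreover have "P1 (f - s) \<in> K" unfolding P1g using P1f TK by blast
    ultimately have c: "P1 (f - s) \<in> F" unfolding fr1(2)[symmetric] A.F_def by simp
    define c where "c = P1 (f - s)"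
    have eqs: "u1 * P (f - s) + v1 * Q (f - s) = c" "u2 * P (f - s) + v2 * Q (f - s) = 0"
      using P1K[OF gK] Q1K[OF gK] Q1g by (simp_all add: c_def)
    have "P (f - s) = (u1 * v2 - u2 * v1) * P (f - s)" using det by simp
    also have "\<dots> = v2 * (u1 * P (f - s) + v1 * Q (f - s)) - v1 * (u2 * P (f - s) + v2 * Q (f - s))"
      by (simp only: algebra_simps)
    also have "\<dots> = v2 * c" unfolding eqs by simp
    finally have PF: "P (f - s) \<in> F" using F_simps(4)[OF uv(4), of c] c by (simp add: c_def)
    have "Q (f - s) = (u1 * v2 - u2 * v1) * Q (f - s)" using det by simp
    also have "\<dots> = u1 * (u2 * P (f - s) + v2 * Q (f - s)) - u2 * (u1 * P (f - s) + v1 * Q (f - s))"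
      by (simp only: algebra_simps)
    also have "\<dots> = - (u2 * c)" unfolding eqs by simp
    finally have "Q (f - s) \<in> F"
      using F_simps(5)[OF F_simps(4)[OF uv(3), of c]] c by (simp add: c_def)
    then have "P1 (f - s) = 0" using only_b[OF gK PF] P1K[OF gK] by simp
    then have "f - s \<in> F" using gK Q1g unfolding fr1(2)[symmetric] A.F_def by simp
    then have "(f - s) + s \<in> ?T" using FT s(1) plusT by blast
    then show ?thesis by simp
  qed
  have co1: "e i \<in> ?T" if "i \<in> {1..m}" for i
    by (rule coefs_in(1)[OF FT _ _ _ that]) (fact plusT timesT int)+
  have co2: "p \<in> ?T" if "cmb r p q \<in> L" for r p q
    by (rule coefs_in(2)[OF FT _ _ _ that]) (fact plusT timesT int)+
  have co3: "r i \<in> ?T" if "cmb r p q \<in> L" "i \<in> {1..m}" for r p q i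
    by (rule coefs_in(3)[OF FT _ _ _ that]) (fact plusT timesT int)+
  have "\<forall>i\<in>{1..m}. \<exists>s. s \<in> ?T \<and> Q1 s = e i" using co1 Q1T by blast
  then obtain s where s: "\<And>i. i \<in> {1..m} \<Longrightarrow> s i \<in> ?T" "\<And>i. i \<in> {1..m} \<Longrightarrow> Q1 (s i) = e i"
    by metis
  define P2 where "P2 = cmb s u1 v1"
  have sK: "s i \<in> K" if "i \<in> {1..m}" for i using s(1)[OF that] TK by blast
  note cf = change_frame(1,2)[OF P2_def Q1_def sK zero_K uv det0]
  have coords: "comb m D P2 Q1 r p q =
      cmb (\<lambda>i. r i + p * s i + q * 0) (p * u1 + q * u2) (p * v1 + q * v2)" for r p q
    by (rule change_frame(3)[OF P2_def Q1_def sK zero_K uv det0])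
  have QP0: "lie_bracket Q1 P2 = 0"
  proof -
    have "lie_bracket Q1 P2 = cmb (\<lambda>i. Q1 (s i) - P2 0) (Q1 u1 - P2 u2) (Q1 v1 - P2 v2) +
        smul (u2 * v1 - v2 * u1) (lie_bracket P Q)"
      using zero_K uv by (intro bracket_cmb[OF Q1_def P2_def]) (auto intro: F_K)
    also have "u2 * v1 - v2 * u1 = - 1" using det by (simp add: algebra_simps)
    also have "cmb (\<lambda>i. Q1 (s i) - P2 0) (Q1 u1 - P2 u2) (Q1 v1 - P2 v2) = cmb e 0 0"
      using s(2) zero_K uv derivation_simps(3)[OF derivation_cmb[of s u1 v1]]
      unfolding cmb_eq_iff by (simp add: P2_def Q1_def cmb_F)
    finally show ?thesis unfolding PQ by (simp add: fun_eq_iff)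
  qed
  have "lie_bracket P2 Q1 = - lie_bracket Q1 P2" by (rule lie_bracket_skew)
  also have "\<dots> = 0" unfolding QP0 by simp
  finally have "commuting_frame m D P2 Q1"
    using cf(1) by (simp add: commuting_frame_def commuting_frame_axioms_def)
  moreover have "L \<subseteq> frame.coef_space m D P2 Q1 ?T ?T F"
  proof
    interpret N: frame m D P2 Q1 by (rule cf(1))
    fix x assume x: "x \<in> L"
    then obtain r p q where x': "x = cmb r p q" using L_cmb by blast
    have xL: "cmb r p q \<in> L" using x x' by simp
    define p' where "p' = p * v2 - q * u2"
    define q' where "q' = q * u1 - p * v1"
    have pT: "p \<in> ?T" by (rule co2[OF xL])
    have pK: "p \<in> K" by (rule coefs_K(2)[OF xL])
    have qF: "q \<in> F" by (rule Q_coef_in_F[OF xL])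
    have "p' \<in> ?T" unfolding p'_def
      using timesT[OF pT, of v2] FT uv qF by (intro lin_closed_minus[OF clT subfield_F]) (auto intro: timesT)
    moreover have "q' \<in> F"
    proof -
      have "v1 * Q p = 0" using P1T[OF pT] P1K[OF pK] P_kills(1)[OF xL] by simp
      then have "v1 = 0 \<or> p \<in> F" using P_kills(1)[OF xL] pK by (auto simp: F_def)
      then have "p * v1 \<in> F" using F_simps(1,4) uv by auto
      then show ?thesis unfolding q'_def by (intro F_simps(6) F_simps(4)[OF qF uv(1)])
    qed
    moreover have "x = comb m D P2 Q1 (\<lambda>i. r i - p' * s i) p' q'"
    proof -
      have "p' * u1 + q' * u2 = p * (u1 * v2 - u2 * v1)" "p' * v1 + q' * v2 = q * (u1 * v2 - u2 * v1)"
        by (simp_all add: p'_def q'_def algebra_simps)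
      then show ?thesis unfolding coords x' det by simp
    qed
    moreover have "r i - p' * s i \<in> ?T" if "i \<in> {1..m}" for i
      using co3[OF xL that] timesT[OF \<open>p' \<in> ?T\<close> s(1)[OF that]]
      by (rule lin_closed_minus[OF clT subfield_F])
    ultimately show "x \<in> N.coef_space ?T ?T F" by (auto intro!: N.coef_spaceI)
  qed
  ultimately show thesis using that[of s] cf(2) unfolding P2_def Q1_def by blast
qed

text \<open>With \<open>a\<close> and \<open>b\<close> dual to \<open>P\<close> and
  \<open>Q\<close>, the coefficients of the bracket have antiderivatives along \<open>P\<close>;
  subtracting these from \<open>Q\<close> makes it commute with \<open>P\<close>.\<close>

lemma straighten2:
  assumes a: "a \<in> K" "P a = 1" "Q a = 0" and b: "b \<in> K" "P b = 0" "Q b = 1"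
  obtains s where "commuting_frame m D P (cmb s 0 1)" "frame.F m D P (cmb s 0 1) = F"
    "L \<subseteq> frame.coef_space m D P (cmb s 0 1) (lin F (monom2 a b)) (lin F (monom1 b)) F"
proof -
  let ?T = "lin F (monom2 a b)" and ?T' = "lin F (monom1 b)"
  have TK: "?T \<subseteq> K" by (rule lin_K[OF monom2_K[OF a(1) b(1)]])
  have TT: "?T' \<subseteq> ?T" by (rule lin_monom1_monom2)
  have FT': "F \<subseteq> ?T'" by (rule F_lin_monom1)
  have FT: "F \<subseteq> ?T" using FT' TT by blast
  have plusT: "f + g \<in> ?T" if "f \<in> ?T" "g \<in> ?T" for f g using lin_plus that .
  have timesT: "f * g \<in> ?T" if "f \<in> ?T" "g \<in> ?T" for f g using lin_monom2_times that .
  have int': "f \<in> ?T'" if f: "f \<in> K" "P f = 0" "Q f \<in> ?T'" for f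
  proof -
    obtain h where h: "h \<in> ?T'" "Q h = Q f" using exists_antiderivative1[OF b(3) f(3)] by blast
    have "f - h \<in> K" using f(1) h(1) TT TK by (auto intro: minus_K)
    moreover have "P (f - h) = 0" "Q (f - h) = 0"
      using f(2) P_lin_zero[OF b(2) h(1)] h(2) by (simp_all add: P_simps(6) Q_simps(6))
    ultimately have "f - h \<in> F" by (simp add: F_def)
    then have "(f - h) + h \<in> ?T'" using FT' h(1) lin_plus by blast
    then show ?thesis by simp
  qed
  have int: "f \<in> ?T" if f: "f \<in> K" "P f \<in> ?T" "Q f \<in> ?T" for f
  proof -
    obtain s where s: "s \<in> ?T" "P s = P f" using exists_antiderivative2[OF a(2) b(2) f(2)] by blast
    have gK: "f - s \<in> K" using f(1) s(1) TK by (auto intro: minus_K)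
    have Pg: "P (f - s) = 0" using s(2) by (simp add: P_simps(6))
    have "Q f - Q s \<in> ?T"
      by (rule lin_closed_minus[OF lin_closed_lin[OF subfield_F] subfield_F f(3)
            Q_lin2[OF a(3) b(3) s(1)]])
    then have "Q (f - s) \<in> ?T" by (simp add: Q_simps(6))
    moreover have "P (Q (f - s)) = 0" using PQ_commute[OF gK] Pg Q_simps(3) by simp
    ultimately have "Q (f - s) \<in> ?T'" by (rule ker_P_lin2[OF a(2) b(2)])
    then have "f - s \<in> ?T'" using int' gK Pg by blast
    then have "(f - s) + s \<in> ?T" using TT s(1) plusT by blast
    then show ?thesis by simp
  qed
  have co1: "e i \<in> ?T" if "i \<in> {1..m}" for i
    by (rule coefs_in(1)[OF FT _ _ _ that]) (fact plusT timesT int)+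
  have co3: "r i \<in> ?T" if "cmb r p q \<in> L" "i \<in> {1..m}" for r p q i
    by (rule coefs_in(3)[OF FT _ _ _ that]) (fact plusT timesT int)+
  have "\<forall>i\<in>{1..m}. \<exists>s. s \<in> ?T \<and> P s = e i" using co1 exists_antiderivative2[OF a(2) b(2)] by blast
  then obtain s where s: "\<And>i. i \<in> {1..m} \<Longrightarrow> s i \<in> ?T" "\<And>i. i \<in> {1..m} \<Longrightarrow> P (s i) = e i"
    by metis
  define Q2 where "Q2 = cmb (\<lambda>i. - s i) 0 1"
  have P': "P = cmb (\<lambda>_. 0) 1 0" by (simp add: comb_P)
  have sK: "- s i \<in> K" if "i \<in> {1..m}" for i using s(1)[OF that] TK uminus_K by blast
  have det0: "1 * 1 - 0 * (0::'a) \<noteq> 0" by simp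
  note cf = change_frame(1,2)[OF P' Q2_def zero_K sK F_simps(2,1,1,2) det0]
  have coords: "comb m D P Q2 r p q =
      cmb (\<lambda>i. r i + p * 0 + q * - s i) (p * 1 + q * 0) (p * 0 + q * 1)" for r p q
    by (rule change_frame(3)[OF P' Q2_def zero_K sK F_simps(2,1,1,2) det0])
  have "lie_bracket P Q2 = 0"
  proof -
    have "lie_bracket P Q2 = cmb (\<lambda>i. P (- s i) - Q2 0) (P 0 - Q2 1) (P 1 - Q2 0) +
        smul (1 * 1 - 0 * 0) (lie_bracket P Q)"
      using zero_K F_simps(1,2) by (intro bracket_cmb[OF P' Q2_def]) (auto intro: F_K)
    also have "cmb (\<lambda>i. P (- s i) - Q2 0) (P 0 - Q2 1) (P 1 - Q2 0) = cmb (\<lambda>i. - e i) 0 0"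
      using s(2) derivation_simps(3,4)[OF derivation_cmb[of "\<lambda>i. - s i" 0 1]]
      unfolding cmb_eq_iff by (simp add: Q2_def P_simps)
    finally show ?thesis unfolding PQ by (simp add: comb_plus comb_zero fun_eq_iff)
  qed
  then have "commuting_frame m D P Q2"
    using cf(1) by (simp add: commuting_frame_def commuting_frame_axioms_def)
  moreover have "L \<subseteq> frame.coef_space m D P Q2 ?T ?T' F"
  proof
    interpret N: frame m D P Q2 by (rule cf(1))
    fix x assume x: "x \<in> L"
    then obtain r p q where x': "x = cmb r p q" using L_cmb by blast
    have xL: "cmb r p q \<in> L" using x x' by simp
    have "p \<in> ?T'" by (rule P_coef_in[OF lin.zero _ xL]) (fact int')
    moreover have qF: "q \<in> F" by (rule Q_coef_in_F[OF xL])
    moreover have "x = comb m D P Q2 (\<lambda>i. r i + q * s i) p q"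
      unfolding coords x' by simp
    moreover have "r i + q * s i \<in> ?T" if "i \<in> {1..m}" for i
      using co3[OF xL that] timesT[OF _ s(1)[OF that], of q] qF FT by (intro plusT) auto
    ultimately show "x \<in> N.coef_space ?T ?T' F" by (auto intro!: N.coef_spaceI)
  qed
  ultimately show thesis using that[of "\<lambda>i. - s i"] cf(2) unfolding Q2_def by blast
qed

text \<open>What the two straightened frames have in common: the new directions are
  \<open>R\<close>-combinations of elements of \<open>L\<close>, so the enclosing algebra has the
  rank of \<open>L\<close> and stays inside every \<open>R\<close>-space that contains
  \<open>L\<close>.\<close>

lemma enclosing_algebra:
  assumes N: "commuting_frame m D P' Q'"
    and P': "P' = cmb s1 u1 v1" and Q': "Q' = cmb s2 u2 v2"
    and M: "M = frame.coef_space m D P' Q' T T' F" and T: "F \<subseteq> T" "F \<subseteq> T'" "lin_closed F T" "lin_closed F T'"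
    and F: "frame.F m D P' Q' = F" and LM: "L \<subseteq> M"
  shows "span_over F L \<subseteq> M" "M \<subseteq> op.span L" "rk M = m + 2"
    "inj_on (frame.directions m D P' Q') {1..m + 2}"
    "basis_over_R M (frame.directions m D P' Q' ` {1..m + 2})"
    "\<forall>i\<in>{1..m + 2}. \<forall>j\<in>{1..m + 2}.
      lie_bracket (frame.directions m D P' Q' i) (frame.directions m D P' Q' j) = 0"
proof -
  interpret N: commuting_frame m D P' Q' by (rule N)
  have FF: "N.F = F" by (rule F)
  have sub: "subspace_over F M"
    using N.subspace_over_coef_space[of T T' F] T closed_F unfolding M FF by blast
  show "span_over F L \<subseteq> M" by (rule span_over_minimal[OF sub LM])
  have inL: "cmb r p q \<in> op.span L" for r p q
    using cmb_in_span op.span_mono[OF directions_L] by blast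
  show "M \<subseteq> op.span L"
  proof
    fix x assume "x \<in> M"
    then obtain r p q where x: "x = N.cmb r p q" unfolding M by (rule N.coef_spaceE) blast
    have "(\<Sum>i\<in>{1..m}. smul (r i) (D i)) + smul p P' + smul q Q' \<in> op.span L"
      using DL inL unfolding P' Q'
      by (intro op.span_add op.span_sum op.span_scale) (auto intro: op.span_base)
    then show "x \<in> op.span L" unfolding x comb_eq_sum .
  qed
  have zero: "0 \<in> T" "0 \<in> T'" "1 \<in> T" "1 \<in> T'" using T F_simps(1,2) by auto
  have "N.directions i \<in> M" if "i \<in> {1..m + 2}" for i
  proof -
    consider "i \<in> {1..m}" | "i = m + 1" | "i = m + 2" using \<open>i \<in> {1..m + 2}\<close> by (auto simp: le_Suc_eq)
    then show ?thesis
    proof cases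
      case 1
      have "N.cmb (\<lambda>j. if j = i then 1 else 0) 0 0 \<in> M"
        unfolding M by (intro N.coef_spaceI) (auto simp: zero F_simps)
      then show ?thesis unfolding comb_D[OF 1] N.directions_simps(1)[OF 1] .
    next
      case 2
      have "N.cmb (\<lambda>_. 0) 1 0 \<in> M" unfolding M by (intro N.coef_spaceI) (auto simp: zero F_simps)
      then show ?thesis unfolding comb_P 2 N.directions_simps .
    next
      case 3
      have "N.cmb (\<lambda>_. 0) 0 1 \<in> M" unfolding M by (intro N.coef_spaceI) (auto simp: zero F_simps)
      then show ?thesis unfolding comb_Q 3 N.directions_simps .
    qed
  qed
  then have "N.directions ` {1..m + 2} \<subseteq> M" by blast
  moreover have "M \<subseteq> {N.cmb r p q | r p q. True}" unfolding M N.coef_space_def by blast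
  ultimately show "rk M = m + 2" "basis_over_R M (N.directions ` {1..m + 2})"
    by (simp_all only: N.rank_and_basis)
  show "inj_on N.directions {1..m + 2}" by (rule N.directions_independent(1))
  have self: "lie_bracket x x = 0" for x :: "'a \<Rightarrow> 'a" by (simp add: lie_bracket_def fun_eq_iff)
  have comm: "lie_bracket P' (D i) = 0" "lie_bracket Q' (D i) = 0" if "i \<in> {1..m}" for i
    using N.commP[OF that] N.commQ[OF that] lie_bracket_skew[of P' "D i"] lie_bracket_skew[of Q' "D i"]
    by simp_all
  have "lie_bracket Q' P' = 0" using N.commPQ lie_bracket_skew[of Q' P'] by simp
  then show "\<forall>i\<in>{1..m + 2}. \<forall>j\<in>{1..m + 2}. lie_bracket (N.directions i) (N.directions j) = 0"
    using N.commP N.commQ N.commD N.commPQ comm self by (auto simp: N.directions_def)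
qed

end

section \<open>The two alternatives\<close>

text \<open>If all coefficients are constants, the first alternative holds. Otherwise some
  function in \<open>K\<close> that is not a constant has constant derivatives under
  \<open>P\<close> and \<open>Q\<close>, and the alternatives in the second case are distinguished
  by the number of independent such functions.\<close>

lemma (in nilpotent_frame) dichotomy:
  "(dim_over F (span_over F L) = enat (m + 2) \<and>
      (lie_abelian (span_over F L) \<or>
       (\<exists>M N. lie_direct_sum F (span_over F L) M N \<and>
          \<not> lie_abelian M \<and> lie_nilpotent F M \<and> dim_over F M = 3 \<and> lie_abelian N)))
   \<or> (dim_over F (span_over F L) \<ge> enat (m + 3) \<and>
      (\<exists>M E. span_over F L \<subseteq> M \<and> M \<subseteq> op.span L \<and>
         lie_subalgebra k0 M \<and> lie_locally_nilpotent k0 M \<and>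
         rk M = m + 2 \<and> inj_on E {1..m + 2} \<and> basis_over_R M (E ` {1..m + 2}) \<and>
         (\<forall>i\<in>{1..m + 2}. \<forall>j\<in>{1..m + 2}. lie_bracket (E i) (E j) = 0) \<and>
         ((\<exists>b. M = L1 F (m + 2) E b \<and> (\<forall>i\<in>{1..m + 1}. E i b = 0) \<and> E (m + 2) b = 1) \<or>
          (\<exists>a b. M = L2 F (m + 2) E a b \<and>
             E (m + 1) a = 1 \<and> E (m + 2) a = 0 \<and> E (m + 1) b = 0 \<and> E (m + 2) b = 1 \<and>
             (\<forall>i\<in>{1..m}. E i a = 0 \<and> E i b = 0)))))"
  (is "?A \<or> _ \<and> (\<exists>M E. ?B M E)")
proof (cases "L \<subseteq> coef_space F F F")
  case True
  then show ?thesis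
    using constant_coefs[OF True] dim_over_coef_space_F unfolding span_over_L_eq[OF True] by blast
next
  case False
  have "\<exists>M E. ?B M E"
  proof (cases "\<exists>a b. a \<in> K \<and> P a = 1 \<and> Q a = 0 \<and> b \<in> K \<and> P b = 0 \<and> Q b = 1")
    case True
    then obtain a b where a: "a \<in> K" "P a = 1" "Q a = 0" and b: "b \<in> K" "P b = 0" "Q b = 1"
      by blast
    obtain s where s: "commuting_frame m D P (cmb s 0 1)" "frame.F m D P (cmb s 0 1) = F"
        "L \<subseteq> frame.coef_space m D P (cmb s 0 1) (lin F (monom2 a b)) (lin F (monom1 b)) F"
      by (rule straighten2[OF a b])
    define Q2 where "Q2 = cmb s 0 1"
    interpret N: commuting_frame m D P Q2 unfolding Q2_def by (rule s(1))
    have NF: "N.F = F" unfolding Q2_def by (rule s(2))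
    define M where "M = N.coef_space (lin F (monom2 a b)) (lin F (monom1 b)) F"
    have P': "P = cmb (\<lambda>_. 0) 1 0" by (simp add: comb_P)
    have FT: "F \<subseteq> lin F (monom1 b)" "F \<subseteq> lin F (monom2 a b)"
      using F_lin_monom1 lin_monom1_monom2 by blast+
    have LM: "L \<subseteq> M" unfolding M_def Q2_def by (rule s(3))
    note enc = enclosing_algebra[OF N.commuting_frame_axioms P' Q2_def M_def FT(2,1)
        lin_closed_lin[OF subfield_F] lin_closed_lin[OF subfield_F] NF LM]
    have "Q2 a = 0" "Q2 b = 1" using a b by (simp_all add: Q2_def cmb_K)
    note form = N.L2_eq_coef_space[OF a(1,2) \<open>Q2 a = 0\<close> b(1,2) \<open>Q2 b = 1\<close> _ N.directions_simps(2,3),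
        of k0, unfolded NF, folded M_def]
    have L2: "M = L2 F (m + 2) N.directions a b" "lie_subalgebra k0 M" "lie_locally_nilpotent k0 M"
      by (simp_all only: form N.directions_simps(1) k0_F)
    have "M = L2 F (m + 2) N.directions a b \<and> N.directions (m + 1) a = 1 \<and> N.directions (m + 2) a = 0 \<and>
        N.directions (m + 1) b = 0 \<and> N.directions (m + 2) b = 1 \<and> (\<forall>i\<in>{1..m}. N.directions i a = 0 \<and> N.directions i b = 0)"
      using L2(1) a b \<open>Q2 a = 0\<close> \<open>Q2 b = 1\<close> unfolding N.directions_simps(2,3)
      by (simp add: N.directions_simps(1) K_def)
    then show ?thesis
      by (intro exI[of _ M] exI[of _ N.directions] conjI enc L2(2,3)) blast
  next
    case no_pair: False
    have "\<exists>s\<in>K. P s \<in> F \<and> Q s \<in> F \<and> s \<notin> F"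
    proof (rule ccontr)
      assume "\<not> ?thesis"
      then have int: "f \<in> F" if "f \<in> K" "P f \<in> F" "Q f \<in> F" for f using that by blast
      have "x \<in> coef_space F F F" if x': "x \<in> L" for x
      proof -
        obtain r p q where x: "x = cmb r p q" using x' L_cmb by blast
        have xL: "cmb r p q \<in> L" using x' x by simp
        have "r i \<in> F" if "i \<in> {1..m}" for i
          by (rule coefs_in(3)[OF order_refl _ _ _ xL that]) (fact F_simps int)+
        moreover have "p \<in> F"
          by (rule coefs_in(2)[OF order_refl _ _ _ xL]) (fact F_simps int)+
        ultimately show ?thesis unfolding x using Q_coef_in_F[OF xL] by (intro coef_spaceI)
      qed
      then show False using \<open>\<not> L \<subseteq> coef_space F F F\<close> by blast
    qed
    then obtain b where b: "b \<in> K" "P b \<in> F" "Q b \<in> F" "b \<notin> F" by blast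
    \<comment> \<open>Two such functions with independent gradients would combine to a pair dual to \<open>P\<close>, \<open>Q\<close>.\<close>
    have prop0: "Q b * P s - P b * Q s = 0" if s: "s \<in> K" "P s \<in> F" "Q s \<in> F" for s
    proof (rule ccontr)
      define d where "d = Q b * P s - P b * Q s"
      assume "Q b * P s - P b * Q s \<noteq> 0"
      then have d: "d \<noteq> 0" "d \<in> F" unfolding d_def using b s by (auto intro!: F_simps(6) F_simps(4))
      \<comment> \<open>Cramer's rule for the gradients of \<open>s\<close> and \<open>b\<close>.\<close>
      define a1 where "a1 = Q b / d * s - Q s / d * b"
      define b1 where "b1 = P s / d * b - P b / d * s"
      have F: "Q b / d \<in> F" "Q s / d \<in> F" "P s / d \<in> F" "P b / d \<in> F"
        using b s d F_simps(8) by auto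
      have "a1 \<in> K" "b1 \<in> K"
        unfolding a1_def b1_def
        by (intro minus_K times_K F_K[OF F(1)] F_K[OF F(2)] F_K[OF F(3)] F_K[OF F(4)] b(1) s(1))+
      moreover have "P a1 = (Q b * P s - P b * Q s) / d" "Q a1 = 0" "P b1 = 0"
        "Q b1 = (Q b * P s - P b * Q s) / d"
        unfolding a1_def b1_def P_simps(6) Q_simps(6) P_F_linear[OF F(1)] P_F_linear[OF F(2)]
          P_F_linear[OF F(3)] P_F_linear[OF F(4)] Q_F_linear[OF F(1)] Q_F_linear[OF F(2)]
          Q_F_linear[OF F(3)] Q_F_linear[OF F(4)]
        by (simp_all add: diff_divide_distrib mult.commute)
      then have "P a1 = 1" "Q a1 = 0" "P b1 = 0" "Q b1 = 1" using d by (simp_all add: d_def)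
      ultimately show False using no_pair by blast
    qed
    \<comment> \<open>Up to the \<open>D i\<close> the new first direction is \<open>Q b P - P b Q\<close>; the second is scaled to map \<open>b\<close> to 1.\<close>
    define u2 where "u2 = (if Q b = 0 then 1 / P b else 0)"
    define v2 where "v2 = (if Q b = 0 then 0 else 1 / Q b)"
    have Pb: "P b \<noteq> 0" if "Q b = 0" using b that by (auto simp: F_def)
    have uv: "Q b \<in> F" "- P b \<in> F" "u2 \<in> F" "v2 \<in> F"
      using b F_simps(1,2,8) F_simps(5) by (auto simp: u2_def v2_def)
    have 1: "Q b * P b + - P b * Q b = 0" by simp
    have 2: "u2 * P b + v2 * Q b = 1" using Pb by (simp add: u2_def v2_def)
    have 3: "Q b * v2 - u2 * - P b = 1" using 2 by (simp add: algebra_simps)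
    have 4: "Q b * P s + - P b * Q s = 0" if "s \<in> K" "P s \<in> F" "Q s \<in> F" for s
      using prop0[OF that] by simp
    obtain s where s: "commuting_frame m D (cmb s (Q b) (- P b)) (cmb (\<lambda>_. 0) u2 v2)"
        "frame.F m D (cmb s (Q b) (- P b)) (cmb (\<lambda>_. 0) u2 v2) = F"
        "L \<subseteq> frame.coef_space m D (cmb s (Q b) (- P b)) (cmb (\<lambda>_. 0) u2 v2)
          (lin F (monom1 b)) (lin F (monom1 b)) F"
      by (rule straighten1[OF b(1) 1 2 uv 3 4])
    define P2 where "P2 = cmb s (Q b) (- P b)"
    define Q2 where "Q2 = cmb (\<lambda>_. 0) u2 v2"
    interpret N: commuting_frame m D P2 Q2 unfolding P2_def Q2_def by (rule s(1))
    have NF: "N.F = F" unfolding P2_def Q2_def by (rule s(2))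
    define M where "M = N.coef_space (lin F (monom1 b)) (lin F (monom1 b)) F"
    have FT: "F \<subseteq> lin F (monom1 b)" by (rule F_lin_monom1)
    have LM: "L \<subseteq> M" unfolding M_def P2_def Q2_def by (rule s(3))
    note enc = enclosing_algebra[OF N.commuting_frame_axioms P2_def Q2_def M_def FT FT
        lin_closed_lin[OF subfield_F] lin_closed_lin[OF subfield_F] NF LM]
    have "P2 b = 0" "Q2 b = 1" using b(1) 1 2 by (simp_all add: P2_def Q2_def cmb_K)
    note form = N.L1_eq_coef_space[OF b(1) \<open>P2 b = 0\<close> \<open>Q2 b = 1\<close> _ N.directions_simps(2,3),
        of k0, unfolded NF, folded M_def]
    have L1: "M = L1 F (m + 2) N.directions b" "lie_subalgebra k0 M" "lie_locally_nilpotent k0 M"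
      by (simp_all only: form N.directions_simps(1) k0_F)
    have "N.directions i b = 0" if "i \<in> {1..m + 1}" for i
      using that b(1) \<open>P2 b = 0\<close> N.directions_simps(1)[of i] N.directions_simps(2)
      by (cases "i = m + 1") (auto simp: K_def)
    then have "M = L1 F (m + 2) N.directions b \<and> (\<forall>i\<in>{1..m + 1}. N.directions i b = 0) \<and> N.directions (m + 2) b = 1"
      using L1(1) \<open>Q2 b = 1\<close> unfolding N.directions_simps(3) by blast
    then show ?thesis
      by (intro exI[of _ M] exI[of _ N.directions] conjI enc L1(2,3)) blast
  qed
  then show ?thesis using dim_over_large[OF False] by blast
qed

section \<open>Choosing a frame\<close>

lemma (in domain_algebra) subfield_base_field: "subfield (base_field scale)"
proof -
  have mult: "scale c 1 * scale d 1 = scale (c * d) 1" for c d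
    by (simp add: scale_mult_left)
  have inv: "inverse (to_fract (scale c 1)) = to_fract (scale (inverse c) 1)" for c
  proof (cases "c = 0")
    case False
    then have "to_fract (scale c 1) * to_fract (scale (inverse c) 1) = 1"
      by (simp add: to_fract_mult[symmetric] mult)
    then show ?thesis by (simp add: inverse_unique)
  qed simp
  show ?thesis
    unfolding subfield_def base_field_def
  proof (intro conjI ballI)
    show "0 \<in> range (\<lambda>c. to_fract (scale c 1))" by (rule range_eqI[of _ _ 0]) simp
    show "1 \<in> range (\<lambda>c. to_fract (scale c 1))" by (rule range_eqI[of _ _ 1]) simp
    fix x assume "x \<in> range (\<lambda>c. to_fract (scale c 1))"
    then obtain c where x: "x = to_fract (scale c 1)" by blast
    show "- x \<in> range (\<lambda>c. to_fract (scale c 1))"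
      by (rule range_eqI[of _ _ "- c"]) (simp add: x)
    show "inverse x \<in> range (\<lambda>c. to_fract (scale c 1))"
      unfolding x inv by blast
    fix y assume "y \<in> range (\<lambda>c. to_fract (scale c 1))"
    then obtain d where y: "y = to_fract (scale d 1)" by blast
    show "x + y \<in> range (\<lambda>c. to_fract (scale c 1))"
      by (rule range_eqI[of _ _ "c + d"]) (simp add: x y scale_left_distrib)
    show "x * y \<in> range (\<lambda>c. to_fract (scale c 1))"
      by (rule range_eqI[of _ _ "c * d"]) (simp add: x y mult[symmetric])
  qed
qed

lemma (in domain_algebra) of_nat_fract_nonzero:
  assumes "k > 0"
  shows "of_nat k \<noteq> (0 :: 'a fract)"
proof -
  have "scale (of_nat k) 1 = of_nat k" by (induction k) (simp_all add: scale_left_distrib)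
  moreover have "scale (of_nat k) 1 \<noteq> 0" using assms by simp
  moreover have "to_fract (of_nat k :: 'a) = of_nat k" by (induction k) simp_all
  ultimately show ?thesis by (metis to_fract_eq_0_iff)
qed

lemma W_derivation:
  assumes "d \<in> W scale"
  shows "derivation d \<and> (\<forall>c\<in>base_field scale. d c = 0)"
  using assms unfolding W_def
proof (induction rule: op.span_induct)
  case base
  show ?case
    unfolding op.subspace_def derivation_def by (auto simp: smul_def algebra_simps)
next
  case (step d)
  then have lin: "Vector_Spaces.linear (fract_scale scale) (fract_scale scale) d"
    and mult: "\<And>x y. d (x * y) = d x * y + x * d y" by (auto simp: Der_def)
  interpret l: Vector_Spaces.linear "fract_scale scale" "fract_scale scale" d by (rule lin)
  have d: "derivation d" using mult l.add by (simp add: derivation_def)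
  have "d (to_fract (scale c 1)) = 0" for c
  proof -
    have "d (fract_scale scale c 1) = fract_scale scale c (d 1)" by (rule l.scale)
    then show ?thesis by (simp add: fract_scale_def derivation_simps(4)[OF d])
  qed
  then show ?case using d by (auto simp: base_field_def)
qed

lemma span_image_comb: "op.span (D ` {1..m}) \<subseteq> {comb m D P Q r 0 0 | r. True}"
proof (rule op.span_minimal)
  show "D ` {1..m} \<subseteq> {comb m D P Q r 0 0 | r. True}"
  proof
    fix x assume "x \<in> D ` {1..m}"
    then obtain j where "j \<in> {1..m}" "x = D j" by blast
    then have "x = comb m D P Q (\<lambda>i. if i = j then 1 else 0) 0 0" by (simp only: comb_D)
    then show "x \<in> {comb m D P Q r 0 0 | r. True}" by blast
  qed
  have "0 \<in> {comb m D P Q r 0 0 | r. True}" using comb_zero[of m D P Q] by (metis (mono_tags) mem_Collect_eq)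
  moreover have "comb m D P Q r 0 0 + comb m D P Q r' 0 0 \<in> {comb m D P Q r 0 0 | r. True}" for r r'
    unfolding comb_plus by auto
  moreover have "smul c (comb m D P Q r 0 0) \<in> {comb m D P Q r 0 0 | r. True}" for c r
    unfolding comb_scale by auto
  ultimately show "op.subspace {comb m D P Q r 0 0 | r. True}"
    unfolding op.subspace_def by blast
qed

lemma span_insert_comb:
  "op.span (insert Q (insert P (D ` {1..m}))) \<subseteq> {comb m D P Q r p q | r p q. True}"
proof
  fix x assume "x \<in> op.span (insert Q (insert P (D ` {1..m})))"
  then obtain q p where "x - smul q Q - smul p P \<in> op.span (D ` {1..m})"
    unfolding op.span_insert by (auto simp: algebra_simps)
  then obtain r where "x - smul q Q - smul p P = comb m D P Q r 0 0"
    using span_image_comb by blast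
  then have "x = comb m D P Q r 0 0 + smul p P + smul q Q" by (simp add: algebra_simps)
  also have "\<dots> = comb m D P Q r p q" by (simp add: comb_eq_sum)
  finally show "x \<in> {comb m D P Q r p q | r p q. True}" by blast
qed

lemma independent_comb:
  assumes inj: "inj_on D {1..m}" and P: "P \<notin> op.span (D ` {1..m})"
    and Q: "Q \<notin> op.span (insert P (D ` {1..m}))" and D: "op.independent (D ` {1..m})"
    and 0: "comb m D P Q r p q = 0"
  shows "(\<forall>i\<in>{1..m}. r i = 0) \<and> p = 0 \<and> q = 0"
proof -
  have sum_in: "(\<Sum>i\<in>{1..m}. smul (r i) (D i)) \<in> op.span (D ` {1..m})"
    by (intro op.span_sum op.span_scale op.span_base) auto
  have eq: "(\<Sum>i\<in>{1..m}. smul (r i) (D i)) + smul p P + smul q Q = 0"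
    using 0 by (simp only: comb_eq_sum)
  have "q = 0"
  proof (rule ccontr)
    assume "q \<noteq> 0"
    have "(\<Sum>i\<in>{1..m}. smul (r i) (D i)) + smul p P \<in> op.span (insert P (D ` {1..m}))"
      using sum_in op.span_mono[of "D ` {1..m}" "insert P (D ` {1..m})"]
      by (intro op.span_add op.span_scale) (auto intro: op.span_base)
    then have "- ((\<Sum>i\<in>{1..m}. smul (r i) (D i)) + smul p P) \<in> op.span (insert P (D ` {1..m}))"
      by (rule op.span_neg)
    moreover have "- ((\<Sum>i\<in>{1..m}. smul (r i) (D i)) + smul p P) = smul q Q"
      using eq by (simp only: add_eq_0_iff)
    ultimately have "smul (inverse q) (smul q Q) \<in> op.span (insert P (D ` {1..m}))"
      by (metis op.span_scale)
    then show False using Q \<open>q \<noteq> 0\<close> by simp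
  qed
  moreover have "p = 0"
  proof (rule ccontr)
    assume "p \<noteq> 0"
    have "- (\<Sum>i\<in>{1..m}. smul (r i) (D i)) \<in> op.span (D ` {1..m})"
      using sum_in by (rule op.span_neg)
    moreover have "- (\<Sum>i\<in>{1..m}. smul (r i) (D i)) = smul p P"
      using eq \<open>q = 0\<close> by (simp add: add_eq_0_iff)
    ultimately have "smul (inverse p) (smul p P) \<in> op.span (D ` {1..m})"
      by (metis op.span_scale)
    then show False using P \<open>p \<noteq> 0\<close> by simp
  qed
  moreover have "r i = 0" if "i \<in> {1..m}" for i
  proof -
    define u where "u = (\<lambda>v. r (inv_into {1..m} D v))"
    have "(\<Sum>v\<in>D ` {1..m}. smul (u v) v) = (\<Sum>i\<in>{1..m}. smul (r i) (D i))"
      unfolding sum.reindex[OF inj] by (intro sum.cong refl) (simp add: u_def inv_into_f_f[OF inj] del: One_nat_def)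
    also have "\<dots> = 0" using eq \<open>p = 0\<close> \<open>q = 0\<close> by simp
    finally have "u (D i) = 0"
      using op.independentD[OF D, of "D ` {1..m}" u "D i"] that by auto
    then show ?thesis using that inj by (simp add: u_def)
  qed
  ultimately show ?thesis by blast
qed

text \<open>The frame consists of central elements, one element that is central modulo their span,
  found by nilpotency, and one more.\<close>

lemma exists_nilpotent_frame:
  fixes L :: "('r::field \<Rightarrow> 'r) set"
  assumes char0: "\<And>k. k > 0 \<Longrightarrow> of_nat k \<noteq> (0::'r)"
    and der: "\<And>d. d \<in> L \<Longrightarrow> derivation d" and k0: "subfield k0" "k0 \<subseteq> constants L"
    and L: "lie_subalgebra k0 L" "lie_nilpotent k0 L"
    and rk: "rk L = m + 2" and m: "m > 0" "rk (lie_center L) \<ge> m"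
  obtains D P Q e where "nilpotent_frame m D P Q k0 L e"
proof -
  let ?Z = "lie_center L"
  obtain B where B: "B \<subseteq> ?Z" "op.independent B" "?Z \<subseteq> op.span B" "card B = op.dim ?Z"
    using op.basis_exists by blast
  have "card B \<ge> m" using m(2) by (simp add: rk_def B(4))
  then obtain B' where B': "B' \<subseteq> B" "card B' = m" "finite B'"
    by (rule obtain_subset_with_card_n)
  obtain D where D: "bij_betw D {1..m} B'" using ex_bij_betw_nat_finite_1[OF B'(3)] B'(2) by blast
  have DB: "D ` {1..m} = B'" and inj: "inj_on D {1..m}" using D by (auto simp: bij_betw_def)
  have indD: "op.independent (D ` {1..m})" using op.independent_mono[OF B(2) B'(1)] DB by simp
  have DZ: "D i \<in> ?Z" if "i \<in> {1..m}" for i using that DB B(1) B'(1) by blast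
  have DL: "D ` {1..m} \<subseteq> L" using DZ by (auto simp: lie_center_def)
  obtain C where C: "C \<subseteq> L" "op.independent C" "L \<subseteq> op.span C" "card C = op.dim L"
    using op.basis_exists by blast
  have cardC: "card C = m + 2" using rk by (simp add: rk_def C(4))
  then have finC: "finite C" using card.infinite by fastforce
  have large: "\<not> L \<subseteq> op.span S" if "finite S" "card S < m + 2" for S
  proof
    assume "L \<subseteq> op.span S"
    then have "C \<subseteq> op.span S" using C(1) by blast
    then have "card C \<le> card S" using op.independent_span_bound[OF that(1) C(2)] by blast
    then show False using that(2) cardC by simp
  qed
  have cardD: "card (D ` {1..m}) = m" by (simp only: DB B'(2))
  have "\<exists>P\<in>L. P \<notin> op.span (D ` {1..m}) \<and> (\<forall>y\<in>L. lie_bracket y P \<in> op.span (D ` {1..m}))"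
  proof (rule ccontr)
    assume neg: "\<not> ?thesis"
    have "x \<in> op.span (D ` {1..m})" if "x \<in> L" for x
      by (rule nilpotent_induct[OF k0(1) L, where \<phi> = "\<lambda>x. x \<in> op.span (D ` {1..m})"])
        (use neg that op.span_zero in auto)
    then show False using large[of "D ` {1..m}"] cardD by auto
  qed
  then obtain P where P: "P \<in> L" "P \<notin> op.span (D ` {1..m})"
      "\<And>y. y \<in> L \<Longrightarrow> lie_bracket y P \<in> op.span (D ` {1..m})" by blast
  have "card (insert P (D ` {1..m})) < m + 2"
    using card_insert_le_m1[of "m + 1" "D ` {1..m}" P] cardD by (simp del: One_nat_def)
  then obtain Q where Q: "Q \<in> L" "Q \<notin> op.span (insert P (D ` {1..m}))"
    using large[of "insert P (D ` {1..m})"] by auto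
  let ?S = "insert Q (insert P (D ` {1..m}))"
  have indS: "op.independent ?S"
    by (intro op.independent_insertI Q(2) P(2) indD)
  have "P \<notin> D ` {1..m}" using P(2) op.span_base[of P "D ` {1..m}"] by blast
  moreover have "Q \<notin> insert P (D ` {1..m})"
    using Q(2) op.span_base[of Q "insert P (D ` {1..m})"] by blast
  ultimately have cardS: "card ?S = m + 2" using cardD by (simp del: One_nat_def)
  have L_S: "L \<subseteq> op.span ?S"
  proof (rule ccontr)
    assume "\<not> L \<subseteq> op.span ?S"
    then obtain x where x: "x \<in> L" "x \<notin> op.span ?S" by blast
    then have "op.independent (insert x ?S)" by (intro op.independent_insertI indS)
    moreover have "insert x ?S \<subseteq> op.span C" using x(1) P(1) Q(1) DL C(3) by blast
    ultimately have "card (insert x ?S) \<le> card C" using op.independent_span_bound[OF finC] by blast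
    moreover have "x \<notin> ?S" using x(2) op.span_base[of x ?S] by blast
    then have "card (insert x ?S) = m + 3" using cardS by (simp del: One_nat_def insert_iff)
    ultimately show False using cardC by simp
  qed
  have L_cmb: "L \<subseteq> {comb m D P Q r p q | r p q. True}" using L_S span_insert_comb by blast
  have in_comb: "\<exists>f. x = comb m D P Q f 0 0" if "x \<in> op.span (D ` {1..m})" for x
    using that span_image_comb by blast
  have central: "lie_bracket (D i) x = 0" if "i \<in> {1..m}" "x \<in> L" for i x
    using DZ that by (simp add: lie_center_def)
  have fr: "frame m D P Q"
  proof
    show "\<And>i. i \<in> {1..m} \<Longrightarrow> derivation (D i)" "derivation P" "derivation Q"
      using der P(1) Q(1) DL by blast+
    show "(\<forall>i\<in>{1..m}. r i = 0) \<and> p = 0 \<and> q = 0" if "comb m D P Q r p q = 0" for r p q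
      using independent_comb[OF inj P(2) Q(2) indD that] .
    show "lie_bracket (D i) (D j) = 0" if "i \<in> {1..m}" "j \<in> {1..m}" for i j
      using central[OF that(1)] DL that(2) by blast
  qed (use char0 central P(1) Q(1) in auto)
  obtain f where f: "lie_bracket Q P = comb m D P Q f 0 0" using in_comb P(3) Q(1) by blast
  have "lie_bracket P Q = - lie_bracket Q P" by (rule lie_bracket_skew)
  then have PQ: "lie_bracket P Q = comb m D P Q (\<lambda>i. - f i) 0 0" by (simp add: f comb_uminus)
  have "constants L = frame.F m D P Q"
    by (rule frame.constants_eq_F[OF fr L_cmb DL P(1) Q(1)])
  then have k0F: "k0 \<subseteq> frame.F m D P Q" using k0(2) by (simp only:)
  have DL': "D i \<in> L" if "i \<in> {1..m}" for i using DL that by blast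
  have PI: "\<exists>f. lie_bracket y P = comb m D P Q f 0 0" if "y \<in> L" for y
    by (rule in_comb[OF P(3)[OF that]])
  have "nilpotent_frame m D P Q k0 L (\<lambda>i. - f i)"
    by (rule nilpotent_frame.intro[OF fr nilpotent_frame_axioms.intro])
      (fact k0(1) L k0F DL' P(1) Q(1) L_cmb central PI PQ)+
  then show thesis by (rule that)
qed

theorem theorem1:
  fixes scale :: "'k::field_char_0 \<Rightarrow> 'a::idom \<Rightarrow> 'a"
    and L :: "('a fract \<Rightarrow> 'a fract) set"
    and n :: nat
  defines "F \<equiv> constants L"
  defines "FL \<equiv> span_over F L"
  assumes "domain_algebra scale"
    and "L \<subseteq> W scale"
    and "lie_subalgebra (base_field scale) L"
    and "lie_nilpotent (base_field scale) L"
    and "rk L = n" and "n \<ge> 3"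
    and "rk (lie_center L) \<ge> n - 2"
  shows
    "(dim_over F FL = enat n \<and>
      (lie_abelian FL \<or>
       (\<exists>M N. lie_direct_sum F FL M N \<and>
          \<not> lie_abelian M \<and> lie_nilpotent F M \<and> dim_over F M = 3 \<and> lie_abelian N)))
     \<or>
     (dim_over F FL \<ge> enat (n + 1) \<and>
      (\<exists>M D. FL \<subseteq> M \<and> M \<subseteq> W scale \<and>
         lie_subalgebra (base_field scale) M \<and> lie_locally_nilpotent (base_field scale) M \<and>
         rk M = n \<and>
         inj_on D {1..n} \<and> basis_over_R M (D ` {1..n}) \<and>
         (\<forall>i\<in>{1..n}. \<forall>j\<in>{1..n}. lie_bracket (D i) (D j) = 0) \<and>
         ((\<exists>b. M = L1 F n D b \<and> (\<forall>i\<in>{1..n - 1}. D i b = 0) \<and> D n b = 1) \<or>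
          (\<exists>a b. M = L2 F n D a b \<and>
             D (n - 1) a = 1 \<and> D n a = 0 \<and> D (n - 1) b = 0 \<and> D n b = 1 \<and>
             (\<forall>i\<in>{1..n - 2}. D i a = 0 \<and> D i b = 0)))))"
proof -
  interpret A: domain_algebra scale by fact
  define m where "m = n - 2"
  have n: "n = m + 2" "n + 1 = m + 3" "n - 1 = m + 1" "n - 2 = m" "m > 0"
    using assms(8) by (auto simp: m_def)
  have der: "derivation d" and zero: "\<forall>c\<in>base_field scale. d c = 0" if "d \<in> L" for d
    using W_derivation that assms(4) by blast+
  have "base_field scale \<subseteq> constants L" using zero by (auto simp: constants_def)
  moreover have "rk L = m + 2" "rk (lie_center L) \<ge> m" using assms(7,9) n by simp_all
  ultimately obtain D P Q e where "nilpotent_frame m D P Q (base_field scale) L e"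
    using exists_nilpotent_frame[of L "base_field scale" m] A.of_nat_fract_nonzero der
      A.subfield_base_field assms(5,6) n(5) by blast
  then interpret N: nilpotent_frame m D P Q "base_field scale" L e .
  have F: "F = N.F" unfolding F_def
    using N.DL by (intro N.constants_eq_F N.L_cmb N.PL N.QL) auto
  have "op.span L \<subseteq> W scale"
    using op.span_mono[OF assms(4)] unfolding W_def by (simp only: op.span_span)
  then have W: "M \<subseteq> W scale" if "M \<subseteq> op.span L" for M using that by blast
  show ?thesis
    using N.dichotomy unfolding F[symmetric] FL_def[symmetric] n(4,3,2) unfolding n(1)
    by (elim disj_forward conj_forward ex_forward W)
qed

end
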